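(* Let $d\ge1$. For all rational $\rho$ with $0<\rho\le\frac12$, $$ 0<a(\rho)\le\frac1{2d}\,\xi(\rho). $$ Moreover, for small densities, $$ a(\rho)>\frac{2}{(3d)^3}\,\xi(\rho)\,\bigl(1-O(\rho^{2/d})\bigr), $$ that is, there exist constants $C<\infty$ and $\rho_0>0$ depending only on $d$ such that $a(\rho)>\frac{2}{(3d)^3}\,\xi(\rho)\,(1-C\rho^{2/d})$ for all rational $\rho$ with $0<\rho<\rho_0$.
   Context: For a finite nonempty domain $\Lambda\subset\mathbb{Z}^d$, the discrete Laplacian $h_\Lambda$ on $\ell_2(\Lambda)$ is $$ h_\Lambda\varphi(x)=-\sum_{y\in\Lambda,\ |y-x|=1}\varphi(y)+2d\,\varphi(x),\qquad x\in\Lambda, $$ where $|\cdot|$ is the $\ell_1$ norm. $S_{\Lambda,N}$ denotes the sum of the $N$ lowest eigenvalues of $h_\Lambda$ (counted with multiplicity). $B(\Lambda)$ is the number of bonds connecting $\Lambda$ with its complement: $$ B(\Lambda)=\bigl|\{(x,y):x\in\Lambda,\ y\in\mathbb{Z}^d\setminus\Lambda,\ |x-y|=1\}\bigr|. $$ For $k\in[-\pi,\pi]^d$ let $\varepsilon_k=2d-2\sum_{i=1}^d\cos k_i$. For $\rho\in[0,1]$ the Fermi level $\varepsilon_{\rm F}(\rho)$ is defined by $$ \rho=\frac1{(2\pi)^d}\int_{\varepsilon_k<\varepsilon_{\rm F}(\rho)}\mathrm{d}k, $$ and the ground state energy per site of free fermions is $$ e(\rho)=\frac1{(2\pi)^d}\int_{\varepsilon_k<\varepsilon_{\rm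 F}(\rho)}\varepsilon_k\,\mathrm{d}k $$ (integrals over $k\in[-\pi,\pi]^d$). Set $$ \xi(\rho)=\rho\,\varepsilon_{\rm F}(\rho)-e(\rho). $$ For rational $\rho\in[0,1]$, define $$ a(\rho)=\inf_\Lambda\frac{S_{\Lambda,N}-e(\rho)|\Lambda|}{B(\Lambda)}, $$ where the infimum is over all finite nonempty domains $\Lambda\subset\mathbb{Z}^d$ such that $N=\rho|\Lambda|$ is an integer. *)

theory Defs
  imports "HOL-Analysis.Analysis" "HOL-Library.Multiset" "HOL-Library.Function_Algebras"
begin

text \<open>
  The lattice is \<open>int ^ 'n\<close>, with dimension \<open>d = CARD('n)\<close>. Quantities that depend on the
  dimension but have no argument of type \<open>int ^ 'n\<close> or \<open>real ^ 'n\<close> take \<open>TYPE('n)\<close> instead.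
\<close>

definition l1_norm :: "int ^ 'n::finite \<Rightarrow> int" where
  "l1_norm x = (\<Sum>i\<in>UNIV. \<bar>x $ i\<bar>)"

text \<open>
  \<open>\<ell>\<^sub>2(\<Lambda>)\<close> for finite \<open>\<Lambda>\<close> is encoded as the complex functions on the whole lattice that vanish
  off \<open>\<Lambda>\<close>.
\<close>

definition l2 :: "(int ^ 'n::finite) set \<Rightarrow> (int ^ 'n \<Rightarrow> complex) set" where
  "l2 \<Lambda> = {\<phi>. \<forall>x. x \<notin> \<Lambda> \<longrightarrow> \<phi> x = 0}"

definition laplacian :: "(int ^ 'n::finite) set \<Rightarrow> (int ^ 'n \<Rightarrow> complex) \<Rightarrow> (int ^ 'n \<Rightarrow> complex)" where
  "laplacian \<Lambda> \<phi> =
    (\<lambda>x. if x \<in> \<Lambda>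
         then - (\<Sum>y | y \<in> \<Lambda> \<and> l1_norm (y - x) = 1. \<phi> y) + 2 * of_nat CARD('n) * \<phi> x
         else 0)"

definition fun_scale :: "complex \<Rightarrow> ('a \<Rightarrow> complex) \<Rightarrow> ('a \<Rightarrow> complex)" where
  "fun_scale c \<phi> = (\<lambda>x. c * \<phi> x)"

global_interpretation cfun: vector_space "fun_scale :: complex \<Rightarrow> ('a \<Rightarrow> complex) \<Rightarrow> ('a \<Rightarrow> complex)"
  by unfold_locales (auto simp: fun_scale_def fun_eq_iff algebra_simps)

text \<open>
  The operator is self-adjoint on \<open>\<ell>\<^sub>2(\<Lambda>)\<close>: only real eigenvalues need be considered, and the
  multiplicity of an eigenvalue is the dimension of its eigenspace.
\<close>

definition eigenspace :: "(int ^ 'n::finite) set \<Rightarrow> real \<Rightarrow> (int ^ 'n \<Rightarrow> complex) set" where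
  "eigenspace \<Lambda> \<mu> = {\<phi> \<in> l2 \<Lambda>. laplacian \<Lambda> \<phi> = fun_scale (of_real \<mu>) \<phi>}"

definition eig_mult :: "(int ^ 'n::finite) set \<Rightarrow> real \<Rightarrow> nat" where
  "eig_mult \<Lambda> \<mu> = cfun.dim (eigenspace \<Lambda> \<mu>)"

definition eigenvalues :: "(int ^ 'n::finite) set \<Rightarrow> real multiset" where
  "eigenvalues \<Lambda> = (\<Sum>\<mu> | eigenspace \<Lambda> \<mu> \<noteq> {0}. replicate_mset (eig_mult \<Lambda> \<mu>) \<mu>)"

definition lowest_sum :: "(int ^ 'n::finite) set \<Rightarrow> nat \<Rightarrow> real" where
  "lowest_sum \<Lambda> N = sum_list (take N (sorted_list_of_multiset (eigenvalues \<Lambda>)))"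

definition boundary_bonds :: "(int ^ 'n::finite) set \<Rightarrow> nat" where
  "boundary_bonds \<Lambda> = card {(x, y). x \<in> \<Lambda> \<and> y \<notin> \<Lambda> \<and> l1_norm (x - y) = 1}"

definition dispersion :: "real ^ 'n::finite \<Rightarrow> real" where
  "dispersion k = 2 * real CARD('n) - 2 * (\<Sum>i\<in>UNIV. cos (k $ i))"

definition fermi_sea :: "real \<Rightarrow> (real ^ 'n::finite) set" where
  "fermi_sea E = {k \<in> cbox (\<chi> i. - pi) (\<chi> i. pi). dispersion k < E}"

text \<open>
  The defining equation has exactly one solution if \<open>0 < \<rho> < 1\<close>. Restricting to the range
  \<open>[0, 4 d]\<close> of the dispersion relation makes it unique for \<open>\<rho> = 0\<close> and \<open>\<rho> = 1\<close> as well.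
\<close>

definition fermi_level :: "'n::finite itself \<Rightarrow> real \<Rightarrow> real" where
  "fermi_level _ \<rho> =
    (THE E. 0 \<le> E \<and> E \<le> 4 * real CARD('n) \<and>
      \<rho> = 1 / (2 * pi) ^ CARD('n) * measure lborel (fermi_sea E :: (real ^ 'n) set))"

definition energy_density :: "'n::finite itself \<Rightarrow> real \<Rightarrow> real" where
  "energy_density T \<rho> =
    1 / (2 * pi) ^ CARD('n) *
      (LINT k : (fermi_sea (fermi_level T \<rho>) :: (real ^ 'n) set) | lborel. dispersion k)"

definition xi :: "'n::finite itself \<Rightarrow> real \<Rightarrow> real" where
  "xi T \<rho> = \<rho> * fermi_level T \<rho> - energy_density T \<rho>"

text \<open>
  The infimum is taken in the extended reals, so that it has its usual meaning without knowing
  beforehand that the index set is nonempty and the quotients are bounded below.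
\<close>

definition boundary_const :: "'n::finite itself \<Rightarrow> real \<Rightarrow> ereal" where
  "boundary_const T \<rho> =
    (INF (\<Lambda>, N) \<in> {(\<Lambda> :: (int ^ 'n) set, N :: nat).
                     finite \<Lambda> \<and> \<Lambda> \<noteq> {} \<and> real N = \<rho> * real (card \<Lambda>)}.
       ereal ((lowest_sum \<Lambda> N - energy_density T \<rho> * real (card \<Lambda>)) / real (boundary_bonds \<Lambda>)))"

end

theory Submission
  imports Defs "HOL-Computational_Algebra.Fundamental_Theorem_Algebra"
begin

text \<open>
  Let \<open>f\<^sub>k\<close> be the plane wave \<open>e\<^bsup>ikx\<^esup>\<close> cut off to \<open>\<Lambda>\<close>. Then \<open>h f\<^sub>k = \<epsilon>\<^sub>k f\<^sub>k + b\<^sub>k\<close> with \<open>b\<^sub>k\<close> supported on the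
  boundary sites, and the squared norm of \<open>b\<^sub>k\<close> has average at least \<open>B(\<Lambda>)\<close>. Let \<open>P\<close> be the
  spectral projection of \<open>h\<close> below the Fermi level \<open>E\<close>. Averaged over \<open>k\<close>, the energy excess is at
  least \<open>(E - \<epsilon>\<^sub>k) |(1-P) f\<^sub>k|\<^sup>2\<close> inside the Fermi sea plus \<open>(\<epsilon>\<^sub>k - E) |P f\<^sub>k|\<^sup>2\<close> outside, and on an
  eigenvector with eigenvalue \<open>\<mu>\<close> the components satisfy \<open>(\<mu> - \<epsilon>\<^sub>k) f\<^sub>k = b\<^sub>k\<close>. So a small excess
  would force \<open>P b\<^sub>k\<close> to be \<open>b\<^sub>k\<close> inside the sea and \<open>0\<close> outside. But the Fourier coefficient of
  \<open>P b\<^sub>k(x)\<close> at \<open>x \<in> \<Lambda>\<close> vanishes, because \<open>b\<^sub>k\<close> only involves frequencies outside \<open>\<Lambda>\<close>, whereas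
  that of \<open>b\<^sub>k(x)\<close> restricted to the sea is a positive multiple of the number of bonds leaving \<open>x\<close>.

  At low density \<open>b\<^sub>k\<close> is almost orthogonal to the range of \<open>P\<close>, and
  \<open>r\<^sup>2 (3d - r) \<le> 4d\<^sup>3\<close> for \<open>r = \<mu> - \<epsilon>\<^sub>k\<close> bounds \<open>|(1-P) f\<^sub>k|\<^sup>2\<close> from below by \<open>B(\<Lambda>) / (10 d\<^sup>2)\<close>.
  This beats \<open>2 / (3d)\<^sup>3\<close> with room to spare, so the correction term can be dropped (\<open>C = 0\<close>).

  For the upper bound, take a large cube together with many isolated sites: all particles go into
  the cube, an isolated site costs \<open>\<xi>\<close> in energy and contributes \<open>2d\<close> bonds, and the boundary of the
  cube is negligible.
\<close>

section \<open>Self-adjoint operators on finite domains\<close>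

lemma sum_fun_apply: "(\<Sum>i\<in>I. f i) x = (\<Sum>i\<in>I. f i x)"
  by (induction I rule: infinite_finite_induct) simp_all

definition ip :: "'a set \<Rightarrow> ('a \<Rightarrow> complex) \<Rightarrow> ('a \<Rightarrow> complex) \<Rightarrow> complex" where
  "ip \<Lambda> f g = (\<Sum>x\<in>\<Lambda>. cnj (f x) * g x)"

definition sqn :: "'a set \<Rightarrow> ('a \<Rightarrow> complex) \<Rightarrow> real" where
  "sqn \<Lambda> f = (\<Sum>x\<in>\<Lambda>. (cmod (f x))\<^sup>2)"

definition orthonormal :: "'a set \<Rightarrow> ('a \<Rightarrow> complex) set \<Rightarrow> bool" where
  "orthonormal \<Lambda> \<Phi> \<longleftrightarrow> (\<forall>f\<in>\<Phi>. \<forall>g\<in>\<Phi>. ip \<Lambda> f g = (if f = g then 1 else 0))"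

lemma ip_cnj: "cnj (ip \<Lambda> f g) = ip \<Lambda> g f"
  by (simp add: ip_def mult.commute)

lemma ip_self: "ip \<Lambda> f f = of_real (sqn \<Lambda> f)"
  unfolding ip_def sqn_def of_real_sum
  by (intro sum.cong refl) (simp only: complex_norm_square mult.commute)

lemma ip_sum_right: "ip \<Lambda> f (\<lambda>x. \<Sum>i\<in>I. c i * g i x) = (\<Sum>i\<in>I. c i * ip \<Lambda> f (g i))"
  unfolding ip_def sum_distrib_left by (subst sum.swap) (simp add: algebra_simps)

lemma ip_sum_left: "ip \<Lambda> (\<lambda>x. \<Sum>i\<in>I. c i * g i x) f = (\<Sum>i\<in>I. cnj (c i) * ip \<Lambda> (g i) f)"
  unfolding ip_def sum_distrib_left cnj_sum sum_distrib_right
  by (subst sum.swap) (simp add: algebra_simps)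

lemma ip_diff_right: "ip \<Lambda> f (\<lambda>x. g x - h x) = ip \<Lambda> f g - ip \<Lambda> f h"
  by (simp add: ip_def algebra_simps sum_subtractf)

lemma ip_scale_right: "ip \<Lambda> f (\<lambda>x. c * g x) = c * ip \<Lambda> f g"
  by (simp add: ip_def sum_distrib_left algebra_simps)

lemma ip_scale_left: "ip \<Lambda> (\<lambda>x. c * f x) g = cnj c * ip \<Lambda> f g"
  by (simp add: ip_def sum_distrib_left algebra_simps)

lemma sqn_nonneg: "0 \<le> sqn \<Lambda> f"
  by (simp add: sqn_def sum_nonneg)

lemma sqn_eq_0: "finite \<Lambda> \<Longrightarrow> sqn \<Lambda> f = 0 \<longleftrightarrow> (\<forall>x\<in>\<Lambda>. f x = 0)"
  by (simp add: sqn_def sum_nonneg_eq_0_iff)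

lemma orthonormal_combination:
  assumes "orthonormal \<Lambda> \<Phi>" "finite \<Phi>" "\<phi> \<in> \<Phi>" "J \<subseteq> \<Phi>"
  shows "ip \<Lambda> \<phi> (\<lambda>x. \<Sum>f\<in>J. c f * f x) = (if \<phi> \<in> J then c \<phi> else 0)"
proof -
  have fin: "finite J" using assms finite_subset by blast
  have "ip \<Lambda> \<phi> (\<lambda>x. \<Sum>f\<in>J. c f * f x) = (\<Sum>f\<in>J. if f = \<phi> then c \<phi> else 0)"
    unfolding ip_sum_right using assms
    by (intro sum.cong) (auto simp: orthonormal_def subset_iff)
  then show ?thesis using fin by (simp add: sum.delta)
qed

lemma sqn_combination:
  assumes "orthonormal \<Lambda> \<Phi>" "finite \<Phi>" "J \<subseteq> \<Phi>"
  shows "sqn \<Lambda> (\<lambda>x. \<Sum>f\<in>J. c f * f x) = (\<Sum>f\<in>J. (cmod (c f))\<^sup>2)"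
proof -
  have "of_real (sqn \<Lambda> (\<lambda>x. \<Sum>f\<in>J. c f * f x))
      = (\<Sum>f\<in>J. cnj (c f) * ip \<Lambda> f (\<lambda>x. \<Sum>f\<in>J. c f * f x))"
    unfolding ip_self[symmetric] by (subst ip_sum_left) simp
  also have "\<dots> = (\<Sum>f\<in>J. cnj (c f) * c f)"
    using assms by (intro sum.cong refl) (subst orthonormal_combination[of \<Lambda> \<Phi>], auto)
  also have "\<dots> = of_real (\<Sum>f\<in>J. (cmod (c f))\<^sup>2)"
    unfolding of_real_sum by (intro sum.cong refl) (simp only: complex_norm_square mult.commute)
  finally show ?thesis by (simp only: of_real_eq_iff)
qed

text \<open>Subtracting from \<open>\<psi>\<close> its projection \<open>?p\<close> leaves a vector
  whose squared norm is the difference of the two sides, and squared norms are nonnegative.\<close>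

lemma bessel:
  assumes on: "orthonormal \<Lambda> \<Phi>" and fin: "finite \<Phi>"
  shows "(\<Sum>f\<in>\<Phi>. (cmod (ip \<Lambda> f \<psi>))\<^sup>2) \<le> sqn \<Lambda> \<psi>"
proof -
  let ?p = "\<lambda>x. \<Sum>f\<in>\<Phi>. ip \<Lambda> f \<psi> * f x"
  let ?s = "\<Sum>f\<in>\<Phi>. (cmod (ip \<Lambda> f \<psi>))\<^sup>2"
  have pp: "ip \<Lambda> ?p ?p = of_real ?s"
    unfolding ip_self sqn_combination[OF on fin order_refl] ..
  have p\<psi>: "ip \<Lambda> ?p \<psi> = of_real ?s"
    unfolding ip_sum_left of_real_sum
    by (intro sum.cong refl) (simp only: complex_norm_square mult.commute)
  then have \<psi>p: "ip \<Lambda> \<psi> ?p = of_real ?s"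
    using ip_cnj[of \<Lambda> ?p \<psi>] by simp
  have "ip \<Lambda> (\<lambda>x. \<psi> x - ?p x) (\<lambda>x. \<psi> x - ?p x)
      = ip \<Lambda> \<psi> \<psi> - ip \<Lambda> \<psi> ?p - ip \<Lambda> ?p \<psi> + ip \<Lambda> ?p ?p"
    unfolding ip_def by (simp add: algebra_simps sum_subtractf sum.distrib)
  also have "\<dots> = of_real (sqn \<Lambda> \<psi> - ?s)"
    unfolding pp p\<psi> \<psi>p unfolding ip_self by simp
  finally have "of_real (sqn \<Lambda> (\<lambda>x. \<psi> x - ?p x)) = (of_real (sqn \<Lambda> \<psi> - ?s) :: complex)"
    by (simp only: ip_self)
  then show ?thesis using sqn_nonneg[of \<Lambda> "\<lambda>x. \<psi> x - ?p x"] by (simp only: of_real_eq_iff)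
qed

text \<open>Bessel for the point mass at \<open>y\<close> bounds the sum of \<open>|f y|^2\<close>
  over the family by 1; summing over \<open>y\<close> and exchanging the sums counts each unit
  vector once.\<close>

lemma card_orthonormal_le:
  assumes "orthonormal \<Lambda> \<Phi>" "finite \<Phi>" "finite \<Lambda>"
  shows "card \<Phi> \<le> card \<Lambda>"
proof -
  have "(\<Sum>f\<in>\<Phi>. (cmod (f y))\<^sup>2) \<le> 1" if "y \<in> \<Lambda>" for y
  proof -
    have "ip \<Lambda> f (\<lambda>x. if x = y then 1 else 0) = cnj (f y)" for f
      using that assms(3) by (simp add: ip_def if_distrib cong: if_cong)
    moreover have "sqn \<Lambda> (\<lambda>x. if x = y then 1 else 0) = 1"
      using that assms(3) by (simp add: sqn_def if_distrib[of "\<lambda>z. (cmod z)\<^sup>2"] cong: if_cong)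
    ultimately show ?thesis
      using bessel[OF assms(1,2), of "\<lambda>x. if x = y then 1 else 0"] by simp
  qed
  then have "(\<Sum>y\<in>\<Lambda>. \<Sum>f\<in>\<Phi>. (cmod (f y))\<^sup>2) \<le> (\<Sum>y\<in>\<Lambda>. 1)"
    by (intro sum_mono) auto
  moreover have "(\<Sum>y\<in>\<Lambda>. \<Sum>f\<in>\<Phi>. (cmod (f y))\<^sup>2) = (\<Sum>f\<in>\<Phi>. sqn \<Lambda> f)"
    unfolding sqn_def by (rule sum.swap)
  moreover have "sqn \<Lambda> f = 1" if "f \<in> \<Phi>" for f
    using assms(1) that ip_self[of \<Lambda> f] unfolding orthonormal_def by (metis of_real_eq_1_iff)
  ultimately show ?thesis by simp
qed

section \<open>Spectral theorem for self-adjoint operators on a finite domain\<close>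

locale self_adjoint =
  fixes \<Lambda> :: "(int ^ 'n::finite) set" and T :: "(int ^ 'n \<Rightarrow> complex) \<Rightarrow> (int ^ 'n \<Rightarrow> complex)"
  assumes finite_domain: "finite \<Lambda>"
    and maps: "f \<in> l2 \<Lambda> \<Longrightarrow> T f \<in> l2 \<Lambda>"
    and lin: "T (\<lambda>x. a * f x + b * g x) = (\<lambda>x. a * T f x + b * T g x)"
    and sym: "f \<in> l2 \<Lambda> \<Longrightarrow> g \<in> l2 \<Lambda> \<Longrightarrow> ip \<Lambda> (T f) g = ip \<Lambda> f (T g)"
begin

text \<open>This is \<open>p(T) v\<close>, the operator substituted into the polynomial.\<close>

definition poly_app :: "complex poly \<Rightarrow> (int ^ 'n \<Rightarrow> complex) \<Rightarrow> (int ^ 'n \<Rightarrow> complex)" where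
  "poly_app p v = (\<lambda>x. \<Sum>i\<le>degree p. coeff p i * (T ^^ i) v x)"

lemma poly_app_bound:
  "degree p \<le> n \<Longrightarrow> poly_app p v x = (\<Sum>i\<le>n. coeff p i * (T ^^ i) v x)"
  unfolding poly_app_def by (rule sum.mono_neutral_left) (auto simp: coeff_eq_0)

lemma iter_lin: "(T ^^ i) (\<lambda>x. a * f x + b * g x) = (\<lambda>x. a * (T ^^ i) f x + b * (T ^^ i) g x)"
  by (induction i) (simp_all add: lin)

lemma iter_l2: "f \<in> l2 \<Lambda> \<Longrightarrow> (T ^^ i) f \<in> l2 \<Lambda>"
  by (induction i) (simp_all add: maps)

text \<open>The coefficients of \<open>(X - z) q\<close> are those of \<open>X q\<close> minus
  \<open>z\<close> times those of \<open>q\<close>; an index shift in the first sum moves one power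
  of \<open>T\<close> onto \<open>v\<close>.\<close>

lemma poly_app_root:
  "poly_app ([:- z, 1:] * q) v = poly_app q (\<lambda>x. T v x - z * v x)"
proof
  fix x
  let ?n = "degree q"
  have l: "(T ^^ i) (\<lambda>x. T v x - z * v x) y = (T ^^ Suc i) v y - z * (T ^^ i) v y" for i y
    using iter_lin[of i 1 "T v" "- z" v] by (simp add: funpow_swap1)
  have d: "degree ([:- z, 1:] * q) \<le> Suc ?n"
    using degree_mult_le[of "[:- z, 1:]" q] by simp
  have "poly_app ([:- z, 1:] * q) v x
      = (\<Sum>i\<le>Suc ?n. coeff (pCons 0 q) i * (T ^^ i) v x) - z * (\<Sum>i\<le>Suc ?n. coeff q i * (T ^^ i) v x)"
    unfolding poly_app_bound[OF d] sum_distrib_left sum_subtractf[symmetric]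
    by (intro sum.cong refl) (simp add: algebra_simps)
  also have "(\<Sum>i\<le>Suc ?n. coeff (pCons 0 q) i * (T ^^ i) v x) = (\<Sum>i\<le>?n. coeff q i * (T ^^ Suc i) v x)"
    unfolding sum.atMost_Suc_shift by simp
  also have "(\<Sum>i\<le>Suc ?n. coeff q i * (T ^^ i) v x) = (\<Sum>i\<le>?n. coeff q i * (T ^^ i) v x)"
    by (simp add: coeff_eq_0)
  also have "(\<Sum>i\<le>?n. coeff q i * (T ^^ Suc i) v x) - z * (\<Sum>i\<le>?n. coeff q i * (T ^^ i) v x)
      = poly_app q (\<lambda>x. T v x - z * v x) x"
    unfolding poly_app_def l by (simp add: algebra_simps sum_subtractf sum_distrib_left)
  finally show "poly_app ([:- z, 1:] * q) v x = poly_app q (\<lambda>x. T v x - z * v x) x" .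
qed

lemma poly_app_degree_0: "degree p = 0 \<Longrightarrow> poly_app p v = (\<lambda>x. coeff p 0 * v x)"
  by (simp add: poly_app_def)

text \<open>Induction on the degree with a complex root \<open>z\<close>: either
  \<open>T v = z v\<close>, or \<open>T v - z v\<close> is a nonzero vector of \<open>V\<close>
  annihilated by the cofactor. Carrying \<open>V\<close> along allows the eigenvector to be sought
  inside an orthogonal complement.\<close>

lemma eigenvector_of_poly:
  assumes inv: "\<And>f. f \<in> V \<Longrightarrow> T f \<in> V" and sub: "\<And>a b f g. f \<in> V \<Longrightarrow> g \<in> V \<Longrightarrow> (\<lambda>x. a * f x + b * g x) \<in> V"
  shows "p \<noteq> 0 \<Longrightarrow> v \<in> V \<Longrightarrow> v \<noteq> (\<lambda>x. 0) \<Longrightarrow> poly_app p v = (\<lambda>x. 0)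
    \<Longrightarrow> \<exists>w\<in>V. \<exists>z. w \<noteq> (\<lambda>x. 0) \<and> T w = (\<lambda>x. z * w x)"
proof (induction "degree p" arbitrary: p v)
  case 0
  then have "coeff p 0 \<noteq> 0" by (metis leading_coeff_0_iff)
  with 0 have "v = (\<lambda>x. 0)" by (auto simp: poly_app_degree_0 fun_eq_iff)
  with 0 show ?case by simp
next
  case (Suc n)
  then have "\<not> constant (poly p)" by (simp add: constant_degree)
  then obtain z where z: "poly p z = 0" using fundamental_theorem_of_algebra by blast
  then obtain q where q: "p = [:- z, 1:] * q" by (metis dvdE poly_eq_0_iff_dvd)
  with Suc.prems have q0: "q \<noteq> 0" by auto
  have "degree p = Suc (degree q)" unfolding q using q0 by (subst degree_mult_eq) auto
  with Suc.hyps have n: "n = degree q" by simp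
  let ?w = "\<lambda>x. T v x - z * v x"
  have w: "?w \<in> V" using sub[OF inv[OF Suc.prems(2)] Suc.prems(2), of 1 "- z"] by simp
  show ?case
  proof (cases "?w = (\<lambda>x. 0)")
    case True
    then have "T v = (\<lambda>x. z * v x)" by (auto simp: fun_eq_iff)
    with Suc.prems show ?thesis by blast
  next
    case False
    show ?thesis
      using Suc.hyps(1)[OF n q0 w False] Suc.prems(4) unfolding q poly_app_root by simp
  qed
qed

text \<open>The iterates \<open>v, T v, ..., T^n v\<close> with \<open>n = card \<Lambda>\<close>
  lie in the span of \<open>n\<close> point masses, so they satisfy a linear relation, whose
  coefficients form the polynomial.\<close>

lemma annihilating_poly:
  assumes v: "v \<in> l2 \<Lambda>"
  shows "\<exists>p. p \<noteq> 0 \<and> poly_app p v = (\<lambda>x. 0)"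
proof -
  define n where "n = card \<Lambda>"
  define it where "it i = (T ^^ i) v" for i
  have "\<exists>c. (\<exists>i\<le>n. c i \<noteq> 0) \<and> (\<forall>x. (\<Sum>i\<le>n. c i * it i x) = 0)"
  proof (cases "inj_on it {..n}")
    \<comment> \<open>Dependence is a property of sets and does not see a repeated iterate, but a
      repetition is a linear relation by itself.\<close>
    case False
    then obtain i j where ij: "i \<le> n" "j \<le> n" "i \<noteq> j" "it i = it j" by (auto simp: inj_on_def)
    let ?c = "\<lambda>k. if k = i then 1 else if k = j then - 1 else (0::complex)"
    have "(\<Sum>k\<le>n. ?c k * it k x) = 0" for x
    proof -
      have "(\<Sum>k\<le>n. ?c k * it k x)
          = (\<Sum>k\<le>n. (if k = i then it i x else 0) - (if k = j then it j x else 0))"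
        using ij by (intro sum.cong) auto
      also have "\<dots> = 0" using ij by (simp add: sum_subtractf)
      finally show ?thesis .
    qed
    with ij show ?thesis by (intro exI[of _ ?c]) auto
  next
    case True
    define \<delta> where "\<delta> y = (\<lambda>x. if x = y then 1 else (0::complex))" for y :: "int ^ 'n"
    have "it ` {..n} \<subseteq> cfun.span (\<delta> ` \<Lambda>)"
    proof clarify
      fix i
      have "it i \<in> l2 \<Lambda>" unfolding it_def by (rule iter_l2[OF v])
      then have "it i = (\<Sum>y\<in>\<Lambda>. fun_scale (it i y) (\<delta> y))"
        by (intro ext) (auto simp: l2_def fun_scale_def \<delta>_def sum_fun_apply if_distrib
            finite_domain cong: if_cong)
      also have "\<dots> \<in> cfun.span (\<delta> ` \<Lambda>)"
        by (intro cfun.span_sum cfun.span_scale cfun.span_base) auto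
      finally show "it i \<in> cfun.span (\<delta> ` \<Lambda>)" .
    qed
    moreover have "card (\<delta> ` \<Lambda>) \<le> n" unfolding n_def by (rule card_image_le[OF finite_domain])
    moreover have "card (it ` {..n}) = Suc n" using True by (simp add: card_image)
    ultimately have "cfun.dependent (it ` {..n})"
      using cfun.independent_span_bound[of "\<delta> ` \<Lambda>" "it ` {..n}"] finite_domain by fastforce
    then obtain u where u: "\<exists>w\<in>it ` {..n}. u w \<noteq> 0" "(\<Sum>w\<in>it ` {..n}. fun_scale (u w) w) = 0"
      using cfun.dependent_finite[of "it ` {..n}"] by auto
    have "(\<Sum>i\<le>n. u (it i) * it i x) = 0" for x
    proof -
      have "(\<Sum>i\<le>n. fun_scale (u (it i)) (it i)) = 0"
        using u(2) True by (simp add: sum.reindex)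
      then have "(\<Sum>i\<le>n. fun_scale (u (it i)) (it i)) x = 0" by simp
      then show ?thesis by (simp add: sum_fun_apply fun_scale_def)
    qed
    with u(1) show ?thesis by (intro exI[of _ "\<lambda>i. u (it i)"]) auto
  qed
  then obtain c where c: "\<exists>i\<le>n. c i \<noteq> 0" "\<And>x. (\<Sum>i\<le>n. c i * it i x) = 0" by blast
  define p where "p = (\<Sum>i\<le>n. monom (c i) i)"
  have co: "coeff p i = (if i \<le> n then c i else 0)" for i
    by (simp add: p_def coeff_sum if_distrib cong: if_cong)
  have "degree p \<le> n" using co by (intro degree_le) auto
  then have "poly_app p v = (\<lambda>x. 0)"
    using c(2) by (intro ext) (simp add: poly_app_bound co it_def)
  moreover have "p \<noteq> 0" using c(1) co by (metis coeff_0)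
  ultimately show ?thesis by blast
qed

lemma real_eigenvalue:
  assumes "w \<in> l2 \<Lambda>" "w \<noteq> (\<lambda>x. 0)" "T w = (\<lambda>x. z * w x)"
  shows "z \<in> \<real>"
proof -
  have "cnj z * ip \<Lambda> w w = z * ip \<Lambda> w w"
    using sym[OF assms(1,1)] unfolding assms(3) by (simp add: ip_scale_left ip_scale_right)
  moreover have "ip \<Lambda> w w \<noteq> 0"
    using assms(1,2) finite_domain by (fastforce simp: ip_self sqn_eq_0 l2_def fun_eq_iff)
  ultimately have "cnj z = z" by simp
  then show ?thesis by (simp add: Reals_cnj_iff)
qed

text \<open>Take an orthonormal family of eigenvectors of maximal size. If the expansion failed for
  some \<open>\<psi>\<close>, the residual \<open>v\<close> would be a nonzero vector of the
  orthogonal complement \<open>V\<close>, which is \<open>T\<close>-invariant by symmetry; an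
  eigenvector in \<open>V\<close>, normalised, would enlarge the family.\<close>

theorem eigenbasis:
  "\<exists>\<Phi> ev. finite \<Phi> \<and> \<Phi> \<subseteq> l2 \<Lambda> \<and> orthonormal \<Lambda> \<Phi> \<and>
    (\<forall>\<phi>\<in>\<Phi>. T \<phi> = fun_scale (of_real (ev \<phi>)) \<phi>) \<and>
    (\<forall>\<psi>\<in>l2 \<Lambda>. \<psi> = (\<lambda>x. \<Sum>\<phi>\<in>\<Phi>. ip \<Lambda> \<phi> \<psi> * \<phi> x))"
proof -
  define good where "good \<Phi> \<longleftrightarrow> finite \<Phi> \<and> \<Phi> \<subseteq> l2 \<Lambda> \<and> orthonormal \<Lambda> \<Phi> \<and>
    (\<forall>\<phi>\<in>\<Phi>. \<exists>r::real. T \<phi> = fun_scale (of_real r) \<phi>)" for \<Phi>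
  have "good {}" by (simp add: good_def orthonormal_def)
  moreover have "good \<Phi> \<Longrightarrow> card \<Phi> \<le> card \<Lambda>" for \<Phi>
    using card_orthonormal_le finite_domain by (auto simp: good_def)
  ultimately obtain \<Phi> where g: "good \<Phi>" and max: "\<And>\<Psi>. good \<Psi> \<Longrightarrow> card \<Psi> \<le> card \<Phi>"
    using ex_has_greatest_nat[of good "{}" card "Suc (card \<Lambda>)"] by (metis less_Suc_eq_le)
  note g' = g[unfolded good_def]
  from g' have "\<forall>\<phi>\<in>\<Phi>. \<exists>r::real. T \<phi> = fun_scale (of_real r) \<phi>" by blast
  from bchoice[OF this] obtain ev where ev': "\<forall>\<phi>\<in>\<Phi>. T \<phi> = fun_scale (of_real (ev \<phi> :: real)) \<phi>" ..
  then have ev: "\<And>\<phi>. \<phi> \<in> \<Phi> \<Longrightarrow> T \<phi> = fun_scale (of_real (ev \<phi>)) \<phi>" by blast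
  have "\<psi> = (\<lambda>x. \<Sum>\<phi>\<in>\<Phi>. ip \<Lambda> \<phi> \<psi> * \<phi> x)" if \<psi>: "\<psi> \<in> l2 \<Lambda>" for \<psi>
  proof (rule ccontr)
    assume neq: "\<psi> \<noteq> (\<lambda>x. \<Sum>\<phi>\<in>\<Phi>. ip \<Lambda> \<phi> \<psi> * \<phi> x)"
    define v where "v = (\<lambda>x. \<psi> x - (\<Sum>\<phi>\<in>\<Phi>. ip \<Lambda> \<phi> \<psi> * \<phi> x))"
    define V where "V = {f \<in> l2 \<Lambda>. \<forall>\<phi>\<in>\<Phi>. ip \<Lambda> \<phi> f = 0}"
    have v0: "v \<noteq> (\<lambda>x. 0)" using neq by (auto simp: v_def fun_eq_iff)
    have vl: "v \<in> l2 \<Lambda>" using \<psi> g' by (auto simp: v_def l2_def intro!: sum.neutral)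
    have vV: "v \<in> V" unfolding V_def
    proof (clarsimp simp: vl)
      fix \<phi> assume "\<phi> \<in> \<Phi>"
      then show "ip \<Lambda> \<phi> v = 0"
        unfolding v_def ip_diff_right using g' by (subst orthonormal_combination[of \<Lambda> \<Phi>]) auto
    qed
    have Vinv: "T f \<in> V" if "f \<in> V" for f
      unfolding V_def
    proof (safe)
      show "T f \<in> l2 \<Lambda>" using that maps by (simp add: V_def)
      fix \<phi> assume p: "\<phi> \<in> \<Phi>"
      have "ip \<Lambda> \<phi> (T f) = ip \<Lambda> (T \<phi>) f" using that p g' by (subst sym) (auto simp: V_def)
      also have "\<dots> = 0" using that p by (simp add: ev fun_scale_def ip_scale_left V_def)
      finally show "ip \<Lambda> \<phi> (T f) = 0" .
    qed
    have Vsub: "(\<lambda>x. a * f x + b * k x) \<in> V" if "f \<in> V" "k \<in> V" for a b f k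
      using that by (auto simp: V_def l2_def ip_def algebra_simps sum.distrib sum_distrib_left[symmetric])
    obtain p where "p \<noteq> 0" "poly_app p v = (\<lambda>x. 0)" using annihilating_poly[OF vl] by blast
    then obtain w z where w: "w \<in> V" "w \<noteq> (\<lambda>x. 0)" "T w = (\<lambda>x. z * w x)"
      using eigenvector_of_poly[of V p v, OF Vinv Vsub] vV v0 by blast
    have wl: "w \<in> l2 \<Lambda>" using w by (simp add: V_def)
    obtain r where r: "z = of_real r"
      using real_eigenvalue[OF wl w(2,3)] by (auto elim: Reals_cases)
    define s where "s = 1 / sqrt (sqn \<Lambda> w)"
    have sw: "sqn \<Lambda> w > 0"
      using sqn_nonneg[of \<Lambda> w] sqn_eq_0[OF finite_domain, of w] w(2) wl by (force simp: l2_def)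
    define u where "u = (\<lambda>x. of_real s * w x)"
    have "ip \<Lambda> u u = of_real (s * s * sqn \<Lambda> w)"
      by (simp add: u_def ip_scale_left ip_scale_right ip_self)
    also have "s * s * sqn \<Lambda> w = 1" using sw by (simp add: s_def)
    finally have uu: "ip \<Lambda> u u = 1" by simp
    have uo: "ip \<Lambda> \<phi> u = 0" "ip \<Lambda> u \<phi> = 0" if "\<phi> \<in> \<Phi>" for \<phi>
      using w(1) that ip_cnj[of \<Lambda> \<phi> w] by (auto simp: V_def u_def ip_scale_right ip_scale_left)
    have "u \<notin> \<Phi>" using uo uu by force
    have "T u = fun_scale (of_real r) u"
      using lin[of "of_real s" w 0 w] w(3) by (simp add: u_def r fun_scale_def algebra_simps)
    then have "good (insert u \<Phi>)"
      using g' uu uo wl unfolding good_def orthonormal_def by (auto simp: u_def l2_def)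
    from max[OF this] \<open>u \<notin> \<Phi>\<close> g' show False by simp
  qed
  with g' ev' show ?thesis by blast
qed

end

section \<open>Eigenbases of the Laplacian and its lowest eigenvalues\<close>

lemma l1_norm_minus_commute: "l1_norm (x - y) = l1_norm (y - x)"
  unfolding l1_norm_def by (intro sum.cong) auto

text \<open>Summing over all of \<open>\<Lambda>\<close> with a condition inside makes both ranges
  of the double sum independent, so that it can be swapped in the proof of symmetry.\<close>

lemma laplacian_eq:
  fixes \<Lambda> :: "(int ^ 'n::finite) set"
  assumes "finite \<Lambda>" "x \<in> \<Lambda>"
  shows "laplacian \<Lambda> \<phi> x
    = 2 * of_nat CARD('n) * \<phi> x - (\<Sum>y\<in>\<Lambda>. if l1_norm (y - x) = 1 then \<phi> y else 0)"
  using assms by (simp add: laplacian_def sum.inter_filter)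

lemma laplacian_self_adjoint:
  assumes "finite \<Lambda>"
  shows "self_adjoint \<Lambda> (laplacian \<Lambda>)"
proof
  show "finite \<Lambda>" by fact
  show "laplacian \<Lambda> f \<in> l2 \<Lambda>" for f by (simp add: l2_def laplacian_def)
  show "laplacian \<Lambda> (\<lambda>x. a * f x + b * g x) = (\<lambda>x. a * laplacian \<Lambda> f x + b * laplacian \<Lambda> g x)"
    for a b f g
    by (intro ext) (simp add: laplacian_def sum.distrib sum_distrib_left algebra_simps)
  show "ip \<Lambda> (laplacian \<Lambda> f) g = ip \<Lambda> f (laplacian \<Lambda> g)" for f g
  proof -
    have "(\<Sum>x\<in>\<Lambda>. \<Sum>y\<in>\<Lambda>. cnj (if l1_norm (y - x) = 1 then f y else 0) * g x)
        = (\<Sum>x\<in>\<Lambda>. \<Sum>y\<in>\<Lambda>. cnj (f x) * (if l1_norm (y - x) = 1 then g y else 0))"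
      by (subst sum.swap) (intro sum.cong refl, simp add: l1_norm_minus_commute)
    then show ?thesis using assms
      by (simp add: ip_def laplacian_eq algebra_simps sum_subtractf sum_distrib_left
          sum_distrib_right)
  qed
qed

text \<open>A fixed eigenbasis turns spectral quantities into sums over \<open>\<Phi>\<close>;
  \<open>ev\<close> may repeat values, which is how multiplicities are carried.\<close>

locale eigenbasis =
  fixes \<Lambda> :: "(int ^ 'n::finite) set" and \<Phi> :: "(int ^ 'n \<Rightarrow> complex) set"
    and ev :: "(int ^ 'n \<Rightarrow> complex) \<Rightarrow> real"
  assumes finite_domain: "finite \<Lambda>"
    and finite_basis: "finite \<Phi>"
    and basis_l2: "\<Phi> \<subseteq> l2 \<Lambda>"
    and orthonormal: "orthonormal \<Lambda> \<Phi>"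
    and eig: "\<phi> \<in> \<Phi> \<Longrightarrow> laplacian \<Lambda> \<phi> = fun_scale (of_real (ev \<phi>)) \<phi>"
    and expansion: "\<psi> \<in> l2 \<Lambda> \<Longrightarrow> \<psi> = (\<lambda>x. \<Sum>\<phi>\<in>\<Phi>. ip \<Lambda> \<phi> \<psi> * \<phi> x)"

lemma eigenbasis_exists:
  assumes "finite \<Lambda>"
  obtains \<Phi> ev where "eigenbasis \<Lambda> \<Phi> ev"
proof -
  from self_adjoint.eigenbasis[OF laplacian_self_adjoint[OF assms]]
  obtain \<Phi> ev where h: "finite \<Phi>" "\<Phi> \<subseteq> l2 \<Lambda>" "orthonormal \<Lambda> \<Phi>"
    "\<forall>\<phi>\<in>\<Phi>. laplacian \<Lambda> \<phi> = fun_scale (of_real (ev \<phi>)) \<phi>"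
    "\<forall>\<psi>\<in>l2 \<Lambda>. \<psi> = (\<lambda>x. \<Sum>\<phi>\<in>\<Phi>. ip \<Lambda> \<phi> \<psi> * \<phi> x)"
    by (elim exE conjE)
  have "eigenbasis \<Lambda> \<Phi> ev"
    by (rule eigenbasis.intro[OF assms h(1-3)]) (erule bspec[OF h(4)], erule bspec[OF h(5)])
  then show ?thesis by (rule that)
qed

context eigenbasis
begin

sublocale self_adjoint \<Lambda> "laplacian \<Lambda>"
  by (rule laplacian_self_adjoint[OF finite_domain])

lemma ip_laplacian:
  assumes "\<phi> \<in> \<Phi>" "\<psi> \<in> l2 \<Lambda>"
  shows "ip \<Lambda> \<phi> (laplacian \<Lambda> \<psi>) = of_real (ev \<phi>) * ip \<Lambda> \<phi> \<psi>"
proof -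
  have "ip \<Lambda> \<phi> (laplacian \<Lambda> \<psi>) = ip \<Lambda> (laplacian \<Lambda> \<phi>) \<psi>"
    using assms basis_l2 by (subst sym) auto
  then show ?thesis using assms by (simp add: eig fun_scale_def ip_scale_left)
qed

lemma parseval_ip:
  assumes "\<psi> \<in> l2 \<Lambda>"
  shows "ip \<Lambda> \<eta> \<psi> = (\<Sum>\<phi>\<in>\<Phi>. cnj (ip \<Lambda> \<phi> \<eta>) * ip \<Lambda> \<phi> \<psi>)"
proof -
  have "ip \<Lambda> \<eta> \<psi> = ip \<Lambda> \<eta> (\<lambda>x. \<Sum>\<phi>\<in>\<Phi>. ip \<Lambda> \<phi> \<psi> * \<phi> x)"
    using expansion[OF assms] by simp
  also have "\<dots> = (\<Sum>\<phi>\<in>\<Phi>. cnj (ip \<Lambda> \<phi> \<eta>) * ip \<Lambda> \<phi> \<psi>)"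
    unfolding ip_sum_right ip_cnj by (simp add: mult.commute)
  finally show ?thesis .
qed

lemma parseval:
  assumes "\<psi> \<in> l2 \<Lambda>"
  shows "sqn \<Lambda> \<psi> = (\<Sum>\<phi>\<in>\<Phi>. (cmod (ip \<Lambda> \<phi> \<psi>))\<^sup>2)"
proof -
  have "of_real (sqn \<Lambda> \<psi>) = (of_real (\<Sum>\<phi>\<in>\<Phi>. (cmod (ip \<Lambda> \<phi> \<psi>))\<^sup>2) :: complex)"
    unfolding ip_self[symmetric] of_real_sum
    by (subst parseval_ip[OF assms]) (intro sum.cong refl, simp only: complex_norm_square mult.commute)
  then show ?thesis by (simp only: of_real_eq_iff)
qed

lemma quadratic_form:
  assumes "\<psi> \<in> l2 \<Lambda>"
  shows "ip \<Lambda> \<psi> (laplacian \<Lambda> \<psi>) = of_real (\<Sum>\<phi>\<in>\<Phi>. ev \<phi> * (cmod (ip \<Lambda> \<phi> \<psi>))\<^sup>2)"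
proof -
  have "ip \<Lambda> \<psi> (laplacian \<Lambda> \<psi>)
      = (\<Sum>\<phi>\<in>\<Phi>. cnj (ip \<Lambda> \<phi> \<psi>) * (of_real (ev \<phi>) * ip \<Lambda> \<phi> \<psi>))"
    by (subst parseval_ip) (use assms maps ip_laplacian in auto)
  also have "\<dots> = of_real (\<Sum>\<phi>\<in>\<Phi>. ev \<phi> * (cmod (ip \<Lambda> \<phi> \<psi>))\<^sup>2)"
    unfolding of_real_sum of_real_mult
    by (intro sum.cong refl) (simp only: complex_norm_square mult_ac)
  finally show ?thesis .
qed

text \<open>Applying the operator multiplies the coefficient on \<open>\<phi>\<close> both by
  \<open>\<mu>\<close> and by \<open>ev \<phi>\<close>, so it vanishes unless the two agree. This
  links multiplicities, defined as dimensions, to counting in \<open>\<Phi>\<close>.\<close>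

lemma eigenspace_eq_span: "eigenspace \<Lambda> \<mu> = cfun.span {\<phi> \<in> \<Phi>. ev \<phi> = \<mu>}"
proof
  show "eigenspace \<Lambda> \<mu> \<subseteq> cfun.span {\<phi> \<in> \<Phi>. ev \<phi> = \<mu>}"
  proof
    fix \<psi> assume "\<psi> \<in> eigenspace \<Lambda> \<mu>"
    then have l: "\<psi> \<in> l2 \<Lambda>" and e: "laplacian \<Lambda> \<psi> = fun_scale (of_real \<mu>) \<psi>"
      by (auto simp: eigenspace_def)
    have z: "ip \<Lambda> \<phi> \<psi> = 0" if "\<phi> \<in> \<Phi>" "ev \<phi> \<noteq> \<mu>" for \<phi>
      using ip_laplacian[OF that(1) l] that(2) by (simp add: e fun_scale_def ip_scale_right)
    have "\<psi> = (\<lambda>x. \<Sum>\<phi>\<in>\<Phi>. ip \<Lambda> \<phi> \<psi> * \<phi> x)" by (rule expansion[OF l])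
    also have "\<dots> = (\<lambda>x. \<Sum>\<phi>\<in>{\<phi> \<in> \<Phi>. ev \<phi> = \<mu>}. ip \<Lambda> \<phi> \<psi> * \<phi> x)"
      using finite_basis z by (intro ext sum.mono_neutral_right) auto
    also have "\<dots> = (\<Sum>\<phi>\<in>{\<phi> \<in> \<Phi>. ev \<phi> = \<mu>}. fun_scale (ip \<Lambda> \<phi> \<psi>) \<phi>)"
      by (intro ext) (simp add: sum_fun_apply fun_scale_def)
    also have "\<dots> \<in> cfun.span {\<phi> \<in> \<Phi>. ev \<phi> = \<mu>}"
      by (intro cfun.span_sum cfun.span_scale cfun.span_base)
    finally show "\<psi> \<in> cfun.span {\<phi> \<in> \<Phi>. ev \<phi> = \<mu>}" .
  qed
  have lap0: "laplacian \<Lambda> (\<lambda>x. 0) = (\<lambda>x. 0)" using lin[of 0 _ 0] by simp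
  have "cfun.subspace (eigenspace \<Lambda> \<mu>)"
    unfolding cfun.subspace_def
  proof (intro conjI ballI allI)
    show "0 \<in> eigenspace \<Lambda> \<mu>"
      using lap0 by (simp add: eigenspace_def l2_def fun_scale_def zero_fun_def)
    show "f + g \<in> eigenspace \<Lambda> \<mu>" if "f \<in> eigenspace \<Lambda> \<mu>" "g \<in> eigenspace \<Lambda> \<mu>" for f g
      using that lin[of 1 f 1 g]
      by (auto simp: eigenspace_def l2_def fun_scale_def plus_fun_def algebra_simps)
    show "fun_scale c f \<in> eigenspace \<Lambda> \<mu>" if "f \<in> eigenspace \<Lambda> \<mu>" for c f
      using that lin[of c f 0 f] by (auto simp: eigenspace_def l2_def fun_scale_def algebra_simps)
  qed
  then show "cfun.span {\<phi> \<in> \<Phi>. ev \<phi> = \<mu>} \<subseteq> eigenspace \<Lambda> \<mu>"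
    using basis_l2 eig by (intro cfun.span_minimal) (auto simp: eigenspace_def)
qed

lemma independent_basis:
  assumes "J \<subseteq> \<Phi>"
  shows "\<not> cfun.dependent J"
proof
  assume "cfun.dependent J"
  moreover have "finite J" using assms finite_basis finite_subset by blast
  ultimately obtain u \<phi> where u: "\<phi> \<in> J" "u \<phi> \<noteq> 0" "(\<Sum>f\<in>J. fun_scale (u f) f) = 0"
    using cfun.dependent_finite by blast
  have "(\<lambda>x. \<Sum>f\<in>J. u f * f x) = (\<lambda>x. 0)"
    using u(3) by (auto simp: fun_eq_iff sum_fun_apply fun_scale_def)
  then have "ip \<Lambda> \<phi> (\<lambda>x. 0) = u \<phi>"
    using orthonormal_combination[OF orthonormal finite_basis, of \<phi> J u] u(1) assms
    by (auto simp: subset_iff)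
  then show False using u(2) by (simp add: ip_def)
qed

lemma eig_mult_eq: "eig_mult \<Lambda> \<mu> = card {\<phi> \<in> \<Phi>. ev \<phi> = \<mu>}"
  unfolding eig_mult_def eigenspace_eq_span
  by (intro cfun.dim_span_eq_card_independent independent_basis) auto

lemma eigenspace_trivial_iff: "eigenspace \<Lambda> \<mu> \<noteq> {0} \<longleftrightarrow> \<mu> \<in> ev ` \<Phi>"
proof
  show "\<mu> \<in> ev ` \<Phi>" if "eigenspace \<Lambda> \<mu> \<noteq> {0}"
  proof (rule ccontr)
    assume "\<mu> \<notin> ev ` \<Phi>"
    then have e: "{\<phi> \<in> \<Phi>. ev \<phi> = \<mu>} = {}" by auto
    show False using that unfolding eigenspace_eq_span e by simp
  qed
  show "eigenspace \<Lambda> \<mu> \<noteq> {0}" if "\<mu> \<in> ev ` \<Phi>"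
  proof -
    from that obtain \<phi> where p: "\<phi> \<in> \<Phi>" "ev \<phi> = \<mu>" by auto
    then have "\<phi> \<in> eigenspace \<Lambda> \<mu>" unfolding eigenspace_eq_span by (intro cfun.span_base) auto
    moreover have "\<phi> \<noteq> 0" using p(1) orthonormal unfolding orthonormal_def ip_def by force
    ultimately show ?thesis by auto
  qed
qed

lemma eigenvalues_eq: "eigenvalues \<Lambda> = image_mset ev (mset_set \<Phi>)"
proof (rule multiset_eqI)
  fix \<mu>
  have "{\<mu>. eigenspace \<Lambda> \<mu> \<noteq> {0}} = ev ` \<Phi>" using eigenspace_trivial_iff by auto
  then have "count (eigenvalues \<Lambda>) \<mu> = (\<Sum>\<nu>\<in>ev ` \<Phi>. if \<nu> = \<mu> then eig_mult \<Lambda> \<nu> else 0)"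
    unfolding eigenvalues_def by (simp add: count_sum eq_commute cong: if_cong)
  also have "\<dots> = card {\<phi> \<in> \<Phi>. ev \<phi> = \<mu>}"
    using finite_basis by (auto simp: eig_mult_eq card_eq_0_iff)
  finally show "count (eigenvalues \<Lambda>) \<mu> = count (image_mset ev (mset_set \<Phi>)) \<mu>"
    using finite_basis by (simp add: count_image_mset_eq_card_vimage)
qed

abbreviation "spectrum_list \<equiv> sorted_list_of_multiset (eigenvalues \<Lambda>)"

lemma sum_list_spectrum: "sum_list (map g spectrum_list) = (\<Sum>\<phi>\<in>\<Phi>. g (ev \<phi>))" for g :: "real \<Rightarrow> real"
proof -
  have "sum_list (map g spectrum_list) = sum_mset (image_mset g (mset spectrum_list))"
    by (metis mset_map sum_mset_sum_list)
  also have "\<dots> = (\<Sum>\<phi>\<in>\<Phi>. g (ev \<phi>))"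
    by (simp add: eigenvalues_eq sum_unfold_sum_mset multiset.map_comp comp_def)
  finally show ?thesis .
qed

lemma length_spectrum: "length spectrum_list = card \<Phi>"
  by (metis eigenvalues_eq mset_sorted_list_of_multiset size_image_mset size_mset size_mset_set)

text \<open>One half of the duality between the sum of the \<open>N\<close> lowest eigenvalues and
  the maximum over \<open>E\<close> of \<open>E N\<close> minus the sum of
  \<open>(E - ev)_+\<close>: positive parts are at least \<open>E - e\<close> on the first
  \<open>N\<close> entries and nonnegative on the rest.\<close>

lemma lowest_sum_ge:
  assumes "N \<le> card \<Phi>"
  shows "E * real N - (\<Sum>\<phi>\<in>\<Phi>. max 0 (E - ev \<phi>)) \<le> lowest_sum \<Lambda> N"
proof -
  let ?g = "\<lambda>e. max 0 (E - e)" and ?L = "spectrum_list"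
  have "(\<Sum>\<phi>\<in>\<Phi>. ?g (ev \<phi>)) = sum_list (map ?g (take N ?L @ drop N ?L))"
    by (simp add: sum_list_spectrum del: map_append)
  also have "\<dots> \<ge> sum_list (map ?g (take N ?L))"
    by (auto simp del: append_take_drop_id intro!: sum_list_nonneg)
  also have "sum_list (map ?g (take N ?L)) \<ge> sum_list (map (\<lambda>e. E - e) (take N ?L))"
    by (intro sum_list_mono) auto
  also have "sum_list (map (\<lambda>e. E - e) (take N ?L)) = E * real N - lowest_sum \<Lambda> N"
    using assms by (simp add: lowest_sum_def sum_list_subtractf sum_list_triv length_spectrum)
  finally show ?thesis by simp
qed

text \<open>The variational principle for fractional occupation numbers \<open>w\<close>: a suitable
  \<open>E\<close> gives equality in \<open>lowest_sum_ge\<close>, and \<open>w (E - ev)\<close>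
  never exceeds the positive part of \<open>E - ev\<close>.\<close>

lemma lowest_sum_le:
  assumes w: "\<And>\<phi>. \<phi> \<in> \<Phi> \<Longrightarrow> 0 \<le> w \<phi>" "\<And>\<phi>. \<phi> \<in> \<Phi> \<Longrightarrow> w \<phi> \<le> 1" and N: "(\<Sum>\<phi>\<in>\<Phi>. w \<phi>) = real N"
  shows "lowest_sum \<Lambda> N \<le> (\<Sum>\<phi>\<in>\<Phi>. w \<phi> * ev \<phi>)"
proof (cases "N = 0")
  case True
  then have "\<And>\<phi>. \<phi> \<in> \<Phi> \<Longrightarrow> w \<phi> = 0" using N w finite_basis by (simp add: sum_nonneg_eq_0_iff)
  with True show ?thesis by (simp add: lowest_sum_def)
next
  case False
  let ?L = "spectrum_list"
  \<comment> \<open>The \<open>N\<close>-th lowest eigenvalue, at index \<open>N - 1\<close> because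
    positions start at 0: entries before the cut are at most \<open>E\<close>, those after it at
    least \<open>E\<close>.\<close>
  define E where "E = ?L ! (N - 1)"
  let ?g = "\<lambda>e. max 0 (E - e)"
  have "real N \<le> (\<Sum>\<phi>\<in>\<Phi>. 1)" unfolding N[symmetric] by (intro sum_mono w)
  then have le: "N \<le> length ?L" by (simp add: length_spectrum)
  have s: "sorted ?L" by simp
  have up: "e \<le> E" if "e \<in> set (take N ?L)" for e
    using that le False s by (auto simp: in_set_conv_nth E_def intro!: sorted_nth_mono)
  have lo: "E \<le> e" if "e \<in> set (drop N ?L)" for e
    using that le False s by (auto simp: in_set_conv_nth E_def intro!: sorted_nth_mono)
  have "(\<Sum>\<phi>\<in>\<Phi>. ?g (ev \<phi>)) = sum_list (map ?g (take N ?L @ drop N ?L))"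
    by (simp add: sum_list_spectrum del: map_append)
  also have "\<dots> = sum_list (map ?g (take N ?L)) + sum_list (map ?g (drop N ?L))"
    by (simp del: append_take_drop_id)
  also have "map ?g (drop N ?L) = map (\<lambda>_. 0) (drop N ?L)" using lo by (intro map_cong) auto
  also have "map ?g (take N ?L) = map (\<lambda>e. E - e) (take N ?L)" using up by (intro map_cong) auto
  also have "sum_list (map (\<lambda>e. E - e) (take N ?L)) = E * real N - lowest_sum \<Lambda> N"
    using le by (simp add: lowest_sum_def sum_list_subtractf sum_list_triv)
  finally have "lowest_sum \<Lambda> N = E * real N - (\<Sum>\<phi>\<in>\<Phi>. ?g (ev \<phi>))" by simp
  also have "(\<Sum>\<phi>\<in>\<Phi>. w \<phi> * (E - ev \<phi>)) \<le> (\<Sum>\<phi>\<in>\<Phi>. ?g (ev \<phi>))"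
  proof (intro sum_mono)
    fix \<phi> assume p: "\<phi> \<in> \<Phi>"
    have "w \<phi> * (E - ev \<phi>) \<le> w \<phi> * ?g (ev \<phi>)" using w[OF p] by (intro mult_left_mono) auto
    also have "\<dots> \<le> 1 * ?g (ev \<phi>)" using w[OF p] by (intro mult_right_mono) auto
    finally show "w \<phi> * (E - ev \<phi>) \<le> ?g (ev \<phi>)" by simp
  qed
  then have "E * real N - (\<Sum>\<phi>\<in>\<Phi>. ?g (ev \<phi>)) \<le> E * real N - (\<Sum>\<phi>\<in>\<Phi>. w \<phi> * (E - ev \<phi>))" by simp
  also have "\<dots> = (\<Sum>\<phi>\<in>\<Phi>. w \<phi> * ev \<phi>)"
    by (simp add: N[symmetric] algebra_simps sum_subtractf sum_distrib_left)
  finally show ?thesis .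
qed

text \<open>Parseval for the point mass at \<open>x\<close>; summed over \<open>x\<close> it gives
  the size of the basis.\<close>

lemma basis_completeness:
  assumes "x \<in> \<Lambda>"
  shows "(\<Sum>\<phi>\<in>\<Phi>. (cmod (\<phi> x))\<^sup>2) = 1"
proof -
  let ?\<delta> = "\<lambda>y. if y = x then 1 else (0::complex)"
  have "cmod (ip \<Lambda> f ?\<delta>) = cmod (f x)" for f
    using assms finite_domain by (simp add: ip_def if_distrib cong: if_cong)
  moreover have "sqn \<Lambda> ?\<delta> = 1"
    using assms finite_domain by (simp add: sqn_def if_distrib[of "\<lambda>z. (cmod z)\<^sup>2"] cong: if_cong)
  moreover have "?\<delta> \<in> l2 \<Lambda>" using assms by (simp add: l2_def)
  ultimately show ?thesis using parseval[of ?\<delta>] by simp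
qed

lemma sqn_basis: "\<phi> \<in> \<Phi> \<Longrightarrow> sqn \<Lambda> \<phi> = 1"
  using orthonormal ip_self[of \<Lambda> \<phi>] unfolding orthonormal_def by (metis of_real_eq_1_iff)

lemma card_basis: "card \<Phi> = card \<Lambda>"
proof -
  have "real (card \<Lambda>) = (\<Sum>x\<in>\<Lambda>. \<Sum>\<phi>\<in>\<Phi>. (cmod (\<phi> x))\<^sup>2)" by (simp add: basis_completeness)
  also have "\<dots> = (\<Sum>\<phi>\<in>\<Phi>. sqn \<Lambda> \<phi>)" unfolding sqn_def by (rule sum.swap)
  finally show ?thesis by (simp add: sqn_basis)
qed

end

section \<open>Boundary vectors of plane waves\<close>

definition units :: "(int ^ 'n::finite) set" where
  "units = {e. l1_norm e = 1}"

lemma l1_norm_axis: "l1_norm (axis i c) = \<bar>c\<bar>"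
proof -
  have "l1_norm (axis i c) = (\<Sum>j\<in>UNIV. if j = i then \<bar>c\<bar> else 0)"
    unfolding l1_norm_def by (intro sum.cong) (auto simp: axis_def)
  then show ?thesis by simp
qed

lemma units_eq: "(units :: (int ^ 'n::finite) set)
    = range (\<lambda>i. axis i 1) \<union> range (\<lambda>i. axis i (- 1))"
proof
  show "(units :: (int ^ 'n) set) \<subseteq> range (\<lambda>i. axis i 1) \<union> range (\<lambda>i. axis i (- 1))"
  proof
    fix e :: "int ^ 'n" assume "e \<in> units"
    then have e: "(\<Sum>i\<in>UNIV. \<bar>e $ i\<bar>) = 1" by (simp add: units_def l1_norm_def)
    then obtain i where i: "e $ i \<noteq> 0" by (metis abs_0 sum.neutral zero_neq_one)
    have "\<bar>e $ i\<bar> + (\<Sum>j\<in>UNIV - {i}. \<bar>e $ j\<bar>) = 1"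
      using e by (simp add: sum.remove[of UNIV i])
    moreover have "(\<Sum>j\<in>UNIV - {i}. \<bar>e $ j\<bar>) \<ge> 0" by (intro sum_nonneg) auto
    ultimately have "(\<Sum>j\<in>UNIV - {i}. \<bar>e $ j\<bar>) = 0" and ei: "e $ i = 1 \<or> e $ i = - 1"
      using i by linarith+
    then have "\<forall>j\<in>UNIV - {i}. e $ j = 0" by (subst (asm) sum_nonneg_eq_0_iff) auto
    then have "e = axis i (e $ i)" by (auto simp: vec_eq_iff axis_def)
    with ei show "e \<in> range (\<lambda>i. axis i 1) \<union> range (\<lambda>i. axis i (- 1))"
      by (metis UnI1 UnI2 rangeI)
  qed
qed (auto simp: units_def l1_norm_axis)

lemma finite_units: "finite (units :: (int ^ 'n::finite) set)"
  by (simp add: units_eq)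

lemma sum_units:
  "(\<Sum>e\<in>units. f e) = (\<Sum>i\<in>UNIV. f (axis i 1) + f (axis i (- 1)))"
  for f :: "int ^ 'n::finite \<Rightarrow> 'a::comm_monoid_add"
proof -
  have inj: "inj (\<lambda>i::'n. axis i c)" if "c \<noteq> 0" for c :: int
    using that by (auto simp: inj_on_def axis_eq_axis)
  have "range (\<lambda>i::'n. axis i 1) \<inter> range (\<lambda>i. axis i (- 1::int)) = {}"
    by (auto simp: axis_eq_axis)
  from sum.union_disjoint[OF _ _ this] have "(\<Sum>e\<in>units. f e)
      = (\<Sum>e\<in>range (\<lambda>i. axis i 1). f e) + (\<Sum>e\<in>range (\<lambda>i. axis i (- 1)). f e)"
    by (simp add: units_eq)
  also have "\<dots> = (\<Sum>i\<in>UNIV. f (axis i 1)) + (\<Sum>i\<in>UNIV. f (axis i (- 1)))"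
    using sum.reindex[OF inj[of 1], of f] sum.reindex[OF inj[of "- 1"], of f] by (simp add: comp_def)
  finally show ?thesis by (simp only: sum.distrib)
qed

lemma card_units: "card (units :: (int ^ 'n::finite) set) = 2 * CARD('n)"
  using sum_units[of "\<lambda>_ :: int ^ 'n. 1::nat"] by simp

lemma l1_norm_uminus: "l1_norm (- x) = l1_norm x"
  by (simp add: l1_norm_def)

lemma uminus_units: "- e \<in> units \<longleftrightarrow> e \<in> units"
  by (simp add: units_def l1_norm_uminus)

text \<open>Directions are collected instead of neighbouring sites, so that the phase of a plane
  wave at \<open>x\<close> factors out of sums over them.\<close>

definition outgoing :: "(int ^ 'n::finite) set \<Rightarrow> int ^ 'n \<Rightarrow> (int ^ 'n) set" where
  "outgoing \<Lambda> x = {e \<in> units. x + e \<notin> \<Lambda>}"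

definition ingoing :: "(int ^ 'n::finite) set \<Rightarrow> int ^ 'n \<Rightarrow> (int ^ 'n) set" where
  "ingoing \<Lambda> x = {e \<in> units. x + e \<in> \<Lambda>}"

abbreviation degout :: "(int ^ 'n::finite) set \<Rightarrow> int ^ 'n \<Rightarrow> real" where
  "degout \<Lambda> x \<equiv> real (card (outgoing \<Lambda> x))"

lemma finite_outgoing: "finite (outgoing \<Lambda> x)" and finite_ingoing: "finite (ingoing \<Lambda> x)"
  by (simp_all add: outgoing_def ingoing_def finite_units)

lemma sum_units_split:
  "(\<Sum>e\<in>units. f e) = (\<Sum>e\<in>ingoing \<Lambda> x. f e) + (\<Sum>e\<in>outgoing \<Lambda> x. f e)"
  for f :: "int ^ 'n::finite \<Rightarrow> 'a::comm_monoid_add"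
proof -
  have u: "units = ingoing \<Lambda> x \<union> outgoing \<Lambda> x" and d: "ingoing \<Lambda> x \<inter> outgoing \<Lambda> x = {}"
    by (auto simp: ingoing_def outgoing_def)
  show ?thesis unfolding u by (rule sum.union_disjoint[OF finite_ingoing finite_outgoing d])
qed

lemma card_ingoing: "real (card (ingoing \<Lambda> x)) = 2 * real CARD('n) - degout \<Lambda> x"
  for x :: "int ^ 'n::finite"
  using sum_units_split[of "\<lambda>_. 1::real" \<Lambda> x] by (simp add: card_units)

lemma laplacian_ingoing:
  "x \<in> \<Lambda> \<Longrightarrow> laplacian \<Lambda> \<phi> x = 2 * of_nat CARD('n) * \<phi> x - (\<Sum>e\<in>ingoing \<Lambda> x. \<phi> (x + e))"
  for x :: "int ^ 'n::finite"
proof -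
  have "(\<Sum>y | y \<in> \<Lambda> \<and> l1_norm (y - x) = 1. \<phi> y) = (\<Sum>e\<in>ingoing \<Lambda> x. \<phi> (x + e))"
    by (rule sum.reindex_bij_witness[of _ "\<lambda>e. x + e" "\<lambda>y. y - x"])
      (auto simp: ingoing_def units_def)
  then show "x \<in> \<Lambda> \<Longrightarrow> ?thesis" by (simp add: laplacian_def)
qed

text \<open>Reversing a bond, \<open>(x, e)\<close> to \<open>(x + e, - e)\<close>, permutes the
  bonds inside \<open>\<Lambda>\<close>.\<close>

lemma sum_ingoing_swap:
  fixes g :: "int ^ 'n::finite \<Rightarrow> int ^ 'n \<Rightarrow> 'a::comm_monoid_add"
  assumes "finite \<Lambda>"
  shows "(\<Sum>x\<in>\<Lambda>. \<Sum>e\<in>ingoing \<Lambda> x. g x (x + e)) = (\<Sum>x\<in>\<Lambda>. \<Sum>e\<in>ingoing \<Lambda> x. g (x + e) x)"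
proof -
  have "(\<Sum>x\<in>\<Lambda>. \<Sum>e\<in>ingoing \<Lambda> x. g x (x + e))
      = (\<Sum>(x, e)\<in>(SIGMA x:\<Lambda>. ingoing \<Lambda> x). g x (x + e))"
    using assms by (simp add: sum.Sigma finite_ingoing)
  also have "\<dots> = (\<Sum>(x, e)\<in>(SIGMA x:\<Lambda>. ingoing \<Lambda> x). g (x + e) x)"
    by (rule sum.reindex_bij_witness[of _ "\<lambda>(x, e). (x + e, - e)" "\<lambda>(x, e). (x + e, - e)"])
      (auto simp: ingoing_def uminus_units)
  also have "\<dots> = (\<Sum>x\<in>\<Lambda>. \<Sum>e\<in>ingoing \<Lambda> x. g (x + e) x)"
    using assms by (simp add: sum.Sigma finite_ingoing)
  finally show ?thesis .
qed

lemma boundary_bonds_eq: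
  assumes "finite \<Lambda>"
  shows "boundary_bonds \<Lambda> = (\<Sum>x\<in>\<Lambda>. card (outgoing \<Lambda> x))"
proof -
  have "bij_betw (\<lambda>(x, e). (x, x + e)) (SIGMA x:\<Lambda>. outgoing \<Lambda> x)
      {(x, y). x \<in> \<Lambda> \<and> y \<notin> \<Lambda> \<and> l1_norm (x - y) = 1}"
    by (rule bij_betw_byWitness[of _ "\<lambda>(x, y). (x, y - x)"])
      (auto simp: outgoing_def units_def l1_norm_uminus l1_norm_minus_commute)
  from bij_betw_same_card[OF this] show ?thesis
    using assms by (simp add: boundary_bonds_def finite_outgoing)
qed

definition hop :: "(int ^ 'n::finite) set \<Rightarrow> (int ^ 'n \<Rightarrow> complex) \<Rightarrow> complex" where
  "hop \<Lambda> \<psi> = (\<Sum>x\<in>\<Lambda>. \<Sum>e\<in>ingoing \<Lambda> x. cnj (\<psi> x) * \<psi> (x + e))"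

lemma ip_laplacian_hop:
  "ip \<Lambda> \<psi> (laplacian \<Lambda> \<psi>) = of_real (2 * real CARD('n) * sqn \<Lambda> \<psi>) - hop \<Lambda> \<psi>"
  for \<Lambda> :: "(int ^ 'n::finite) set"
proof -
  have "ip \<Lambda> \<psi> (laplacian \<Lambda> \<psi>) = 2 * of_nat CARD('n) * ip \<Lambda> \<psi> \<psi> - hop \<Lambda> \<psi>"
    by (simp add: ip_def hop_def laplacian_ingoing algebra_simps sum_subtractf sum_distrib_left)
  then show ?thesis by (simp add: ip_self)
qed

text \<open>The arithmetic-geometric mean on each inner bond splits its weight between the two ends;
  reversing bonds collects both halves at \<open>x\<close>, which has \<open>2 d - degout\<close>
  inner bonds.\<close>

lemma hop_bound:
  fixes \<Lambda> :: "(int ^ 'n::finite) set"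
  assumes "finite \<Lambda>"
  shows "cmod (hop \<Lambda> \<psi>) \<le> (\<Sum>x\<in>\<Lambda>. (2 * real CARD('n) - degout \<Lambda> x) * (cmod (\<psi> x))\<^sup>2)"
proof -
  have "cmod (hop \<Lambda> \<psi>) \<le> (\<Sum>x\<in>\<Lambda>. \<Sum>e\<in>ingoing \<Lambda> x. cmod (cnj (\<psi> x) * \<psi> (x + e)))"
    unfolding hop_def by (intro sum_norm_le norm_sum)
  also have "\<dots> \<le> (\<Sum>x\<in>\<Lambda>. \<Sum>e\<in>ingoing \<Lambda> x. (cmod (\<psi> x))\<^sup>2 / 2 + (cmod (\<psi> (x + e)))\<^sup>2 / 2)"
  proof (intro sum_mono)
    fix x e
    show "cmod (cnj (\<psi> x) * \<psi> (x + e)) \<le> (cmod (\<psi> x))\<^sup>2 / 2 + (cmod (\<psi> (x + e)))\<^sup>2 / 2"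
      using sum_squares_bound[of "cmod (\<psi> x)" "cmod (\<psi> (x + e))"] by (simp add: norm_mult)
  qed
  also have "\<dots> = (\<Sum>x\<in>\<Lambda>. \<Sum>e\<in>ingoing \<Lambda> x. (cmod (\<psi> x))\<^sup>2)"
    using sum_ingoing_swap[OF assms, of "\<lambda>x y. (cmod (\<psi> y))\<^sup>2 / 2"]
    by (simp add: sum.distrib sum_divide_distrib[symmetric])
  also have "\<dots> = (\<Sum>x\<in>\<Lambda>. (2 * real CARD('n) - degout \<Lambda> x) * (cmod (\<psi> x))\<^sup>2)"
    by (simp add: card_ingoing)
  finally show ?thesis .
qed

context eigenbasis
begin

text \<open>The form is \<open>2 d |\<psi>|^2\<close> minus the hopping term, and the bonds missing
  in \<open>hop_bound\<close> survive as a repulsive potential on the boundary sites.\<close>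

lemma quadratic_form_ge:
  assumes "\<psi> \<in> l2 \<Lambda>"
  shows "(\<Sum>x\<in>\<Lambda>. degout \<Lambda> x * (cmod (\<psi> x))\<^sup>2) \<le> (\<Sum>\<phi>\<in>\<Phi>. ev \<phi> * (cmod (ip \<Lambda> \<phi> \<psi>))\<^sup>2)"
    and "(\<Sum>\<phi>\<in>\<Phi>. ev \<phi> * (cmod (ip \<Lambda> \<phi> \<psi>))\<^sup>2) \<le> 4 * real CARD('n) * sqn \<Lambda> \<psi>"
proof -
  let ?q = "\<Sum>\<phi>\<in>\<Phi>. ev \<phi> * (cmod (ip \<Lambda> \<phi> \<psi>))\<^sup>2" and ?D = "\<Sum>x\<in>\<Lambda>. degout \<Lambda> x * (cmod (\<psi> x))\<^sup>2"
  have "of_real ?q = of_real (2 * real CARD('n) * sqn \<Lambda> \<psi>) - hop \<Lambda> \<psi>"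
    using quadratic_form[OF assms] ip_laplacian_hop[of \<Lambda> \<psi>] by simp
  from arg_cong[OF this, of Re] have "?q = 2 * real CARD('n) * sqn \<Lambda> \<psi> - Re (hop \<Lambda> \<psi>)"
    by (simp only: Re_complex_of_real minus_complex.simps)
  moreover have "\<bar>Re (hop \<Lambda> \<psi>)\<bar> \<le> 2 * real CARD('n) * sqn \<Lambda> \<psi> - ?D"
    using abs_Re_le_cmod[of "hop \<Lambda> \<psi>"] hop_bound[OF finite_domain, of \<psi>]
    by (simp add: sqn_def algebra_simps sum_subtractf sum_distrib_left)
  moreover have "?D \<ge> 0" by (intro sum_nonneg) auto
  ultimately show "?D \<le> ?q" "?q \<le> 4 * real CARD('n) * sqn \<Lambda> \<psi>" by linarith+
qed

lemma ev_range:
  assumes "\<phi> \<in> \<Phi>"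
  shows "0 \<le> ev \<phi>" "ev \<phi> \<le> 4 * real CARD('n)"
proof -
  have "(\<Sum>f\<in>\<Phi>. ev f * (cmod (ip \<Lambda> f \<phi>))\<^sup>2) = (\<Sum>f\<in>\<Phi>. if f = \<phi> then ev \<phi> else 0)"
    using assms orthonormal by (intro sum.cong) (auto simp: orthonormal_def)
  then have e: "(\<Sum>f\<in>\<Phi>. ev f * (cmod (ip \<Lambda> f \<phi>))\<^sup>2) = ev \<phi>" using assms finite_basis by simp
  have l: "\<phi> \<in> l2 \<Lambda>" using assms basis_l2 by auto
  have "0 \<le> (\<Sum>x\<in>\<Lambda>. degout \<Lambda> x * (cmod (\<phi> x))\<^sup>2)" by (intro sum_nonneg) auto
  then show "0 \<le> ev \<phi>" using quadratic_form_ge(1)[OF l] by (simp add: e)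
  show "ev \<phi> \<le> 4 * real CARD('n)" using quadratic_form_ge(2)[OF l] by (simp add: e sqn_basis assms)
qed

end

definition pw :: "real ^ 'n::finite \<Rightarrow> int ^ 'n \<Rightarrow> complex" where
  "pw k x = cis (\<Sum>i\<in>UNIV. k $ i * of_int (x $ i))"

lemma pw_add: "pw k (x + y) = pw k x * pw k y"
  by (simp add: pw_def cis_mult sum.distrib algebra_simps)

lemma pw_uminus: "pw k (- x) = cnj (pw k x)"
  by (simp add: pw_def cis_cnj sum_negf)

lemma pw_diff: "pw k (x - y) = pw k x * cnj (pw k y)"
  using pw_add[of k x "- y"] by (simp add: pw_uminus)

lemma norm_pw: "cmod (pw k x) = 1"
  by (simp add: pw_def)

lemma pw_axis: "pw k (axis i c) = cis (k $ i * of_int c)"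
proof -
  have "(\<Sum>j\<in>UNIV. k $ j * of_int (axis i c $ j)) = (\<Sum>j\<in>UNIV. if j = i then k $ i * of_int c else 0)"
    by (intro sum.cong) (auto simp: axis_def)
  then show ?thesis by (simp add: pw_def)
qed

lemma sum_units_pw: "(\<Sum>e\<in>units. pw k e) = of_real (2 * real CARD('n) - dispersion k)"
  for k :: "real ^ 'n::finite"
  unfolding sum_units
  by (simp add: complex_eq_iff pw_axis dispersion_def sum_distrib_left)

text \<open>\<open>pwl \<Lambda> k\<close> is the cut-off plane wave f_k, and
  \<open>bdry \<Lambda> k\<close> below is its boundary vector b_k.\<close>

definition pwl :: "(int ^ 'n::finite) set \<Rightarrow> real ^ 'n \<Rightarrow> int ^ 'n \<Rightarrow> complex" where
  "pwl \<Lambda> k x = (if x \<in> \<Lambda> then pw k x else 0)"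

definition bdry :: "(int ^ 'n::finite) set \<Rightarrow> real ^ 'n \<Rightarrow> int ^ 'n \<Rightarrow> complex" where
  "bdry \<Lambda> k x = (if x \<in> \<Lambda> then \<Sum>e\<in>outgoing \<Lambda> x. pw k (x + e) else 0)"

lemma pwl_l2: "pwl \<Lambda> k \<in> l2 \<Lambda>" and bdry_l2: "bdry \<Lambda> k \<in> l2 \<Lambda>"
  by (simp_all add: l2_def pwl_def bdry_def)

lemma sqn_pwl: "sqn \<Lambda> (pwl \<Lambda> k) = real (card \<Lambda>)"
  by (simp add: sqn_def pwl_def norm_pw)

text \<open>On the whole lattice the plane wave is an eigenfunction with eigenvalue
  \<open>dispersion k\<close>; the cut-off operator omits the hops out of \<open>\<Lambda>\<close>,
  and these make up \<open>bdry\<close>.\<close>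

lemma laplacian_pwl:
  "laplacian \<Lambda> (pwl \<Lambda> k) = (\<lambda>x. of_real (dispersion k) * pwl \<Lambda> k x + bdry \<Lambda> k x)"
  for \<Lambda> :: "(int ^ 'n::finite) set"
proof
  fix x
  show "laplacian \<Lambda> (pwl \<Lambda> k) x = of_real (dispersion k) * pwl \<Lambda> k x + bdry \<Lambda> k x"
  proof (cases "x \<in> \<Lambda>")
    case True
    have "(\<Sum>e\<in>ingoing \<Lambda> x. pwl \<Lambda> k (x + e)) = (\<Sum>e\<in>ingoing \<Lambda> x. pw k (x + e))"
      by (intro sum.cong) (auto simp: ingoing_def pwl_def)
    also have "\<dots> = (\<Sum>e\<in>units. pw k (x + e)) - bdry \<Lambda> k x"
      using True by (simp add: sum_units_split[of _ \<Lambda> x] bdry_def)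
    also have "(\<Sum>e\<in>units. pw k (x + e)) = pw k x * of_real (2 * real CARD('n) - dispersion k)"
      by (simp add: pw_add sum_distrib_left[symmetric] sum_units_pw)
    finally show ?thesis using True by (simp add: laplacian_ingoing pwl_def algebra_simps)
  qed (simp add: laplacian_def pwl_def bdry_def)
qed

lemma norm_bdry_le: "cmod (bdry \<Lambda> k x) \<le> degout \<Lambda> x"
proof -
  have "cmod (\<Sum>e\<in>outgoing \<Lambda> x. pw k (x + e)) \<le> (\<Sum>e\<in>outgoing \<Lambda> x. 1)"
    by (intro sum_norm_le) (simp add: norm_pw)
  then show ?thesis by (simp add: bdry_def)
qed

lemma dispersion_range: "0 \<le> dispersion k" "dispersion k \<le> 4 * real CARD('n)"
  for k :: "real ^ 'n::finite"
proof -
  have "(\<Sum>i\<in>UNIV. cos (k $ i)) \<le> (\<Sum>i\<in>(UNIV::'n set). 1)" by (intro sum_mono) simp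
  then show "0 \<le> dispersion k" by (simp add: dispersion_def)
  have "(\<Sum>i\<in>UNIV. cos (k $ i)) \<ge> (\<Sum>i\<in>(UNIV::'n set). - 1)" by (intro sum_mono) simp
  then show "dispersion k \<le> 4 * real CARD('n)" by (simp add: dispersion_def)
qed

context eigenbasis
begin

text \<open>The overlap of \<open>\<phi>\<close> with the Laplacian of f_k is computed twice, by
  self-adjointness and by \<open>laplacian_pwl\<close>. This converts spectral weight of b_k into
  spectral weight of f_k.\<close>

lemma ip_bdry: "\<phi> \<in> \<Phi> \<Longrightarrow> ip \<Lambda> \<phi> (bdry \<Lambda> k) = of_real (ev \<phi> - dispersion k) * ip \<Lambda> \<phi> (pwl \<Lambda> k)"
proof -
  assume p: "\<phi> \<in> \<Phi>"
  have "ip \<Lambda> \<phi> (laplacian \<Lambda> (pwl \<Lambda> k))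
      = of_real (dispersion k) * ip \<Lambda> \<phi> (pwl \<Lambda> k) + ip \<Lambda> \<phi> (bdry \<Lambda> k)"
    unfolding laplacian_pwl by (simp add: ip_def sum.distrib sum_distrib_left algebra_simps)
  then show ?thesis using ip_laplacian[OF p pwl_l2] by (simp add: algebra_simps)
qed

definition wt :: "real ^ 'n \<Rightarrow> (int ^ 'n \<Rightarrow> complex) \<Rightarrow> real" where
  "wt k \<phi> = (cmod (ip \<Lambda> \<phi> (pwl \<Lambda> k)))\<^sup>2"

definition bwt :: "real ^ 'n \<Rightarrow> (int ^ 'n \<Rightarrow> complex) \<Rightarrow> real" where
  "bwt k \<phi> = (cmod (ip \<Lambda> \<phi> (bdry \<Lambda> k)))\<^sup>2"

lemma wt_nonneg: "0 \<le> wt k \<phi>" and bwt_nonneg: "0 \<le> bwt k \<phi>"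
  by (simp_all add: wt_def bwt_def)

lemma bwt_eq: "\<phi> \<in> \<Phi> \<Longrightarrow> bwt k \<phi> = (ev \<phi> - dispersion k)\<^sup>2 * wt k \<phi>"
  by (simp add: bwt_def wt_def ip_bdry norm_mult power_mult_distrib del: of_real_diff)

text \<open>Eigenvalues and dispersion both lie in \<open>[0, 4 d]\<close>, so they differ by at
  most \<open>4 d\<close>; hence the factor \<open>16 d^2\<close>.\<close>

lemma bwt_le: "\<phi> \<in> \<Phi> \<Longrightarrow> bwt k \<phi> \<le> 16 * (real CARD('n))\<^sup>2 * wt k \<phi>"
proof -
  assume p: "\<phi> \<in> \<Phi>"
  have "\<bar>ev \<phi> - dispersion k\<bar> \<le> 4 * real CARD('n)"
    using ev_range[OF p] dispersion_range[of k] by linarith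
  then have "(ev \<phi> - dispersion k)\<^sup>2 \<le> (4 * real CARD('n))\<^sup>2" by (rule power2_le_iff_abs_le[THEN iffD2, rotated]) simp
  then show ?thesis
    unfolding bwt_eq[OF p] by (intro mult_right_mono wt_nonneg) (simp add: power_mult_distrib)
qed

lemma sum_wt: "(\<Sum>\<phi>\<in>\<Phi>. wt k \<phi>) = real (card \<Lambda>)"
  unfolding wt_def parseval[OF pwl_l2, symmetric] by (rule sqn_pwl)

lemma sum_bwt: "(\<Sum>\<phi>\<in>\<Phi>. bwt k \<phi>) = sqn \<Lambda> (bdry \<Lambda> k)"
  unfolding bwt_def parseval[OF bdry_l2, symmetric] ..

end

section \<open>The Brillouin zone\<close>

abbreviation BZ :: "(real ^ 'n::finite) set" where
  "BZ \<equiv> cbox (\<chi> i. - pi) (\<chi> i. pi)"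

text \<open>Normalised Lebesgue measure on the zone. As a probability measure it absorbs the
  prefactors \<open>(2 pi)^-d\<close> and makes the plane waves orthonormal.\<close>

definition bz :: "(real ^ 'n::finite) measure" where
  "bz = density lborel (\<lambda>k. ennreal (indicator BZ k / (2 * pi) ^ CARD('n)))"

lemma sets_bz [measurable_cong, simp]: "sets bz = sets borel"
  by (simp add: bz_def)

lemma space_bz [simp]: "space bz = UNIV"
  by (simp add: bz_def)

lemma integral_bz:
  fixes f :: "real ^ 'n::finite \<Rightarrow> 'b::{banach, second_countable_topology}"
  assumes "f \<in> borel_measurable borel"
  shows "(\<integral>k. f k \<partial>bz) = (\<integral>k. (indicator BZ k / (2 * pi) ^ CARD('n)) *\<^sub>R f k \<partial>lborel)"
  unfolding bz_def using assms by (intro integral_density) auto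

lemma Basis_cart: "(Basis :: (real ^ 'n::finite) set) = range (\<lambda>i. axis i 1)"
  by (auto simp: Basis_vec_def)

lemma prod_Basis_cart:
  "(\<Prod>b\<in>(Basis :: (real ^ 'n::finite) set). f b) = (\<Prod>i\<in>UNIV. f (axis i 1))"
proof -
  have "inj (\<lambda>i::'n. axis i (1::real))" by (auto simp: inj_on_def axis_eq_axis)
  from prod.reindex[OF this, of f] show ?thesis by (simp add: Basis_cart comp_def)
qed

lemma emeasure_bz:
  "A \<in> sets borel \<Longrightarrow> emeasure bz A = emeasure lborel (BZ \<inter> A) / ennreal ((2 * pi) ^ CARD('n))"
  for A :: "(real ^ 'n::finite) set"
proof -
  assume A: "A \<in> sets borel"
  define c where "c = (2 * pi) ^ CARD('n)"
  have e: "1 / ennreal c = ennreal (1 / c)" using divide_ennreal[of 1 c] by (simp add: c_def)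
  have "emeasure bz A = (\<integral>\<^sup>+k. ennreal (indicator BZ k / (2 * pi) ^ CARD('n)) * indicator A k \<partial>lborel)"
    unfolding bz_def using A by (intro emeasure_density) auto
  also have "\<dots> = (\<integral>\<^sup>+k. indicator (BZ \<inter> A) k / ennreal ((2 * pi) ^ CARD('n)) \<partial>lborel)"
    unfolding c_def[symmetric] by (intro nn_integral_cong) (auto split: split_indicator simp: e)
  also have "\<dots> = emeasure lborel (BZ \<inter> A) / ennreal ((2 * pi) ^ CARD('n))"
    using A by (subst nn_integral_divide) auto
  finally show ?thesis .
qed

lemma emeasure_BZ: "emeasure lborel (BZ :: (real ^ 'n::finite) set) = ennreal ((2 * pi) ^ CARD('n))"
proof -
  have "emeasure lborel (BZ :: (real ^ 'n) set) = (\<Prod>b\<in>Basis. ((\<chi> i. pi) - (\<chi> i. - pi) :: real ^ 'n) \<bullet> b)"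
    by (rule emeasure_lborel_cbox) (auto simp: Basis_cart inner_axis)
  then show ?thesis by (simp add: prod_Basis_cart inner_axis)
qed

lemma emeasure_bz_UNIV: "emeasure (bz :: (real ^ 'n::finite) measure) UNIV = 1"
  by (simp add: emeasure_bz emeasure_BZ ennreal_divide_self)

lemma finite_measure_bz: "finite_measure bz"
  by (rule finite_measureI) (simp add: emeasure_bz_UNIV)

interpretation bz: finite_measure bz
  by (rule finite_measure_bz)

lemma measure_bz_UNIV [simp]: "measure (bz :: (real ^ 'n::finite) measure) UNIV = 1"
  by (simp add: measure_def emeasure_bz_UNIV)

lemma measure_bz:
  fixes A :: "(real ^ 'n::finite) set"
  assumes "A \<in> sets borel"
  shows "measure bz A = 1 / (2 * pi) ^ CARD('n) * measure lborel (BZ \<inter> A)"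
proof -
  have "emeasure lborel (BZ \<inter> A) \<le> emeasure lborel (BZ :: (real ^ 'n) set)"
    using assms by (intro emeasure_mono) auto
  then have "emeasure lborel (BZ \<inter> A) \<noteq> \<infinity>"
    by (auto simp: emeasure_BZ top_unique)
  then have "emeasure lborel (BZ \<inter> A) = ennreal (measure lborel (BZ \<inter> A))"
    by (simp add: emeasure_eq_ennreal_measure)
  then show ?thesis
    using assms by (simp add: measure_def[of bz] emeasure_bz divide_ennreal)
qed

lemma integrable_bz:
  fixes f :: "real ^ 'n::finite \<Rightarrow> 'b::{banach, second_countable_topology}"
  assumes "f \<in> borel_measurable borel" "\<And>k. norm (f k) \<le> B"
  shows "integrable bz f"
  using assms by (intro bz.integrable_const_bound[of _ B]) auto

lemma continuous_pw: "continuous_on UNIV (\<lambda>k. pw k x)"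
  unfolding pw_def by (intro continuous_intros)

lemma measurable_pw [measurable]: "(\<lambda>k. pw k x) \<in> borel_measurable borel"
  by (rule borel_measurable_continuous_onI[OF continuous_pw])

lemma continuous_dispersion: "continuous_on UNIV dispersion"
  unfolding dispersion_def by (intro continuous_intros)

lemma measurable_dispersion [measurable]: "dispersion \<in> borel_measurable borel"
  by (rule borel_measurable_continuous_onI[OF continuous_dispersion])

lemma measurable_cos_component [measurable]: "(\<lambda>k :: real ^ 'n::finite. cos (k $ i)) \<in> borel_measurable borel"
  by (intro borel_measurable_continuous_onI continuous_intros)

text \<open>Fubini, with Lebesgue measure written as the image of the product of one-dimensional
  measures over \<open>Basis\<close>.\<close>

lemma integral_lborel_prod:
  fixes g :: "'a::euclidean_space \<Rightarrow> real \<Rightarrow> complex"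
  assumes g: "\<And>b. b \<in> Basis \<Longrightarrow> integrable lborel (g b)"
  shows "(\<integral>k. (\<Prod>b\<in>Basis. g b (k \<bullet> b)) \<partial>lborel) = (\<Prod>b\<in>Basis. \<integral>t. g b t \<partial>lborel)"
proof -
  interpret product_sigma_finite "\<lambda>_ :: 'a. lborel :: real measure"
    by (simp add: product_sigma_finite_def sigma_finite_lborel)
  have [measurable]: "b \<in> Basis \<Longrightarrow> g b \<in> borel_measurable borel" for b
    using borel_measurable_integrable[OF g] by simp
  have "(\<integral>k. (\<Prod>b\<in>Basis. g b (k \<bullet> b)) \<partial>lborel)
      = (\<integral>f. (\<Prod>b\<in>Basis. g b ((\<Sum>c\<in>Basis. f c *\<^sub>R c) \<bullet> b)) \<partial>(\<Pi>\<^sub>M b\<in>(Basis :: 'a set). lborel))"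
    by (subst lborel_eq, subst integral_distr) auto
  also have "\<dots> = (\<integral>f. (\<Prod>b\<in>Basis. g b (f b)) \<partial>(\<Pi>\<^sub>M b\<in>(Basis :: 'a set). lborel))"
    by (intro Bochner_Integration.integral_cong prod.cong refl) simp
  also have "\<dots> = (\<Prod>b\<in>Basis. \<integral>t. g b t \<partial>lborel)"
    by (rule product_integral_prod) (use g in auto)
  finally show ?thesis .
qed

lemma integrable_cis_Icc: "integrable lborel (\<lambda>t. indicator {- pi..pi} t *\<^sub>R cis (t * m))"
  by (intro borel_integrable_compact continuous_intros) auto

lemma integral_cis_Icc:
  "(\<integral>t. indicator {- pi..pi} t *\<^sub>R cis (t * of_int m) \<partial>lborel) = (if m = 0 then 2 * of_real pi else 0)"
proof (cases "m = 0")
  case True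
  have "(\<integral>t. indicator {- pi..pi} t *\<^sub>R cis (t * of_int m) \<partial>lborel)
      = (of_real pi :: complex) - of_real (- pi)"
    by (rule integral_FTC_Icc) (use True in \<open>auto intro!: derivative_eq_intros simp: has_vector_derivative_of_real\<close>)
  with True show ?thesis by simp
next
  case False
  let ?F = "\<lambda>t. cis (t * of_int m) / (\<i> * of_int m)"
  have "(?F has_vector_derivative cis (t * of_int m)) (at t within {- pi..pi})" for t
  proof -
    have "((\<lambda>t. cis (t * of_int m)) has_vector_derivative \<i> * of_int m * cis (t * of_int m)) (at t within {- pi..pi})"
    proof -
      have "((\<lambda>z. exp (\<i> * of_int m * z)) has_field_derivative \<i> * of_int m * exp (\<i> * of_int m * of_real t))
          (at (of_real t))"
        by (auto intro!: derivative_eq_intros)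
      from has_vector_derivative_real_field[OF this] show ?thesis
        by (simp add: cis_conv_exp mult_ac)
    qed
    from has_vector_derivative_divide[OF this, of "\<i> * of_int m"] show ?thesis using False by simp
  qed
  then have "(\<integral>t. indicator {- pi..pi} t *\<^sub>R cis (t * of_int m) \<partial>lborel) = ?F pi - ?F (- pi)"
    by (intro integral_FTC_Icc) (auto intro!: continuous_intros)
  \<comment> \<open>Periodicity: the endpoints differ by an integer multiple of \<open>2 pi\<close>
    in the phase.\<close>
  also have "cis (pi * of_int m) = cis (- (pi * of_int m))"
    by (simp add: complex_eq_iff)
  finally show ?thesis using False by simp
qed

text \<open>Orthogonality of characters: the integral factorises over the coordinates, and any
  nonzero component of \<open>x\<close> contributes a factor 0.\<close>

theorem integral_pw: "(\<integral>k. pw k x \<partial>bz) = (if x = 0 then 1 else 0)"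
  for x :: "int ^ 'n::finite"
proof -
  \<comment> \<open>The product formula is indexed by basis vectors, so the components of
    \<open>x\<close> are looked up through them.\<close>
  define m where "m b = (of_int (x $ (SOME i. b = axis i 1)) :: real)" for b :: "real ^ 'n"
  have m: "m (axis i 1) = of_int (x $ i)" for i by (simp add: m_def axis_eq_axis)
  define g where "g b t = indicator {- pi..pi} t *\<^sub>R cis (t * m b)" for b :: "real ^ 'n" and t :: real
  have pc: "cis (\<Sum>i\<in>A. h i) = (\<Prod>i\<in>A. cis (h i))" if "finite A" for A :: "'n set" and h
    using that by induction (auto simp: cis_mult[symmetric])
  have pi: "indicator BZ k = (\<Prod>i\<in>UNIV. indicator {- pi..pi} (k $ i) :: complex)" for k :: "real ^ 'n"
    by (auto simp: mem_box_cart split: split_indicator)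
  have "(indicator BZ k / (2 * pi) ^ CARD('n)) *\<^sub>R pw k x
      = (\<Prod>b\<in>Basis. g b (k \<bullet> b)) / of_real ((2 * pi) ^ CARD('n))" for k :: "real ^ 'n"
  proof -
    have "(\<Prod>b\<in>Basis. g b (k \<bullet> b)) = (\<Prod>i\<in>UNIV. indicator {- pi..pi} (k $ i) * cis (k $ i * of_int (x $ i)))"
      by (simp add: prod_Basis_cart g_def m inner_axis) (auto intro!: prod.cong split: split_indicator)
    also have "\<dots> = indicator BZ k * pw k x"
      by (simp add: prod.distrib pi pw_def pc)
    finally show ?thesis by (simp split: split_indicator add: scaleR_conv_of_real field_simps)
  qed
  then have "(\<integral>k. pw k x \<partial>bz) = (\<integral>k. (\<Prod>b\<in>Basis. g b (k \<bullet> b)) / of_real ((2 * pi) ^ CARD('n)) \<partial>lborel)"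
    by (simp add: integral_bz del: of_real_power of_real_mult)
  also have "\<dots> = (\<Prod>b\<in>Basis. \<integral>t. g b t \<partial>lborel) / of_real ((2 * pi) ^ CARD('n))"
    by (subst integral_divide_zero, subst integral_lborel_prod)
      (simp_all add: g_def[abs_def] integrable_cis_Icc)
  also have "(\<Prod>b\<in>Basis. \<integral>t. g b t \<partial>lborel) = (\<Prod>i\<in>UNIV. if x $ i = 0 then 2 * of_real pi else 0)"
    unfolding prod_Basis_cart g_def m integral_cis_Icc ..
  also have "\<dots> = (if x = 0 then (2 * of_real pi) ^ CARD('n) else 0)"
    by (auto simp: vec_eq_iff)
  finally show ?thesis by auto
qed

lemma integral_cos: "(\<integral>k. cos (k $ i) \<partial>bz) = 0" for i :: "'n::finite"
proof -
  have "(\<integral>k. cos (k $ i) \<partial>bz) = (\<integral>k. Re (pw k (axis i 1)) \<partial>bz)" by (simp add: pw_axis)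
  also have "\<dots> = Re (\<integral>k. pw k (axis i 1) \<partial>bz)"
    by (rule integral_Re) (rule integrable_bz[of _ 1], simp_all add: norm_pw)
  also have "\<dots> = 0" by (simp add: integral_pw axis_eq_0_iff)
  finally show ?thesis .
qed

section \<open>Invariance under exchange of two coordinates\<close>

definition swap_coords :: "'n \<Rightarrow> 'n \<Rightarrow> real ^ 'n::finite \<Rightarrow> real ^ 'n" where
  "swap_coords i j k = (\<chi> l. k $ Transposition.transpose i j l)"

lemma measurable_swap_coords [measurable]: "swap_coords i j \<in> borel_measurable borel"
  unfolding swap_coords_def by (intro borel_measurable_continuous_onI continuous_intros)

text \<open>A swap maps boxes to boxes and permutes the side lengths, and the volumes of boxes
  determine Lebesgue measure.\<close>

lemma lborel_swap_coords:
  "distr lborel borel (swap_coords i j) = (lborel :: (real ^ 'n::finite) measure)"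
proof (rule lborel_eqI[symmetric])
  fix l u :: "real ^ 'n" assume lu: "\<And>b. b \<in> Basis \<Longrightarrow> l \<bullet> b \<le> u \<bullet> b"
  let ?t = "Transposition.transpose i j"
  have lu': "l $ a \<le> u $ a" for a using lu[of "axis a 1"] by (simp add: inner_axis)
  have "swap_coords i j -` box l u = box (swap_coords i j l) (swap_coords i j u)"
  proof (intro set_eqI iffI; simp add: mem_box_cart swap_coords_def; intro allI)
    fix k a
    show "\<forall>a. l $ a < k $ ?t a \<and> k $ ?t a < u $ a \<Longrightarrow> l $ ?t a < k $ a \<and> k $ a < u $ ?t a"
      by (drule spec[of _ "?t a"]) simp
    show "\<forall>a. l $ ?t a < k $ a \<and> k $ a < u $ ?t a \<Longrightarrow> l $ a < k $ ?t a \<and> k $ ?t a < u $ a"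
      by (drule spec[of _ "?t a"]) simp
  qed
  then have "emeasure (distr lborel borel (swap_coords i j)) (box l u)
      = emeasure lborel (box (swap_coords i j l) (swap_coords i j u))"
    by (simp add: emeasure_distr)
  also have "\<dots> = (\<Prod>a\<in>UNIV. (u - l) $ ?t a)"
  proof (subst emeasure_lborel_box)
    show "\<And>b. b \<in> Basis \<Longrightarrow> swap_coords i j l \<bullet> b \<le> swap_coords i j u \<bullet> b"
      using lu' by (auto simp: Basis_cart inner_axis swap_coords_def)
  qed (simp add: prod_Basis_cart inner_axis swap_coords_def)
  also have "(\<Prod>a\<in>UNIV. (u - l) $ ?t a) = (\<Prod>a\<in>UNIV. (u - l) $ a)"
    by (rule prod.reindex_bij_witness[of _ ?t ?t]) auto
  finally show "emeasure (distr lborel borel (swap_coords i j)) (box l u) = (\<Prod>b\<in>Basis. (u - l) \<bullet> b)"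
    by (simp add: prod_Basis_cart inner_axis)
qed simp

lemma integral_swap_coords:
  fixes f :: "real ^ 'n::finite \<Rightarrow> real"
  assumes [measurable]: "f \<in> borel_measurable borel"
  shows "(\<integral>k. f (swap_coords i j k) \<partial>bz) = (\<integral>k. f k \<partial>bz)"
proof -
  have B: "swap_coords i j k \<in> BZ \<longleftrightarrow> k \<in> BZ" for k :: "real ^ 'n"
    unfolding mem_box_cart swap_coords_def
    by simp (metis transpose_involutory)
  have "(\<integral>k. f k \<partial>bz) = (\<integral>k. (indicator BZ k / (2 * pi) ^ CARD('n)) *\<^sub>R f k \<partial>distr lborel borel (swap_coords i j))"
    unfolding lborel_swap_coords by (rule integral_bz) simp
  also have "\<dots> = (\<integral>k. (indicator BZ (swap_coords i j k) / (2 * pi) ^ CARD('n)) *\<^sub>R f (swap_coords i j k) \<partial>lborel)"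
    by (rule integral_distr) auto
  also have "\<dots> = (\<integral>k. f (swap_coords i j k) \<partial>bz)"
    by (subst integral_bz) (simp_all add: indicator_def B)
  finally show ?thesis ..
qed

lemma dispersion_swap_coords: "dispersion (swap_coords i j k) = dispersion k"
proof -
  have "(\<Sum>a\<in>UNIV. cos (k $ Transposition.transpose i j a)) = (\<Sum>a\<in>UNIV. cos (k $ a))"
    by (rule sum.reindex_bij_witness[of _ "Transposition.transpose i j" "Transposition.transpose i j"]) auto
  then show ?thesis by (simp add: dispersion_def swap_coords_def)
qed

section \<open>The Fermi level\<close>

text \<open>The cosine is strictly decreasing on \<open>[0, pi]\<close>, so shrinking
  \<open>k\<close> increases the cosine of every nonzero component.\<close>

lemma dispersion_radial:
  fixes k :: "real ^ 'n::finite"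
  assumes "k \<in> BZ" "k \<noteq> 0" "0 \<le> c" "c < 1"
  shows "dispersion (c *\<^sub>R k) < dispersion k"
proof -
  have lt: "cos (k $ i) < cos (c * k $ i)" if "k $ i \<noteq> 0" for i
  proof -
    have "\<bar>k $ i\<bar> \<le> pi" using assms(1) by (auto simp: mem_box_cart abs_le_iff) (metis minus_le_iff)
    moreover have "c * \<bar>k $ i\<bar> < \<bar>k $ i\<bar>" using assms that by simp
    ultimately have "cos \<bar>k $ i\<bar> < cos (c * \<bar>k $ i\<bar>)"
      using assms by (intro cos_monotone_0_pi) auto
    moreover have "c * \<bar>k $ i\<bar> = \<bar>c * k $ i\<bar>" using assms by (simp add: abs_mult)
    ultimately show ?thesis by simp
  qed
  obtain i where i: "k $ i \<noteq> 0" using assms(2) by (auto simp: vec_eq_iff)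
  have "(\<Sum>i\<in>UNIV. cos (k $ i)) < (\<Sum>i\<in>UNIV. cos (c * k $ i))"
  proof (rule sum_strict_mono_ex1)
    show "\<forall>i\<in>UNIV. cos (k $ i) \<le> cos (c * k $ i)"
    proof
      fix j show "cos (k $ j) \<le> cos (c * k $ j)" using lt[of j] by (cases "k $ j = 0") auto
    qed
    show "\<exists>i\<in>UNIV. cos (k $ i) < cos (c * k $ i)" using lt[OF i] by blast
  qed simp
  then show ?thesis by (simp add: dispersion_def)
qed

lemma dispersion_0: "dispersion 0 = 0"
  by (simp add: dispersion_def)

text \<open>By \<open>dispersion_radial\<close> each ray from the origin meets a level set at most
  once, and such starlike sets are negligible. The level 0 is treated apart because it contains the
  origin.\<close>

lemma negligible_level: "negligible {k \<in> (BZ :: (real ^ 'n::finite) set). dispersion k = E}"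
proof (cases "E = 0")
  case True
  have "k = 0" if "k \<in> BZ" "dispersion k = 0" for k :: "real ^ 'n"
    using dispersion_radial[OF that(1), of 0] that(2) by (auto simp: dispersion_0)
  then have "{k \<in> (BZ :: (real ^ 'n::finite) set). dispersion k = E} \<subseteq> {0}" using True by auto
  then show ?thesis by (rule negligible_subset[rotated]) simp
next
  case False
  show ?thesis
  proof (rule starlike_negligible_strong[where a = 0])
    show "closed {k \<in> (BZ :: (real ^ 'n::finite) set). dispersion k = E}"
      by (intro continuous_closed_preimage_constant continuous_on_subset[OF continuous_dispersion] closed_cbox) auto
    fix c :: real and x :: "real ^ 'n"
    assume c: "0 \<le> c" "c < 1" and x: "0 + x \<in> {k \<in> BZ. dispersion k = E}"
    then have "x \<noteq> 0" using False by (auto simp: dispersion_0)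
    with dispersion_radial[of x c] c x show "0 + c *\<^sub>R x \<notin> {k \<in> BZ. dispersion k = E}" by auto
  qed
qed

lemma AE_level: "AE k in bz. dispersion k \<noteq> E"
proof (rule AE_I)
  show "{k \<in> space bz. \<not> dispersion k \<noteq> E} \<subseteq> {k. dispersion k = E}" by auto
  have S: "{k :: real ^ 'a. dispersion k = E} \<in> sets borel" by measurable
  then show "{k. dispersion k = E} \<in> sets bz" by simp
  have "BZ \<inter> {k. dispersion k = E} = {k \<in> (BZ :: (real ^ 'a) set). dispersion k = E}" by auto
  moreover have "emeasure lebesgue {k \<in> (BZ :: (real ^ 'a) set). dispersion k = E} = 0"
    using negligible_level[of E] by (auto simp: negligible_iff_null_sets null_sets_def)
  moreover have "{k \<in> (BZ :: (real ^ 'a) set). dispersion k = E} \<in> sets borel" by measurable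
  ultimately show "emeasure bz {k :: real ^ 'a. dispersion k = E} = 0"
    using S by (simp add: emeasure_bz)
qed

text \<open>The integrated density of states of the free lattice, normalised to total mass
  1.\<close>

definition ids :: "'n::finite itself \<Rightarrow> real \<Rightarrow> real" where
  "ids _ E = measure bz {k :: real ^ 'n. dispersion k < E}"

text \<open>The restriction to the Brillouin zone is left to the measure \<open>bz\<close>.\<close>

abbreviation sea :: "real \<Rightarrow> real ^ 'n::finite \<Rightarrow> real" where
  "sea E \<equiv> indicator {k. dispersion k < E}"

lemma sets_sea [measurable]: "{k :: real ^ 'n::finite. dispersion k < E} \<in> sets borel"
  by measurable

lemma integral_sea: "(\<integral>k. sea E k \<partial>(bz :: (real ^ 'n::finite) measure)) = ids TYPE('n) E"
  by (simp add: ids_def)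

lemma ids_mono: "E \<le> E' \<Longrightarrow> ids T E \<le> ids T E'"
  unfolding ids_def by (intro bz.finite_measure_mono) auto

lemma ids_0: "ids T 0 = 0"
proof -
  have "{k :: real ^ 'a. dispersion k < 0} = {}" using dispersion_range(1) by (auto simp: not_less)
  then show ?thesis by (simp add: ids_def)
qed

lemma ids_top:
  assumes "4 * real CARD('n) \<le> E"
  shows "ids TYPE('n::finite) E = 1"
proof -
  have "AE k :: real ^ 'n in bz. dispersion k < E"
    using AE_level[of E]
  proof eventually_elim
    fix k :: "real ^ 'n" assume "dispersion k \<noteq> E"
    then show "dispersion k < E" using dispersion_range(2)[of k] assms by linarith
  qed
  then have "measure bz {k :: real ^ 'n. dispersion k < E} = measure (bz :: (real ^ 'n) measure) UNIV"
    by (intro measure_eq_AE) (auto elim: eventually_mono)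
  then show ?thesis by (simp add: ids_def)
qed

text \<open>Dominated convergence: the indicators converge except on the level set of
  \<open>E\<close>, which is a null set.\<close>

lemma isCont_ids: "isCont (ids TYPE('n::finite)) E"
  unfolding continuous_at_sequentially comp_def
proof (intro allI impI)
  fix X :: "nat \<Rightarrow> real" assume X: "X \<longlonglongrightarrow> E"
  have "(\<lambda>n. \<integral>k. sea (X n) k \<partial>(bz :: (real ^ 'n) measure)) \<longlonglongrightarrow> (\<integral>k. sea E k \<partial>(bz :: (real ^ 'n) measure))"
  proof (rule integral_dominated_convergence[where w = "\<lambda>_. 1"])
    show "AE k :: real ^ 'n in bz. (\<lambda>n. sea (X n) k) \<longlonglongrightarrow> (sea E k :: real)"
      using AE_level[of E]
    proof eventually_elim
      fix k :: "real ^ 'n" assume "dispersion k \<noteq> E"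
      then consider "dispersion k < E" | "E < dispersion k" by linarith
      then show "(\<lambda>n. sea (X n) k) \<longlonglongrightarrow> sea E k"
      proof cases
        case 1
        with order_tendstoD(1)[OF X 1] show ?thesis
          by (intro tendsto_eventually) (auto elim!: eventually_mono)
      next
        case 2
        with order_tendstoD(2)[OF X 2] show ?thesis
          by (intro tendsto_eventually) (auto elim!: eventually_mono)
      qed
    qed
  qed (auto simp: integrable_bz[of _ 1] split: split_indicator)
  then show "(\<lambda>n. ids TYPE('n) (X n)) \<longlonglongrightarrow> ids TYPE('n) E" by (simp only: integral_sea)
qed

text \<open>Otherwise the energy shell between \<open>E\<close> and \<open>E'\<close> would be null,
  although it contains a nonempty open subset of the zone.\<close>

lemma ids_strict_mono:
  assumes "0 \<le> E" "E < E'" "E' \<le> 4 * real CARD('n)"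
  shows "ids TYPE('n::finite) E < ids TYPE('n) E'"
proof (rule ccontr)
  assume "\<not> ?thesis"
  then have eq: "ids TYPE('n) E' = ids TYPE('n) E" using ids_mono[of E E' "TYPE('n)"] assms by linarith
  define A where "A = {k :: real ^ 'n. E \<le> dispersion k \<and> dispersion k < E'}"
  have [measurable]: "A \<in> sets borel" unfolding A_def by measurable
  have "{k :: real ^ 'n. dispersion k < E'} = {k. dispersion k < E} \<union> A"
    using assms by (auto simp: A_def)
  then have "ids TYPE('n) E' = ids TYPE('n) E + measure bz A"
    unfolding ids_def by (subst bz.finite_measure_Union[symmetric]) (auto simp: A_def)
  then have "emeasure bz A = 0" using eq by (simp add: bz.emeasure_eq_measure)
  then have "emeasure lborel (BZ \<inter> A) = 0"
    by (simp add: emeasure_bz ennreal_divide_eq_0_iff)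
  then have "BZ \<inter> A \<in> null_sets lebesgue" by (intro null_sets_completionI) auto
  then have neg: "negligible (BZ \<inter> A)" by (simp add: negligible_iff_null_sets)
  define U where "U = box (\<chi> i. - pi) (\<chi> i. pi) \<inter> {k :: real ^ 'n. E < dispersion k \<and> dispersion k < E'}"
  have "open U"
  proof -
    have "{k :: real ^ 'n. E < dispersion k \<and> dispersion k < E'} = {k. E < dispersion k} \<inter> {k. dispersion k < E'}" by auto
    then show ?thesis unfolding U_def
      by (auto intro!: open_Int open_box open_Collect_less continuous_dispersion continuous_intros)
  qed
  moreover have "U \<subseteq> BZ \<inter> A" using box_subset_cbox by (fastforce simp: U_def A_def)
  ultimately have U: "U = {}" using neg open_not_negligible negligible_subset by blast
  define d where "d = real CARD('n)"
  have d: "d \<ge> 1" by (simp add: d_def Suc_le_eq)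
  \<comment> \<open>Solves \<open>2 d (1 - y) = (E + E') / 2\<close>: the diagonal point with all
    components \<open>arccos y\<close> has its energy in the middle of the shell.\<close>
  define y where "y = 1 - (E + E') / (4 * d)"
  have y: "- 1 < y" "y < 1" using assms d by (auto simp: y_def field_simps d_def[symmetric])
  define k :: "real ^ 'n" where "k = (\<chi> i. arccos y)"
  have "dispersion k = (E + E') / 2"
    using y d by (simp add: dispersion_def k_def cos_arccos d_def[symmetric]) (simp add: y_def field_simps)
  moreover have "0 < arccos y" "arccos y < pi" using arccos_lt_bounded y by auto
  ultimately have "k \<in> U" using assms by (auto simp: U_def mem_box_cart k_def)
  then show False using U by simp
qed

lemma ids_pos: "0 < E \<Longrightarrow> 0 < ids TYPE('n::finite) E"
  using ids_strict_mono[of 0 "min E (4 * real CARD('n))", where 'n = 'n]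
    ids_mono[of "min E (4 * real CARD('n))" E "TYPE('n)"] ids_0[of "TYPE('n)"] by simp

lemma fermi_sea_eq: "fermi_sea E = BZ \<inter> {k. dispersion k < E}"
  by (auto simp: fermi_sea_def)

lemma ids_fermi_sea: "1 / (2 * pi) ^ CARD('n) * measure lborel (fermi_sea E :: (real ^ 'n::finite) set) = ids TYPE('n) E"
  by (simp add: ids_def measure_bz fermi_sea_eq)

text \<open>Existence of the level comes from the intermediate value theorem and uniqueness from
  strict monotonicity, so the definite description is meaningful. The endpoints are excluded since
  \<open>ids\<close> is 0 and 1 there.\<close>

lemma fermi_level:
  assumes "0 < \<rho>" "\<rho> < 1"
  shows "0 < fermi_level TYPE('n::finite) \<rho>" "fermi_level TYPE('n) \<rho> < 4 * real CARD('n)"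
    "ids TYPE('n) (fermi_level TYPE('n) \<rho>) = \<rho>"
proof -
  let ?P = "\<lambda>E. 0 \<le> E \<and> E \<le> 4 * real CARD('n) \<and> \<rho> = ids TYPE('n) E"
  have fl: "fermi_level TYPE('n) \<rho> = (THE E. ?P E)"
    unfolding fermi_level_def ids_fermi_sea ..
  have "\<exists>E\<ge>0. E \<le> 4 * real CARD('n) \<and> ids TYPE('n) E = \<rho>"
    using assms by (intro IVT) (auto simp: ids_0 ids_top isCont_ids)
  then obtain E where E: "?P E" by auto
  have "?P (fermi_level TYPE('n) \<rho>)"
    unfolding fl
  proof (rule theI[of ?P, OF E])
    fix E' assume "?P E'"
    then show "E' = E"
      using E ids_strict_mono[of E E', where 'n = 'n] ids_strict_mono[of E' E, where 'n = 'n]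
      by (cases E E' rule: linorder_cases) auto
  qed
  moreover from this have "fermi_level TYPE('n) \<rho> \<noteq> 0" "fermi_level TYPE('n) \<rho> \<noteq> 4 * real CARD('n)"
    using assms ids_0[of "TYPE('n)"] ids_top[where 'n = 'n, OF order_refl] by auto
  ultimately show "0 < fermi_level TYPE('n) \<rho>" "fermi_level TYPE('n) \<rho> < 4 * real CARD('n)"
    "ids TYPE('n) (fermi_level TYPE('n) \<rho>) = \<rho>" by auto
qed

lemma fermi_level_le:
  assumes "0 < \<rho>" "\<rho> < 1" "\<rho> \<le> ids TYPE('n::finite) E"
  shows "fermi_level TYPE('n) \<rho> \<le> E"
proof (rule ccontr)
  assume n: "\<not> ?thesis"
  note f = fermi_level[OF assms(1,2), where 'n = 'n]
  show False
  proof (cases "0 \<le> E")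
    case True
    then have "ids TYPE('n) E < ids TYPE('n) (fermi_level TYPE('n) \<rho>)"
      using n f by (intro ids_strict_mono) auto
    with f assms show False by simp
  next
    case False
    then show False using ids_mono[of E 0 "TYPE('n)"] assms by (simp add: ids_0)
  qed
qed

lemma integrable_sea: "integrable bz (\<lambda>k. g k * sea E k)"
  if "g \<in> borel_measurable borel" "\<And>k. \<bar>g k\<bar> \<le> B" for g :: "real ^ 'n::finite \<Rightarrow> real"
  using that order_trans[OF abs_ge_zero that(2)] by (intro integrable_bz[of _ B]) (auto split: split_indicator)

lemma integrable_dispersion_sea: "integrable bz (\<lambda>k. (a + b * dispersion k) * sea E k)"
  for a b :: real
proof (rule integrable_sea)
  show "\<bar>a + b * dispersion k\<bar> \<le> \<bar>a\<bar> + \<bar>b\<bar> * (4 * real CARD('a))" for k :: "real ^ 'a"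
    using mult_left_mono[of "\<bar>dispersion k\<bar>" "4 * real CARD('a)" "\<bar>b\<bar>"] dispersion_range[of k]
      abs_triangle_ineq[of a "b * dispersion k"] by (simp add: abs_mult)
qed auto

lemma energy_density_eq:
  "energy_density TYPE('n::finite) \<rho>
    = (\<integral>k. dispersion k * sea (fermi_level TYPE('n) \<rho>) k \<partial>(bz :: (real ^ 'n) measure))"
proof -
  let ?E = "fermi_level TYPE('n) \<rho>"
  have "(\<integral>k. dispersion k * sea ?E k \<partial>(bz :: (real ^ 'n) measure))
      = (\<integral>k. (indicator BZ k / (2 * pi) ^ CARD('n)) * (dispersion k * sea ?E k) \<partial>(lborel :: (real ^ 'n) measure))"
    by (subst integral_bz) auto
  also have "\<dots> = (\<integral>k. (indicator (fermi_sea ?E) k * dispersion k) / (2 * pi) ^ CARD('n) \<partial>(lborel :: (real ^ 'n) measure))"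
    by (intro Bochner_Integration.integral_cong) (auto simp: fermi_sea_eq split: split_indicator)
  finally show ?thesis by (simp add: energy_density_def set_lebesgue_integral_def)
qed

lemma xi_eq:
  assumes "0 < \<rho>" "\<rho> < 1"
  shows "xi TYPE('n::finite) \<rho> = (\<integral>k. (fermi_level TYPE('n) \<rho> - dispersion k)
    * sea (fermi_level TYPE('n) \<rho>) k \<partial>(bz :: (real ^ 'n) measure))"
proof -
  let ?E = "fermi_level TYPE('n) \<rho>"
  have i: "integrable bz (\<lambda>k :: real ^ 'n. ?E * sea ?E k)" "integrable bz (\<lambda>k :: real ^ 'n. dispersion k * sea ?E k)"
    using integrable_dispersion_sea[of ?E 0 ?E] integrable_dispersion_sea[of 0 1 ?E] by simp_all
  have "(\<integral>k. (?E - dispersion k) * sea ?E k \<partial>(bz :: (real ^ 'n) measure))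
      = (\<integral>k. ?E * sea ?E k - dispersion k * sea ?E k \<partial>(bz :: (real ^ 'n) measure))"
    by (simp add: algebra_simps)
  also have "\<dots> = ?E * ids TYPE('n) ?E - energy_density TYPE('n) \<rho>"
    by (simp add: Bochner_Integration.integral_diff[OF i] energy_density_eq ids_def)
  finally show ?thesis by (simp add: xi_def fermi_level[OF assms])
qed

text \<open>States of energy below half the Fermi level have a positive share of the zone, and each
  contributes at least half the Fermi level to the integral in \<open>xi_eq\<close>.\<close>

lemma xi_pos:
  assumes "0 < \<rho>" "\<rho> < 1"
  shows "0 < xi TYPE('n::finite) \<rho>"
proof -
  let ?E = "fermi_level TYPE('n) \<rho>"
  note f = fermi_level[OF assms, where 'n = 'n]
  have "0 < ?E / 2 * ids TYPE('n) (?E / 2)" using f(1) by (intro mult_pos_pos ids_pos) auto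
  also have "\<dots> = (\<integral>k. ?E / 2 * sea (?E / 2) k \<partial>(bz :: (real ^ 'n) measure))"
      by (simp only: integral_mult_right_zero integral_sea)
  also have "\<dots> \<le> (\<integral>k. (?E - dispersion k) * sea ?E k \<partial>(bz :: (real ^ 'n) measure))"
    using f(1) integrable_dispersion_sea[of "?E / 2" 0 "?E / 2"] integrable_dispersion_sea[of ?E "- 1" ?E]
    by (intro integral_mono) (auto split: split_indicator)
  finally show ?thesis by (simp add: xi_eq[OF assms])
qed

lemma integral_cos_sea_swap:
  "(\<integral>k. cos (k $ i) * sea E k \<partial>(bz :: (real ^ 'n::finite) measure)) = (\<integral>k. cos (k $ j) * sea E k \<partial>(bz :: (real ^ 'n) measure))"
proof -
  have sw: "cos (swap_coords i j k $ i) * sea E (swap_coords i j k) = cos (k $ j) * sea E k" for k :: "real ^ 'n"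
    by (simp add: indicator_def dispersion_swap_coords) (simp add: swap_coords_def)
  have "(\<integral>k. cos (k $ i) * sea E k \<partial>(bz :: (real ^ 'n) measure))
      = (\<integral>k. cos (swap_coords i j k $ i) * sea E (swap_coords i j k) \<partial>(bz :: (real ^ 'n) measure))"
    by (rule integral_swap_coords[symmetric]) measurable
  also have "\<dots> = (\<integral>k. cos (k $ j) * sea E k \<partial>(bz :: (real ^ 'n) measure))"
    by (simp only: sw)
  finally show ?thesis .
qed

lemma integrable_cos_sea: "integrable bz (\<lambda>k. cos (k $ i) * sea E k)"
  by (rule integrable_sea[of _ 1]) auto

text \<open>By the exchange symmetry the integral equals its average over the directions, so the
  sign is that of the integral of \<open>2 d - dispersion k\<close> over the sea.\<close>

theorem integral_cos_sea_pos:
  assumes "0 < E" "E < 4 * real CARD('n)"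
  shows "0 < (\<integral>k. cos (k $ i) * sea E k \<partial>(bz :: (real ^ 'n::finite) measure))"
proof -
  let ?d = "real CARD('n)"
  have "(\<Sum>j\<in>(UNIV :: 'n set). \<integral>k. cos (k $ j) * sea E k \<partial>(bz :: (real ^ 'n) measure))
      = (\<Sum>j\<in>(UNIV :: 'n set). \<integral>k. cos (k $ i) * sea E k \<partial>(bz :: (real ^ 'n) measure))"
    by (intro sum.cong refl integral_cos_sea_swap)
  then have "2 * (?d * (\<integral>k. cos (k $ i) * sea E k \<partial>(bz :: (real ^ 'n) measure)))
      = 2 * (\<Sum>j\<in>UNIV. \<integral>k. cos (k $ j) * sea E k \<partial>(bz :: (real ^ 'n) measure))"
    by simp
  also have "\<dots> = (\<integral>k. 2 * (\<Sum>j\<in>UNIV. cos (k $ j) * sea E k) \<partial>(bz :: (real ^ 'n) measure))"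
    by (simp only: integral_mult_right_zero Bochner_Integration.integral_sum[OF integrable_cos_sea])
  also have "\<dots> = (\<integral>k. (2 * ?d - dispersion k) * sea E k \<partial>(bz :: (real ^ 'n) measure))"
    by (intro Bochner_Integration.integral_cong) (auto simp: dispersion_def sum_distrib_right)
  finally have eq: "2 * (?d * (\<integral>k. cos (k $ i) * sea E k \<partial>(bz :: (real ^ 'n) measure))) = \<dots>" .
  have "0 < (\<integral>k. (2 * ?d - dispersion k) * sea E k \<partial>(bz :: (real ^ 'n) measure))"
  proof (cases "E \<le> 2 * ?d")
    case True
    \<comment> \<open>Up to half the bandwidth the integrand is nonnegative, and it is at least
      \<open>E / 2\<close> on the smaller sea of level \<open>E / 2\<close>.\<close>
    have "0 < E / 2 * ids TYPE('n) (E / 2)" using assms by (intro mult_pos_pos ids_pos) auto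
    also have "\<dots> = (\<integral>k. E / 2 * sea (E / 2) k \<partial>(bz :: (real ^ 'n) measure))"
      by (simp only: integral_mult_right_zero integral_sea)
    also have "\<dots> \<le> (\<integral>k. (2 * ?d - dispersion k) * sea E k \<partial>(bz :: (real ^ 'n) measure))"
      using True assms integrable_dispersion_sea[of "E / 2" 0 "E / 2"] integrable_dispersion_sea[of "2 * ?d" "- 1" E]
      by (intro integral_mono) (auto split: split_indicator)
    finally show ?thesis .
  next
    case False
    have "integrable bz (\<lambda>k :: real ^ 'n. cos (k $ j))" for j by (rule integrable_bz[of _ 1]) auto
    then have ii: "integrable bz (\<lambda>k :: real ^ 'n. 2 * ?d - dispersion k)" and z: "(\<integral>k. 2 * ?d - dispersion k \<partial>(bz :: (real ^ 'n) measure)) = 0"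
      by (simp_all add: dispersion_def integral_cos)
    \<comment> \<open>The integral over the full zone vanishes, so the sea can be replaced by its
      complement with opposite sign, where the integrand is at least \<open>E - 2 d\<close>.\<close>
    have "0 < (E - 2 * ?d) * (1 - ids TYPE('n) E)"
      using False ids_strict_mono[of E "4 * ?d", where 'n = 'n] assms by (auto simp: ids_top)
    also have "\<dots> = (\<integral>k. (E - 2 * ?d) * (1 - sea E k) \<partial>(bz :: (real ^ 'n) measure))"
    proof -
      have "integrable bz (\<lambda>k :: real ^ 'n. 1 :: real)" "integrable bz (sea E :: real ^ 'n \<Rightarrow> real)"
        by (rule integrable_bz[of _ 1]; simp)+
      from Bochner_Integration.integral_diff[OF this] show ?thesis by (simp add: ids_def)
    qed
    also have "\<dots> \<le> (\<integral>k. (2 * ?d - dispersion k) * sea E k - (2 * ?d - dispersion k) \<partial>(bz :: (real ^ 'n) measure))"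
    proof (rule integral_mono)
      show "integrable bz (\<lambda>k :: real ^ 'n. (E - 2 * ?d) * (1 - sea E k))"
        by (rule integrable_bz[of _ "\<bar>E - 2 * ?d\<bar>"]) (auto split: split_indicator)
      show "integrable bz (\<lambda>k :: real ^ 'n. (2 * ?d - dispersion k) * sea E k - (2 * ?d - dispersion k))"
        using integrable_dispersion_sea[of "2 * ?d" "- 1" E, where 'a = 'n]
        by (intro Bochner_Integration.integrable_diff ii) simp
    qed (use False in \<open>auto split: split_indicator\<close>)
    also have "\<dots> = (\<integral>k. (2 * ?d - dispersion k) * sea E k \<partial>(bz :: (real ^ 'n) measure))"
      using z integrable_dispersion_sea[of "2 * ?d" "- 1" E, where 'a = 'n]
      by (subst Bochner_Integration.integral_diff[OF _ ii]) simp_all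
    finally show ?thesis .
  qed
  then show ?thesis unfolding eq[symmetric] by (simp add: zero_less_mult_iff)
qed

section \<open>The energy excess\<close>

lemma measurable_cnj_pw [measurable]: "(\<lambda>k. cnj (pw k x)) \<in> borel_measurable borel"
  by (simp add: pw_uminus[symmetric])

lemma integral_pw_pw: "(\<integral>k. cnj (pw k x) * pw k y \<partial>bz) = (if y = x then 1 else 0)"
proof -
  have "(\<integral>k. cnj (pw k x) * pw k y \<partial>bz) = (\<integral>k. pw k (y - x) \<partial>bz)"
    by (simp add: pw_diff mult.commute)
  then show ?thesis by (simp add: integral_pw)
qed

lemma integrable_pw_pw: "integrable bz (\<lambda>k. c * (cnj (pw k x) * pw k y))"
  by (rule integrable_bz[of _ "cmod c"]) (auto simp: norm_mult norm_pw)

text \<open>Termwise orthogonality. The second sum carries a frequency map \<open>h\<close> because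
  in \<open>ip_bdry_eq\<close> several bonds may lead to the same site.\<close>

lemma integral_trig_product:
  assumes "finite A" "finite B"
  shows "(\<integral>k. cnj (\<Sum>x\<in>A. a x * pw k x) * (\<Sum>y\<in>B. b y * pw k (h y)) \<partial>bz)
    = (\<Sum>x\<in>A. \<Sum>y\<in>B. if h y = x then cnj (a x) * b y else 0)"
proof -
  have "(\<integral>k. cnj (\<Sum>x\<in>A. a x * pw k x) * (\<Sum>y\<in>B. b y * pw k (h y)) \<partial>bz)
      = (\<integral>k. (\<Sum>x\<in>A. \<Sum>y\<in>B. (cnj (a x) * b y) * (cnj (pw k x) * pw k (h y))) \<partial>bz)"
    by (intro Bochner_Integration.integral_cong refl)
      (simp only: cnj_sum complex_cnj_mult sum_product, intro sum.cong refl, simp only: mult_ac)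
  also have "\<dots> = (\<Sum>x\<in>A. \<Sum>y\<in>B. (cnj (a x) * b y) * (\<integral>k. cnj (pw k x) * pw k (h y) \<partial>bz))"
    by (simp only: Bochner_Integration.integral_sum Bochner_Integration.integrable_sum integrable_pw_pw
        integral_mult_right_zero)
  also have "\<dots> = (\<Sum>x\<in>A. \<Sum>y\<in>B. if h y = x then cnj (a x) * b y else 0)"
    by (intro sum.cong refl) (simp add: integral_pw_pw)
  finally show ?thesis .
qed

lemma integral_norm_trig:
  assumes "finite A"
  shows "(\<integral>k. (cmod (\<Sum>x\<in>A. a x * pw k x))\<^sup>2 \<partial>bz) = (\<Sum>x\<in>A. (cmod (a x))\<^sup>2)"
proof -
  let ?f = "\<lambda>k. \<Sum>x\<in>A. a x * pw k x"
  have "(of_real (\<integral>k. (cmod (?f k))\<^sup>2 \<partial>bz) :: complex) = (\<integral>k. of_real ((cmod (?f k))\<^sup>2) \<partial>bz)"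
    by (rule integral_complex_of_real[symmetric])
  also have "\<dots> = (\<integral>k. cnj (?f k) * ?f k \<partial>bz)"
    by (simp only: complex_norm_square mult.commute)
  also have "\<dots> = (\<Sum>x\<in>A. \<Sum>y\<in>A. if y = x then cnj (a x) * a y else 0)"
    by (rule integral_trig_product[OF assms assms])
  also have "\<dots> = (\<Sum>x\<in>A. cnj (a x) * a x)"
    using assms by (simp add: sum.delta)
  also have "\<dots> = of_real (\<Sum>x\<in>A. (cmod (a x))\<^sup>2)"
    unfolding of_real_sum by (intro sum.cong refl) (simp only: complex_norm_square mult.commute)
  finally show ?thesis by (simp only: of_real_eq_iff)
qed

text \<open>The variance of \<open>g\<close> under the probability measure \<open>bz\<close> is
  nonnegative.\<close>

lemma square_integral_le:
  fixes g :: "real ^ 'n::finite \<Rightarrow> real"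
  assumes [measurable]: "g \<in> borel_measurable borel" and B: "\<And>k. \<bar>g k\<bar> \<le> B"
  shows "(\<integral>k. g k \<partial>bz)\<^sup>2 \<le> (\<integral>k. (g k)\<^sup>2 \<partial>bz)"
proof -
  define r where "r = (\<integral>k. g k \<partial>bz)"
  have i: "integrable bz g" using B by (intro integrable_bz[of _ B]) auto
  have i2: "integrable bz (\<lambda>k. (g k)\<^sup>2)"
    using power_mono[OF B abs_ge_zero, of _ 2] by (intro integrable_bz[of _ "B\<^sup>2"]) auto
  have "0 \<le> (\<integral>k. (g k - r)\<^sup>2 \<partial>bz)" by simp
  also have "\<dots> = (\<integral>k. (g k)\<^sup>2 - 2 * r * g k + r\<^sup>2 \<partial>bz)"
    by (simp add: power2_eq_square algebra_simps)
  also have "\<dots> = (\<integral>k. (g k)\<^sup>2 \<partial>bz) - 2 * r * r + r\<^sup>2"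
    using i i2 by (simp add: r_def)
  finally show ?thesis by (simp add: r_def power2_eq_square)
qed

lemma ip_pwl: "ip A \<phi> (pwl A k) = (\<Sum>x\<in>A. cnj (\<phi> x) * pw k x)"
  by (simp add: ip_def pwl_def)

lemma ip_bdry_eq:
  assumes "finite A"
  shows "ip A \<phi> (bdry A k) = (\<Sum>z\<in>(SIGMA x:A. outgoing A x). cnj (\<phi> (fst z)) * pw k (fst z + snd z))"
  using assms by (simp add: ip_def bdry_def sum_distrib_left sum.Sigma finite_outgoing case_prod_beta)

lemma measurable_bdry [measurable]: "(\<lambda>k. bdry A k x) \<in> borel_measurable borel"
  by (cases "x \<in> A") (simp_all add: bdry_def)

lemma measurable_ip [measurable]:
  "(\<lambda>k. ip A \<phi> (pwl A k)) \<in> borel_measurable borel"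
  "(\<lambda>k. ip A \<phi> (bdry A k)) \<in> borel_measurable borel"
  by (simp_all add: ip_pwl) (simp add: ip_def)

lemma Re_pw_units:
  fixes e :: "int ^ 'n::finite"
  assumes "e \<in> units"
  obtains i where "\<And>k. Re (pw k e) = cos (k $ i)"
  using assms by (auto simp: units_eq pw_axis)

context eigenbasis
begin

lemma measurable_wt [measurable]: "(\<lambda>k. wt k \<phi>) \<in> borel_measurable borel"
  and measurable_bwt [measurable]: "(\<lambda>k. bwt k \<phi>) \<in> borel_measurable borel"
  by (simp_all add: wt_def bwt_def)

lemma wt_le: "\<phi> \<in> \<Phi> \<Longrightarrow> wt k \<phi> \<le> real (card \<Lambda>)"
  using member_le_sum[of \<phi> \<Phi> "wt k"] finite_basis by (simp add: wt_nonneg sum_wt)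

lemma integral_wt: "\<phi> \<in> \<Phi> \<Longrightarrow> (\<integral>k. wt k \<phi> \<partial>bz) = 1"
  unfolding wt_def ip_pwl integral_norm_trig[OF finite_domain]
  using sqn_basis[of \<phi>] by (simp add: sqn_def)

lemma integrable_wt: "\<phi> \<in> \<Phi> \<Longrightarrow> integrable bz (\<lambda>k. wt k \<phi>)"
  by (rule integrable_bz[of _ "real (card \<Lambda>)"]) (auto simp: wt_nonneg wt_le)

text \<open>By \<open>ip_bdry\<close>, the weighted difference
  \<open>ev \<phi> - dispersion k\<close> is a product of overlaps with f_k and b_k. The former has
  frequencies in \<open>\<Lambda>\<close>, the latter only outside, so its mean is 0.\<close>

lemma integral_dispersion_wt:
  assumes "\<phi> \<in> \<Phi>"
  shows "(\<integral>k. dispersion k * wt k \<phi> \<partial>bz) = ev \<phi>" and "integrable bz (\<lambda>k. dispersion k * wt k \<phi>)"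
proof -
  show i: "integrable bz (\<lambda>k. dispersion k * wt k \<phi>)"
    using assms dispersion_range[where 'n = 'n]
    by (intro integrable_bz[of _ "4 * real CARD('n) * real (card \<Lambda>)"])
      (auto simp: wt_nonneg abs_mult wt_le intro!: mult_mono)
  have "of_real ((ev \<phi> - dispersion k) * wt k \<phi>) = cnj (ip \<Lambda> \<phi> (pwl \<Lambda> k)) * ip \<Lambda> \<phi> (bdry \<Lambda> k)" for k
    unfolding ip_bdry[OF assms] wt_def of_real_mult complex_norm_square by (simp add: mult_ac)
  then have "of_real (\<integral>k. (ev \<phi> - dispersion k) * wt k \<phi> \<partial>bz)
      = (\<integral>k. cnj (ip \<Lambda> \<phi> (pwl \<Lambda> k)) * ip \<Lambda> \<phi> (bdry \<Lambda> k) \<partial>bz)"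
    by (simp only: integral_complex_of_real[symmetric])
  also have "\<dots> = 0"
    unfolding ip_pwl ip_bdry_eq[OF finite_domain]
    by (subst integral_trig_product)
      (auto simp: finite_domain finite_units outgoing_def intro!: sum.neutral finite_SigmaI)
  finally have "(\<integral>k. (ev \<phi> - dispersion k) * wt k \<phi> \<partial>bz) = 0" by simp
  moreover have "(\<integral>k. (ev \<phi> - dispersion k) * wt k \<phi> \<partial>bz) = ev \<phi> - (\<integral>k. dispersion k * wt k \<phi> \<partial>bz)"
    using i integrable_wt[OF assms]
    by (simp add: left_diff_distrib integral_wt[OF assms])
  ultimately show "(\<integral>k. dispersion k * wt k \<phi> \<partial>bz) = ev \<phi>" by simp
qed

definition below :: "real \<Rightarrow> (int ^ 'n \<Rightarrow> complex) set" where
  "below E = {\<phi> \<in> \<Phi>. ev \<phi> < E}"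

definition above :: "real \<Rightarrow> (int ^ 'n \<Rightarrow> complex) set" where
  "above E = {\<phi> \<in> \<Phi>. \<not> ev \<phi> < E}"

lemma below_above: "finite (below E)" "finite (above E)" "below E \<subseteq> \<Phi>" "above E \<subseteq> \<Phi>"
  using finite_basis by (auto simp: below_def above_def)

lemma sum_below_above: "(\<Sum>\<phi>\<in>\<Phi>. f \<phi>) = (\<Sum>\<phi>\<in>below E. f \<phi>) + (\<Sum>\<phi>\<in>above E. f \<phi>)"
  for f :: "_ \<Rightarrow> 'b::comm_monoid_add"
proof -
  have u: "\<Phi> = below E \<union> above E" and d: "below E \<inter> above E = {}" by (auto simp: below_def above_def)
  show ?thesis by (subst u) (rule sum.union_disjoint[OF below_above(1,2) d])
qed

text \<open>
  \<open>bgap\<close> is \<open>gap\<close> without the factors \<open>|\<epsilon>\<^sub>k - E|\<close> and with \<open>f\<^sub>k\<close> replaced by \<open>b\<^sub>k\<close>. The degeneracy of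
  those factors at the Fermi surface is harmless, since a thin shell around it has small measure.
\<close>

definition gap :: "real \<Rightarrow> real ^ 'n \<Rightarrow> real" where
  "gap E k = (E - dispersion k) * sea E k * (\<Sum>\<phi>\<in>above E. wt k \<phi>)
    + (dispersion k - E) * (1 - sea E k) * (\<Sum>\<phi>\<in>below E. wt k \<phi>)"

text \<open>Since the total weight is \<open>card \<Lambda>\<close>, the weight above
  \<open>E\<close> can be traded for the weight below, which leaves terms whose means over
  \<open>k\<close> are known.\<close>

lemma gap_eq:
  "gap E k = real (card \<Lambda>) * ((E - dispersion k) * sea E k) - (\<Sum>\<phi>\<in>below E. E * wt k \<phi> - dispersion k * wt k \<phi>)"
  unfolding gap_def sum_wt[of k, symmetric] sum_below_above[of "wt k" E]
  by (simp add: algebra_simps sum_subtractf sum_distrib_left sum.distrib split: split_indicator)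

lemma integrable_gap: "integrable bz (gap E)"
proof -
  have "integrable bz (\<lambda>k :: real ^ 'n. (E - dispersion k) * sea E k)"
    using integrable_dispersion_sea[of E "- 1" E, where 'a = 'n] by simp
  then show ?thesis
    unfolding gap_eq[abs_def]
    using below_above(3)[of E] integrable_wt integral_dispersion_wt(2) by (auto simp: subset_iff)
qed

lemma gap_nonneg: "0 \<le> gap E k"
  by (auto simp: gap_def wt_nonneg split: split_indicator intro!: mult_nonneg_nonneg sum_nonneg)

text \<open>Integrating \<open>gap_eq\<close> gives \<open>card \<Lambda>\<close> times
  \<open>xi\<close> minus the sum of \<open>(E - ev)_+\<close>, which is the lower bound of
  \<open>lowest_sum_ge\<close> at the Fermi level minus the bulk energy.\<close>

theorem excess_ge:
  assumes \<rho>: "0 < \<rho>" "\<rho> < 1" and N: "real N = \<rho> * real (card \<Lambda>)"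
    and E: "E = fermi_level TYPE('n) \<rho>"
  shows "(\<integral>k. gap E k \<partial>bz) \<le> lowest_sum \<Lambda> N - energy_density TYPE('n) \<rho> * real (card \<Lambda>)"
proof -
  have i: "integrable bz (\<lambda>k :: real ^ 'n. (E - dispersion k) * sea E k)"
    using integrable_dispersion_sea[of E "- 1" E, where 'a = 'n] by simp
  have b: "\<phi> \<in> below E \<Longrightarrow> \<phi> \<in> \<Phi>" for \<phi> by (simp add: below_def)
  have "real N \<le> real (card \<Phi>)" using \<rho> unfolding N card_basis by (intro mult_left_le_one_le) auto
  then have N': "N \<le> card \<Phi>" by simp
  have "(\<integral>k. gap E k \<partial>bz) = real (card \<Lambda>) * (\<integral>k. (E - dispersion k) * sea E k \<partial>(bz :: (real ^ 'n) measure))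
      - (\<Sum>\<phi>\<in>below E. E * (\<integral>k. wt k \<phi> \<partial>bz) - (\<integral>k. dispersion k * wt k \<phi> \<partial>bz))"
    unfolding gap_eq using i b integrable_wt integral_dispersion_wt(2)
    by (simp add: Bochner_Integration.integral_sum)
  also have "\<dots> = real (card \<Lambda>) * xi TYPE('n) \<rho> - (\<Sum>\<phi>\<in>below E. E - ev \<phi>)"
    using xi_eq[OF \<rho>, where 'n = 'n] E b
    by (simp add: integral_wt integral_dispersion_wt(1))
  also have "(\<Sum>\<phi>\<in>below E. E - ev \<phi>) = (\<Sum>\<phi>\<in>\<Phi>. max 0 (E - ev \<phi>))"
    unfolding sum_below_above[of _ E] by (simp add: below_def above_def)
  also have "real (card \<Lambda>) * xi TYPE('n) \<rho> = E * real N - energy_density TYPE('n) \<rho> * real (card \<Lambda>)"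
    by (simp add: xi_def N E algebra_simps)
  finally show ?thesis using lowest_sum_ge[OF N', of E] by linarith
qed

lemma sqn_bdry_le: "sqn \<Lambda> (bdry \<Lambda> k) \<le> (\<Sum>x\<in>\<Lambda>. (degout \<Lambda> x)\<^sup>2)"
  unfolding sqn_def by (intro sum_mono power_mono norm_bdry_le) auto

definition bgap :: "real \<Rightarrow> real ^ 'n \<Rightarrow> real" where
  "bgap E k = sea E k * (\<Sum>\<phi>\<in>above E. bwt k \<phi>) + (1 - sea E k) * (\<Sum>\<phi>\<in>below E. bwt k \<phi>)"

lemma measurable_bgap [measurable]: "bgap E \<in> borel_measurable borel"
  unfolding bgap_def by measurable

lemma bgap_bound: "0 \<le> bgap E k" "bgap E k \<le> (\<Sum>x\<in>\<Lambda>. (degout \<Lambda> x)\<^sup>2)"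
proof -
  have nn: "0 \<le> (\<Sum>\<phi>\<in>above E. bwt k \<phi>)" "0 \<le> (\<Sum>\<phi>\<in>below E. bwt k \<phi>)"
    by (auto intro!: sum_nonneg bwt_nonneg)
  then show "0 \<le> bgap E k" by (auto simp: bgap_def split: split_indicator)
  have "(\<Sum>\<phi>\<in>below E. bwt k \<phi>) + (\<Sum>\<phi>\<in>above E. bwt k \<phi>) = sqn \<Lambda> (bdry \<Lambda> k)"
    using sum_bwt sum_below_above[of "bwt k" E] by simp
  then show "bgap E k \<le> (\<Sum>x\<in>\<Lambda>. (degout \<Lambda> x)\<^sup>2)"
    using nn sqn_bdry_le[of k] by (auto simp: bgap_def split: split_indicator)
qed

text \<open>With P the projection onto the span of \<open>below E\<close>, the vector is (1-P) b_k
  inside the sea and - P b_k outside. So \<open>bgap\<close> measures how far P b_k is from b_k cut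
  off to the sea.\<close>

lemma bgap_eq_sqn:
  "bgap E k = sqn \<Lambda> (\<lambda>x. of_real (sea E k) * bdry \<Lambda> k x - (\<Sum>\<phi>\<in>below E. ip \<Lambda> \<phi> (bdry \<Lambda> k) * \<phi> x))"
proof (cases "dispersion k < E")
  case True
  have "bdry \<Lambda> k x = (\<Sum>\<phi>\<in>\<Phi>. ip \<Lambda> \<phi> (bdry \<Lambda> k) * \<phi> x)" for x
    using expansion[OF bdry_l2, of k] by (rule fun_cong)
  then have e: "bdry \<Lambda> k x = (\<Sum>\<phi>\<in>below E. ip \<Lambda> \<phi> (bdry \<Lambda> k) * \<phi> x)
      + (\<Sum>\<phi>\<in>above E. ip \<Lambda> \<phi> (bdry \<Lambda> k) * \<phi> x)" for x
    unfolding sum_below_above[of _ E, symmetric] .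
  have "bdry \<Lambda> k x - (\<Sum>\<phi>\<in>below E. ip \<Lambda> \<phi> (bdry \<Lambda> k) * \<phi> x)
      = (\<Sum>\<phi>\<in>above E. ip \<Lambda> \<phi> (bdry \<Lambda> k) * \<phi> x)" for x
    by (subst e) simp
  then show ?thesis
    using True by (simp add: bgap_def bwt_def sqn_combination[OF orthonormal finite_basis below_above(4)])
next
  case False
  have "sqn \<Lambda> (\<lambda>x. - f x) = sqn \<Lambda> f" for f by (simp add: sqn_def)
  with False show ?thesis
    by (simp add: bgap_def bwt_def sqn_combination[OF orthonormal finite_basis below_above(3)])
qed

end

lemma measure_shell:
  "(\<integral>k. sea (E + \<delta>) k - sea (E - \<delta>) k \<partial>(bz :: (real ^ 'n::finite) measure))
    = ids TYPE('n) (E + \<delta>) - ids TYPE('n) (E - \<delta>)"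
proof -
  have i: "integrable bz (sea E' :: real ^ 'n \<Rightarrow> real)" for E' by (rule integrable_bz[of _ 1]) simp_all
  show ?thesis by (subst Bochner_Integration.integral_diff[OF i i]) (simp add: ids_def)
qed

context eigenbasis
begin

text \<open>At distance at least \<open>\<delta>\<close> from the Fermi surface the factor in
  \<open>gap\<close> is at least \<open>\<delta>\<close>, and \<open>bwt_le\<close> compares the
  weights. In the shell the crude bound of \<open>bgap\<close> by the squared boundary degrees is
  used.\<close>

lemma bgap_le_gap:
  assumes "0 < \<delta>"
  shows "\<delta> * bgap E k \<le> 16 * (real CARD('n))\<^sup>2 * gap E k
    + \<delta> * (\<Sum>x\<in>\<Lambda>. (degout \<Lambda> x)\<^sup>2) * (sea (E + \<delta>) k - sea (E - \<delta>) k)"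
proof -
  let ?D = "16 * (real CARD('n))\<^sup>2" and ?W = "\<Sum>x\<in>\<Lambda>. (degout \<Lambda> x)\<^sup>2"
  have le: "(\<Sum>\<phi>\<in>J. bwt k \<phi>) \<le> ?D * (\<Sum>\<phi>\<in>J. wt k \<phi>)" if "J \<subseteq> \<Phi>" for J
    unfolding sum_distrib_left using that by (intro sum_mono bwt_le) auto
  have nn: "0 \<le> (\<Sum>\<phi>\<in>J. wt k \<phi>)" for J by (intro sum_nonneg wt_nonneg)
  consider "dispersion k < E - \<delta>" | "E + \<delta> \<le> dispersion k" | "E - \<delta> \<le> dispersion k" "dispersion k < E + \<delta>"
    by linarith
  then show ?thesis
  proof cases
    case 1
    have "\<delta> * (\<Sum>\<phi>\<in>above E. bwt k \<phi>) \<le> (E - dispersion k) * (?D * (\<Sum>\<phi>\<in>above E. wt k \<phi>))"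
      using 1 assms nn by (intro mult_mono le below_above) (auto intro!: sum_nonneg bwt_nonneg)
    with 1 assms show ?thesis by (simp add: bgap_def gap_def algebra_simps)
  next
    case 2
    have "\<delta> * (\<Sum>\<phi>\<in>below E. bwt k \<phi>) \<le> (dispersion k - E) * (?D * (\<Sum>\<phi>\<in>below E. wt k \<phi>))"
      using 2 assms nn by (intro mult_mono le below_above) (auto intro!: sum_nonneg bwt_nonneg)
    with 2 assms show ?thesis by (simp add: bgap_def gap_def algebra_simps)
  next
    case 3
    have "\<delta> * bgap E k \<le> \<delta> * ?W" using assms bgap_bound(2) by simp
    with 3 show ?thesis using gap_nonneg[of E k] by (simp add: add_increasing)
  qed
qed

text \<open>
  The summand \<open>P b\<^sub>k(x)\<close> of \<open>F x k\<close> has no Fourier coefficient at \<open>x\<close>, so the coefficient of \<open>F x\<close> there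
  is \<open>c\<close> times the number of bonds leaving \<open>x\<close>; its square is at most the mean square of \<open>F x\<close>.
\<close>

theorem integral_bgap_ge:
  fixes c :: real
  assumes c: "0 \<le> c" "\<And>i :: 'n. c = (\<integral>k. cos (k $ i) * sea E k \<partial>(bz :: (real ^ 'n) measure))"
  shows "c\<^sup>2 * (\<Sum>x\<in>\<Lambda>. (degout \<Lambda> x)\<^sup>2) \<le> (\<integral>k. bgap E k \<partial>bz)"
proof -
  let ?W = "\<Sum>x\<in>\<Lambda>. (degout \<Lambda> x)\<^sup>2"
  define F where "F x k = of_real (sea E k) * bdry \<Lambda> k x - (\<Sum>\<phi>\<in>below E. ip \<Lambda> \<phi> (bdry \<Lambda> k) * \<phi> x)" for x k
  have [measurable]: "F x \<in> borel_measurable borel" for x unfolding F_def by measurable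
  have bF: "bgap E k = (\<Sum>x\<in>\<Lambda>. (cmod (F x k))\<^sup>2)" for k
    unfolding bgap_eq_sqn sqn_def F_def ..
  have W0: "0 \<le> ?W" by (intro sum_nonneg) auto
  have F_le: "cmod (F x k) \<le> sqrt ?W" if "x \<in> \<Lambda>" for x k
  proof (rule real_le_rsqrt)
    have "(cmod (F x k))\<^sup>2 \<le> (\<Sum>x\<in>\<Lambda>. (cmod (F x k))\<^sup>2)"
      using that finite_domain by (intro member_le_sum) auto
    then show "(cmod (F x k))\<^sup>2 \<le> ?W" using bgap_bound(2)[of E k] by (simp add: bF)
  qed
  have key: "(c * degout \<Lambda> x)\<^sup>2 \<le> (\<integral>k. (cmod (F x k))\<^sup>2 \<partial>bz)" if x: "x \<in> \<Lambda>" for x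
  proof -
    \<comment> \<open>The mean of \<open>g\<close> is the real part of the Fourier coefficient of
      \<open>F x\<close> at \<open>x\<close>.\<close>
    define g where "g k = Re (cnj (pw k x) * F x k)" for k
    have [measurable]: "g \<in> borel_measurable borel" unfolding g_def by measurable
    have gF: "\<bar>g k\<bar> \<le> cmod (F x k)" for k
      using abs_Re_le_cmod[of "cnj (pw k x) * F x k"] by (simp add: g_def norm_mult norm_pw)
    have i1: "integrable bz (\<lambda>k. Re (pw k e) * sea E k)" for e
      using abs_Re_le_cmod[of "pw _ e"] by (intro integrable_sea[of _ 1]) (auto simp: norm_pw)
    have i2: "integrable bz (\<lambda>k. cnj (pw k x) * ip \<Lambda> \<phi> (bdry \<Lambda> k))" for \<phi>
      unfolding ip_bdry_eq[OF finite_domain] sum_distrib_left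
    proof (rule Bochner_Integration.integrable_sum)
      fix z :: "(int ^ 'n) \<times> (int ^ 'n)"
      show "integrable bz (\<lambda>k. cnj (pw k x) * (cnj (\<phi> (fst z)) * pw k (fst z + snd z)))"
        by (rule integrable_bz[of _ "cmod (\<phi> (fst z))"]) (simp_all add: norm_mult norm_pw)
    qed
    \<comment> \<open>The frequencies of this overlap are endpoints of bonds leaving
      \<open>\<Lambda>\<close>, hence different from \<open>x\<close>.\<close>
    have z: "(\<integral>k. cnj (pw k x) * ip \<Lambda> \<phi> (bdry \<Lambda> k) \<partial>bz) = 0" for \<phi>
    proof -
      have "(\<integral>k. cnj (\<Sum>x\<in>{x}. 1 * pw k x) * ip \<Lambda> \<phi> (bdry \<Lambda> k) \<partial>bz) = 0"
        unfolding ip_bdry_eq[OF finite_domain] using x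
        by (subst integral_trig_product)
          (auto simp: finite_domain finite_units outgoing_def intro!: sum.neutral finite_SigmaI)
      then show ?thesis by simp
    qed
    have geq: "g k = (\<Sum>e\<in>outgoing \<Lambda> x. Re (pw k e) * sea E k)
        - Re (\<Sum>\<phi>\<in>below E. \<phi> x * (cnj (pw k x) * ip \<Lambda> \<phi> (bdry \<Lambda> k)))" for k
    proof -
      have u: "cnj (pw k x) * pw k x = 1"
        using complex_norm_square[of "pw k x"] by (simp add: norm_pw mult.commute)
      have "cnj (pw k x) * bdry \<Lambda> k x = (cnj (pw k x) * pw k x) * (\<Sum>e\<in>outgoing \<Lambda> x. pw k e)"
        using x by (simp add: bdry_def pw_add sum_distrib_left mult_ac)
      then have b: "cnj (pw k x) * bdry \<Lambda> k x = (\<Sum>e\<in>outgoing \<Lambda> x. pw k e)" by (simp add: u)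
      have "cnj (pw k x) * F x k = of_real (sea E k) * (cnj (pw k x) * bdry \<Lambda> k x)
          - (\<Sum>\<phi>\<in>below E. \<phi> x * (cnj (pw k x) * ip \<Lambda> \<phi> (bdry \<Lambda> k)))"
        by (simp add: F_def algebra_simps sum_distrib_left)
      also have "\<dots> = of_real (sea E k) * (\<Sum>e\<in>outgoing \<Lambda> x. pw k e)
          - (\<Sum>\<phi>\<in>below E. \<phi> x * (cnj (pw k x) * ip \<Lambda> \<phi> (bdry \<Lambda> k)))"
        unfolding b ..
      finally show ?thesis by (simp add: g_def sum_distrib_left mult_ac split: split_indicator)
    qed
    have "(\<integral>k. g k \<partial>bz) = (\<Sum>e\<in>outgoing \<Lambda> x. \<integral>k. Re (pw k e) * sea E k \<partial>bz)
        - Re (\<Sum>\<phi>\<in>below E. \<phi> x * (\<integral>k. cnj (pw k x) * ip \<Lambda> \<phi> (bdry \<Lambda> k) \<partial>bz))"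
    proof -
      let ?S = "\<lambda>k. \<Sum>\<phi>\<in>below E. \<phi> x * (cnj (pw k x) * ip \<Lambda> \<phi> (bdry \<Lambda> k))"
      have iS: "integrable bz ?S" by (intro Bochner_Integration.integrable_sum integrable_mult_right i2)
      have iU: "integrable bz (\<lambda>k. \<Sum>e\<in>outgoing \<Lambda> x. Re (pw k e) * sea E k)"
        by (intro Bochner_Integration.integrable_sum i1)
      have "(\<integral>k. g k \<partial>bz) = (\<integral>k. (\<Sum>e\<in>outgoing \<Lambda> x. Re (pw k e) * sea E k) \<partial>bz) - (\<integral>k. Re (?S k) \<partial>bz)"
        unfolding geq by (rule Bochner_Integration.integral_diff[OF iU integrable_Re[OF iS]])
      also have "(\<integral>k. Re (?S k) \<partial>bz) = Re (\<integral>k. ?S k \<partial>bz)" by (rule integral_Re[OF iS])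
      also have "(\<integral>k. ?S k \<partial>bz) = (\<Sum>\<phi>\<in>below E. \<phi> x * (\<integral>k. cnj (pw k x) * ip \<Lambda> \<phi> (bdry \<Lambda> k) \<partial>bz))"
        by (simp only: Bochner_Integration.integral_sum[OF integrable_mult_right[OF i2]] integral_mult_right_zero)
      also have "(\<integral>k. (\<Sum>e\<in>outgoing \<Lambda> x. Re (pw k e) * sea E k) \<partial>bz)
          = (\<Sum>e\<in>outgoing \<Lambda> x. \<integral>k. Re (pw k e) * sea E k \<partial>bz)"
        by (rule Bochner_Integration.integral_sum[OF i1])
      finally show ?thesis .
    qed
    also have "\<dots> = (\<Sum>e\<in>outgoing \<Lambda> x. c)"
    proof -
      \<comment> \<open>For either orientation of the bond the real part is the cosine of one
        component, and \<open>c\<close> is common to all components.\<close>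
      have "(\<integral>k. Re (pw k e) * sea E k \<partial>(bz :: (real ^ 'n) measure)) = c" if e: "e \<in> outgoing \<Lambda> x" for e
      proof -
        from e have "e \<in> units" by (simp add: outgoing_def)
        then obtain i where "Re (pw k e) = cos (k $ i)" for k using Re_pw_units[of e] by blast
        then show ?thesis using c(2)[of i] by simp
      qed
      then show ?thesis by (simp add: z)
    qed
    finally have "(c * degout \<Lambda> x)\<^sup>2 = (\<integral>k. g k \<partial>bz)\<^sup>2" by (simp add: mult.commute)
    also have "\<dots> \<le> (\<integral>k. (g k)\<^sup>2 \<partial>bz)"
      using gF F_le[OF x] by (intro square_integral_le[of _ "sqrt ?W"]) (auto intro: order_trans)
    also have "\<dots> \<le> (\<integral>k. (cmod (F x k))\<^sup>2 \<partial>bz)"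
    proof (rule integral_mono)
      have p: "(cmod (F x k))\<^sup>2 \<le> ?W" for k
        using power_mono[OF F_le[OF x, of k] norm_ge_zero, of 2] W0 by simp
      show gp: "(g k)\<^sup>2 \<le> (cmod (F x k))\<^sup>2" for k
        using gF[of k] by (simp add: abs_le_square_iff[symmetric])
      show "integrable bz (\<lambda>k. (cmod (F x k))\<^sup>2)" using p by (intro integrable_bz[of _ ?W]) auto
      show "integrable bz (\<lambda>k. (g k)\<^sup>2)"
        using order_trans[OF gp p] by (intro integrable_bz[of _ ?W]) auto
    qed
    finally show ?thesis .
  qed
  have int: "integrable bz (\<lambda>k. (cmod (F x k))\<^sup>2)" if "x \<in> \<Lambda>" for x
    using power_mono[OF F_le[OF that] norm_ge_zero, of _ 2] W0 by (intro integrable_bz[of _ ?W]) auto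
  have "c\<^sup>2 * ?W = (\<Sum>x\<in>\<Lambda>. (c * degout \<Lambda> x)\<^sup>2)" by (simp add: sum_distrib_left power_mult_distrib)
  also have "\<dots> \<le> (\<Sum>x\<in>\<Lambda>. \<integral>k. (cmod (F x k))\<^sup>2 \<partial>bz)" by (intro sum_mono key)
  also have "\<dots> = (\<integral>k. bgap E k \<partial>bz)" unfolding bF using int by (simp add: Bochner_Integration.integral_sum)
  finally show ?thesis .
qed

text \<open>After integration of \<open>bgap_le_gap\<close> the shell consumes at most half of the
  amount \<open>c\<^sup>2 W\<close> supplied by \<open>integral_bgap_ge\<close>, \<open>W\<close>
  being the sum of squared boundary degrees; hence \<open>32 = 2 * 16\<close>. Degrees are natural
  numbers, so \<open>W\<close> is at least the number of boundary bonds.\<close>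

theorem gap_lower_bound:
  assumes c: "0 \<le> c" "\<And>i :: 'n. c = (\<integral>k. cos (k $ i) * sea E k \<partial>(bz :: (real ^ 'n) measure))"
    and \<delta>: "0 < \<delta>" "ids TYPE('n) (E + \<delta>) - ids TYPE('n) (E - \<delta>) \<le> c\<^sup>2 / 2"
  shows "\<delta> * c\<^sup>2 / (32 * (real CARD('n))\<^sup>2) * real (boundary_bonds \<Lambda>) \<le> (\<integral>k. gap E k \<partial>bz)"
proof -
  let ?D = "16 * (real CARD('n))\<^sup>2" and ?W = "\<Sum>x\<in>\<Lambda>. (degout \<Lambda> x)\<^sup>2"
  let ?s = "ids TYPE('n) (E + \<delta>) - ids TYPE('n) (E - \<delta>)"
  have W0: "0 \<le> ?W" by (intro sum_nonneg) auto
  have ib: "integrable bz (bgap E)" using bgap_bound by (intro integrable_bz[of _ ?W]) auto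
  have ish: "integrable bz (\<lambda>k :: real ^ 'n. sea (E + \<delta>) k - sea (E - \<delta>) k :: real)"
    by (rule integrable_bz[of _ 1]) (auto split: split_indicator)
  have "\<delta> * (c\<^sup>2 * ?W) \<le> \<delta> * (\<integral>k. bgap E k \<partial>bz)"
    using \<delta>(1) integral_bgap_ge[OF c] by simp
  also have "\<dots> = (\<integral>k. \<delta> * bgap E k \<partial>bz)" by simp
  also have "\<dots> \<le> (\<integral>k. ?D * gap E k + \<delta> * ?W * (sea (E + \<delta>) k - sea (E - \<delta>) k) \<partial>bz)"
    by (intro integral_mono bgap_le_gap \<delta> Bochner_Integration.integrable_add integrable_mult_right ib integrable_gap ish)
  also have "\<dots> = ?D * (\<integral>k. gap E k \<partial>bz) + \<delta> * ?W * ?s"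
    by (subst Bochner_Integration.integral_add)
      (simp_all only: integrable_mult_right integrable_gap ish integral_mult_right_zero measure_shell)
  also have "\<dots> \<le> ?D * (\<integral>k. gap E k \<partial>bz) + \<delta> * ?W * (c\<^sup>2 / 2)"
    using \<delta> W0 by (intro add_left_mono mult_left_mono) auto
  finally have "\<delta> * c\<^sup>2 / 2 * ?W \<le> ?D * (\<integral>k. gap E k \<partial>bz)" by (simp add: algebra_simps)
  moreover have "real (boundary_bonds \<Lambda>) \<le> ?W"
  proof -
    have "real n \<le> (real n)\<^sup>2" for n :: nat
      using le_square[of n] by (simp add: power2_eq_square flip: of_nat_mult)
    then show ?thesis unfolding boundary_bonds_eq[OF finite_domain] of_nat_sum by (intro sum_mono)
  qed
  then have "\<delta> * c\<^sup>2 / 2 * real (boundary_bonds \<Lambda>) \<le> \<delta> * c\<^sup>2 / 2 * ?W"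
    using \<delta>(1) by (intro mult_left_mono) auto
  ultimately have "\<delta> * c\<^sup>2 / 2 * real (boundary_bonds \<Lambda>) \<le> ?D * (\<integral>k. gap E k \<partial>bz)" by linarith
  moreover have "?D > 0" by simp
  ultimately show ?thesis by (simp add: field_simps)
qed

text \<open>
  The form of \<open>h\<close> dominates the number of leaving bonds times \<open>|\<psi>|\<^sup>2\<close>, hence low-energy vectors
  have little mass on the support of \<open>b\<^sub>k\<close>.
\<close>

lemma sum_below_bwt:
  assumes "0 < E"
  shows "(\<Sum>\<phi>\<in>below E. bwt k \<phi>) \<le> E * real (boundary_bonds \<Lambda>)"
proof -
  define \<psi> where "\<psi> = (\<lambda>x. \<Sum>\<phi>\<in>below E. ip \<Lambda> \<phi> (bdry \<Lambda> k) * \<phi> x)"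
  let ?s = "\<Sum>\<phi>\<in>below E. bwt k \<phi>"
  have ps: "ip \<Lambda> \<phi> \<psi> = (if \<phi> \<in> below E then ip \<Lambda> \<phi> (bdry \<Lambda> k) else 0)" if "\<phi> \<in> \<Phi>" for \<phi>
    unfolding \<psi>_def by (rule orthonormal_combination[OF orthonormal finite_basis that below_above(3)])
  have l: "\<psi> \<in> l2 \<Lambda>"
    using basis_l2 below_above(3) by (auto simp: \<psi>_def l2_def subset_iff intro!: sum.neutral)
  have "(\<Sum>x\<in>\<Lambda>. degout \<Lambda> x * (cmod (\<psi> x))\<^sup>2) \<le> (\<Sum>\<phi>\<in>\<Phi>. ev \<phi> * (cmod (ip \<Lambda> \<phi> \<psi>))\<^sup>2)"
    by (rule quadratic_form_ge(1)[OF l])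
  also have "\<dots> = (\<Sum>\<phi>\<in>below E. ev \<phi> * bwt k \<phi>)"
    unfolding sum_below_above[of _ E] by (simp add: ps bwt_def below_def above_def)
  also have "\<dots> \<le> (\<Sum>\<phi>\<in>below E. E * bwt k \<phi>)"
    by (intro sum_mono mult_right_mono bwt_nonneg) (simp add: below_def)
  finally have q: "(\<Sum>x\<in>\<Lambda>. degout \<Lambda> x * (cmod (\<psi> x))\<^sup>2) \<le> E * ?s" by (simp add: sum_distrib_left)
  have "of_real ?s = ip \<Lambda> \<psi> (bdry \<Lambda> k)"
    unfolding \<psi>_def ip_sum_left bwt_def of_real_sum complex_norm_square by (simp add: mult.commute)
  then have "?s = cmod (ip \<Lambda> \<psi> (bdry \<Lambda> k))"
    using sum_nonneg[of "below E" "bwt k"] by (metis abs_of_nonneg norm_of_real bwt_nonneg)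
  also have "\<dots> \<le> (\<Sum>x\<in>\<Lambda>. cmod (cnj (\<psi> x) * bdry \<Lambda> k x))" unfolding ip_def by (rule norm_sum)
  also have "\<dots> \<le> (\<Sum>x\<in>\<Lambda>. (degout \<Lambda> x * (cmod (\<psi> x))\<^sup>2 / E + E * degout \<Lambda> x) / 2)"
  proof (rule sum_mono)
    fix x
    have "cmod (cnj (\<psi> x) * bdry \<Lambda> k x) \<le> cmod (\<psi> x) * degout \<Lambda> x"
      by (simp add: norm_mult mult_left_mono norm_bdry_le)
    also have "cmod (\<psi> x) \<le> ((cmod (\<psi> x))\<^sup>2 / E + E) / 2"
      using assms sum_squares_bound[of "cmod (\<psi> x)" E] by (simp add: field_simps power2_eq_square)
    then have "cmod (\<psi> x) * degout \<Lambda> x \<le> ((cmod (\<psi> x))\<^sup>2 / E + E) / 2 * degout \<Lambda> x"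
      by (rule mult_right_mono) simp
    finally show "cmod (cnj (\<psi> x) * bdry \<Lambda> k x) \<le> (degout \<Lambda> x * (cmod (\<psi> x))\<^sup>2 / E + E * degout \<Lambda> x) / 2"
      by (simp add: algebra_simps)
  qed
  also have "\<dots> = ((\<Sum>x\<in>\<Lambda>. degout \<Lambda> x * (cmod (\<psi> x))\<^sup>2) / E + E * real (boundary_bonds \<Lambda>)) / 2"
    by (simp add: boundary_bonds_eq[OF finite_domain] sum.distrib sum_divide_distrib[symmetric] sum_distrib_left[symmetric])
  \<comment> \<open>By \<open>q\<close> the first term is at most \<open>?s\<close> itself, so
    \<open>?s\<close> is at most half of \<open>?s\<close> plus \<open>E\<close> times the number of
    bonds; the weight \<open>E\<close> in the mean inequality was chosen for this.\<close>
  also have "\<dots> \<le> (E * ?s / E + E * real (boundary_bonds \<Lambda>)) / 2"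
    using q assms by (intro divide_right_mono add_right_mono) auto
  finally show ?thesis using assms by simp
qed

end

section \<open>Boundary vectors at low density\<close>

lemma norm_pw_add_minus_1: "cmod (pw k (x + y) - 1) \<le> cmod (pw k x - 1) + cmod (pw k y - 1)"
proof -
  have "pw k (x + y) - 1 = pw k x * (pw k y - 1) + (pw k x - 1)" by (simp add: pw_add algebra_simps)
  also have "cmod \<dots> \<le> cmod (pw k x * (pw k y - 1)) + cmod (pw k x - 1)" by (rule norm_triangle_ineq)
  finally show ?thesis by (simp add: norm_mult norm_pw)
qed

text \<open>All terms \<open>1 - cos (k $ j)\<close> are nonnegative and add up to half the
  dispersion, so each of them is at most that.\<close>

lemma Re_pw_units_low:
  fixes e :: "int ^ 'n::finite"
  assumes "dispersion k \<le> E" "e \<in> units"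
  shows "1 - E / 2 \<le> Re (pw k e)"
proof -
  obtain i where i: "Re (pw k e) = cos (k $ i)" using Re_pw_units[OF assms(2)] by metis
  have "1 - cos (k $ i) \<le> (\<Sum>j\<in>UNIV. 1 - cos (k $ j))"
    by (rule member_le_sum) auto
  also have "\<dots> = dispersion k / 2" by (simp add: dispersion_def sum_subtractf)
  finally show ?thesis using assms i by simp
qed

text \<open>The squared distance is \<open>2 - 2 Re\<close>, hence at most \<open>1 / 9\<close>. The
  threshold is set so that three hops together stay within distance 1 of the phase 1.\<close>

lemma norm_pw_units_low:
  fixes e :: "int ^ 'n::finite"
  assumes "dispersion k \<le> 1 / 9" "e \<in> units"
  shows "cmod (pw k e - 1) \<le> 1 / 3"
proof -
  have "(Re (pw k e))\<^sup>2 + (Im (pw k e))\<^sup>2 = 1" using cmod_power2[of "pw k e"] by (simp add: norm_pw)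
  then have "(cmod (pw k e - 1))\<^sup>2 = 2 - 2 * Re (pw k e)"
    unfolding cmod_power2 by (simp add: power2_eq_square algebra_simps)
  also have "\<dots> \<le> (1 / 3)\<^sup>2" using Re_pw_units_low[OF assms] by (simp add: power2_eq_square)
  finally show ?thesis by (rule power2_le_imp_le) simp
qed

context eigenbasis
begin

text \<open>The product of two neighbouring entries is a sum of phases, each accumulated over the
  three hops \<open>e\<close>, \<open>b\<close> and \<open>- a\<close>; such a phase is within 1 of
  1 and so has nonnegative real part.\<close>

lemma Re_hop_bdry_nonneg:
  assumes "dispersion k \<le> 1 / 9"
  shows "0 \<le> Re (hop \<Lambda> (bdry \<Lambda> k))"
proof -
  have "0 \<le> Re (cnj (bdry \<Lambda> k x) * bdry \<Lambda> k (x + e))" if x: "x \<in> \<Lambda>" and e: "e \<in> ingoing \<Lambda> x" for x e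
  proof -
    have "cnj (bdry \<Lambda> k x) * bdry \<Lambda> k (x + e)
        = (\<Sum>a\<in>outgoing \<Lambda> x. \<Sum>b\<in>outgoing \<Lambda> (x + e). cnj (pw k (x + a)) * pw k (x + e + b))"
      using x e by (simp add: bdry_def ingoing_def sum_product)
    also have "\<dots> = (\<Sum>a\<in>outgoing \<Lambda> x. \<Sum>b\<in>outgoing \<Lambda> (x + e). pw k (e + (b + - a)))"
    proof (intro sum.cong refl)
      fix a b
      have "pw k (x + e + b - (x + a)) = pw k (x + e + b) * cnj (pw k (x + a))" by (rule pw_diff)
      then show "cnj (pw k (x + a)) * pw k (x + e + b) = pw k (e + (b + - a))"
        by (simp add: algebra_simps)
    qed
    finally have eq: "cnj (bdry \<Lambda> k x) * bdry \<Lambda> k (x + e) = \<dots>" .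
    have "0 \<le> Re (pw k (e + (b + - a)))" if "a \<in> outgoing \<Lambda> x" "b \<in> outgoing \<Lambda> (x + e)" for a b
    proof -
      have "cmod (pw k (e + (b + - a)) - 1) \<le> cmod (pw k e - 1) + (cmod (pw k b - 1) + cmod (pw k (- a) - 1))"
        using norm_pw_add_minus_1[of k e "b + - a"] norm_pw_add_minus_1[of k b "- a"] by linarith
      also have "\<dots> \<le> 1 / 3 + (1 / 3 + 1 / 3)"
        using that e by (intro add_mono norm_pw_units_low[OF assms]) (auto simp: outgoing_def ingoing_def uminus_units)
      finally show ?thesis using abs_Re_le_cmod[of "pw k (e + (b + - a)) - 1"] by simp
    qed
    then show ?thesis unfolding eq by (auto intro!: sum_nonneg)
  qed
  then show ?thesis unfolding hop_def Re_sum by (intro sum_nonneg)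
qed

text \<open>The phases at a site nearly align: each has real part at least \<open>17 / 18\<close>,
  whose square is \<open>289 / 324\<close>.\<close>

lemma sqn_bdry_ge:
  assumes "dispersion k \<le> 1 / 9"
  shows "289 / 324 * real (boundary_bonds \<Lambda>) \<le> sqn \<Lambda> (bdry \<Lambda> k)"
proof -
  have "289 / 324 * degout \<Lambda> x \<le> (cmod (bdry \<Lambda> k x))\<^sup>2" if x: "x \<in> \<Lambda>" for x
  proof -
    have "degout \<Lambda> x * (17 / 18) = (\<Sum>e\<in>outgoing \<Lambda> x. 1 - (1 / 9) / 2 :: real)" by simp
    also have "\<dots> \<le> (\<Sum>e\<in>outgoing \<Lambda> x. Re (pw k e))"
      by (intro sum_mono Re_pw_units_low[OF assms]) (simp add: outgoing_def)
    also have "\<dots> \<le> cmod (\<Sum>e\<in>outgoing \<Lambda> x. pw k e)"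
      using complex_Re_le_cmod[of "\<Sum>e\<in>outgoing \<Lambda> x. pw k e"] by simp
    also have "\<dots> = cmod (bdry \<Lambda> k x)"
      using x by (simp add: bdry_def pw_add sum_distrib_left[symmetric] norm_mult norm_pw)
    finally have "(degout \<Lambda> x * (17 / 18))\<^sup>2 \<le> (cmod (bdry \<Lambda> k x))\<^sup>2" by (rule power_mono) simp
    then have "289 / 324 * (degout \<Lambda> x)\<^sup>2 \<le> (cmod (bdry \<Lambda> k x))\<^sup>2"
      by (simp add: power_mult_distrib power_divide)
    moreover have "degout \<Lambda> x \<le> (degout \<Lambda> x)\<^sup>2"
      using le_square[of "card (outgoing \<Lambda> x)"] by (simp add: power2_eq_square flip: of_nat_mult)
    ultimately show ?thesis by linarith
  qed
  then show ?thesis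
    unfolding boundary_bonds_eq[OF finite_domain] of_nat_sum sqn_def sum_distrib_left by (intro sum_mono)
qed

text \<open>The cubic inequality \<open>r\<^sup>2 (3 d - r) \<le> 4 d\<^sup>3\<close> turns weight
  of b_k, damped by \<open>3 d - r\<close>, into weight of f_k. Summed over all states the damped
  weight is large, and the states below \<open>E\<close> hold only a small part of it by
  \<open>sum_below_bwt\<close>.\<close>

lemma sum_above_wt_ge:
  assumes E: "0 < E" "E \<le> 1 / 9" and k: "dispersion k < E"
  shows "real (boundary_bonds \<Lambda>) / (10 * (real CARD('n))\<^sup>2) \<le> (\<Sum>\<phi>\<in>above E. wt k \<phi>)"
proof -
  define d where "d = real CARD('n)"
  have d: "1 \<le> d" by (simp add: d_def Suc_le_eq)
  let ?B = "real (boundary_bonds \<Lambda>)"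
  define \<epsilon> where "\<epsilon> = dispersion k"
  have \<epsilon>: "0 \<le> \<epsilon>" "\<epsilon> < E" using dispersion_range(1) k by (auto simp: \<epsilon>_def)
  have "(3 * d + \<epsilon> - ev \<phi>) * bwt k \<phi> \<le> 4 * d ^ 3 * wt k \<phi>" if "\<phi> \<in> \<Phi>" for \<phi>
  proof -
    define r where "r = ev \<phi> - \<epsilon>"
    \<comment> \<open>The right-hand side expands to \<open>r^3 - 3 d r^2 + 4 d^3\<close>; the
      factor \<open>r + d\<close> is nonnegative since \<open>ev \<phi>\<close> is, and since
      \<open>\<epsilon>\<close> is below \<open>1 / 9\<close> and hence below
      \<open>d\<close>.\<close>
    have "0 \<le> (r - 2 * d)\<^sup>2 * (r + d)" using ev_range(1)[OF that] \<epsilon> E d by (auto simp: r_def)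
    then have "(3 * d - r) * r\<^sup>2 \<le> 4 * d ^ 3" by (simp add: power2_eq_square power3_eq_cube algebra_simps)
    then have "(3 * d - r) * r\<^sup>2 * wt k \<phi> \<le> 4 * d ^ 3 * wt k \<phi>" by (intro mult_right_mono wt_nonneg)
    then show ?thesis unfolding bwt_eq[OF that] by (simp add: r_def \<epsilon>_def algebra_simps)
  qed
  then have "(\<Sum>\<phi>\<in>above E. (3 * d + \<epsilon> - ev \<phi>) * bwt k \<phi>) \<le> 4 * d ^ 3 * (\<Sum>\<phi>\<in>above E. wt k \<phi>)"
    unfolding sum_distrib_left using below_above(4) by (intro sum_mono) auto
  moreover have "(\<Sum>\<phi>\<in>below E. (3 * d + \<epsilon> - ev \<phi>) * bwt k \<phi>) \<le> (\<Sum>\<phi>\<in>below E. 4 * d * bwt k \<phi>)"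
    using \<epsilon> E d ev_range(1) by (intro sum_mono mult_right_mono bwt_nonneg) (fastforce simp: below_def)
  moreover have "(\<Sum>\<phi>\<in>below E. 4 * d * bwt k \<phi>) \<le> 4 * d * (1 / 9 * ?B)"
  proof -
    have "(\<Sum>\<phi>\<in>below E. bwt k \<phi>) \<le> 1 / 9 * ?B"
      using sum_below_bwt[OF E(1), of k] mult_right_mono[OF E(2), of ?B] by linarith
    then show ?thesis unfolding sum_distrib_left[symmetric] using d by (intro mult_left_mono) auto
  qed
  \<comment> \<open>The hopping term of b_k is nonnegative, so its mean energy is at most
    \<open>2 d\<close>, which leaves \<open>3 d - 2 d = d\<close> per unit of squared norm.\<close>
  moreover have "d * (289 / 324 * ?B) \<le> (\<Sum>\<phi>\<in>\<Phi>. (3 * d + \<epsilon> - ev \<phi>) * bwt k \<phi>)"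
  proof -
    let ?s = "sqn \<Lambda> (bdry \<Lambda> k)"
    have "of_real (\<Sum>\<phi>\<in>\<Phi>. ev \<phi> * bwt k \<phi>) = of_real (2 * d * ?s) - hop \<Lambda> (bdry \<Lambda> k)"
      using quadratic_form[OF bdry_l2, of k] ip_laplacian_hop[of \<Lambda> "bdry \<Lambda> k"] by (simp add: bwt_def d_def)
    from arg_cong[OF this, of Re] have "(\<Sum>\<phi>\<in>\<Phi>. ev \<phi> * bwt k \<phi>) = 2 * d * ?s - Re (hop \<Lambda> (bdry \<Lambda> k))"
      by (simp only: Re_complex_of_real minus_complex.simps)
    then have "(\<Sum>\<phi>\<in>\<Phi>. ev \<phi> * bwt k \<phi>) \<le> 2 * d * ?s" using Re_hop_bdry_nonneg[of k] k E by simp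
    moreover have "(\<Sum>\<phi>\<in>\<Phi>. (3 * d + \<epsilon> - ev \<phi>) * bwt k \<phi>) = (3 * d + \<epsilon>) * ?s - (\<Sum>\<phi>\<in>\<Phi>. ev \<phi> * bwt k \<phi>)"
      by (simp add: left_diff_distrib sum_subtractf sum_distrib_left[symmetric] sum_bwt)
    moreover have "0 \<le> \<epsilon> * ?s" using \<epsilon>(1) by (simp add: sqn_nonneg)
    moreover have "d * (289 / 324 * ?B) \<le> d * ?s" using sqn_bdry_ge[of k] k E d by (intro mult_left_mono) auto
    ultimately show ?thesis by (simp add: algebra_simps)
  qed
  \<comment> \<open>Here \<open>145 = 289 - 144\<close>, where \<open>144 / 324 = 4 / 9\<close> is
    the loss to states below \<open>E\<close>. Rounding down to \<open>2 / 5\<close> gives the 10 of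
    the claim after division by \<open>4 d^2\<close>.\<close>
  ultimately have "145 / 324 * (d * ?B) \<le> 4 * d ^ 3 * (\<Sum>\<phi>\<in>above E. wt k \<phi>)"
    unfolding sum_below_above[of _ E] by (simp add: algebra_simps)
  moreover have "2 / 5 * (d * ?B) \<le> 145 / 324 * (d * ?B)" using d by (intro mult_right_mono) auto
  ultimately have "d * (2 / 5 * ?B) \<le> d * (4 * d\<^sup>2 * (\<Sum>\<phi>\<in>above E. wt k \<phi>))"
    by (simp add: power2_eq_square power3_eq_cube algebra_simps)
  then have "2 / 5 * ?B \<le> 4 * d\<^sup>2 * (\<Sum>\<phi>\<in>above E. wt k \<phi>)" using d by simp
  then show ?thesis using d by (simp add: d_def[symmetric] field_simps)
qed

text \<open>Inside the sea \<open>gap\<close> is at least \<open>E - dispersion k\<close> times the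
  bound of \<open>sum_above_wt_ge\<close>, and by \<open>xi_eq\<close> this factor integrates to
  \<open>xi\<close>. Outside it suffices that \<open>gap\<close> is nonnegative.\<close>

theorem gap_low_density:
  assumes \<rho>: "0 < \<rho>" "\<rho> < 1" and E: "E = fermi_level TYPE('n) \<rho>" "E \<le> 1 / 9"
  shows "real (boundary_bonds \<Lambda>) / (10 * (real CARD('n))\<^sup>2) * xi TYPE('n) \<rho> \<le> (\<integral>k. gap E k \<partial>bz)"
proof -
  let ?b = "real (boundary_bonds \<Lambda>) / (10 * (real CARD('n))\<^sup>2)"
  have E0: "0 < E" using fermi_level(1)[OF \<rho>, where 'n = 'n] E by simp
  have i: "integrable bz (\<lambda>k :: real ^ 'n. (E - dispersion k) * sea E k)"
    using integrable_dispersion_sea[of E "- 1" E, where 'a = 'n] by simp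
  have "?b * xi TYPE('n) \<rho> = (\<integral>k. ?b * ((E - dispersion k) * sea E k) \<partial>(bz :: (real ^ 'n) measure))"
    using xi_eq[OF \<rho>, where 'n = 'n] E by simp
  also have "\<dots> \<le> (\<integral>k. gap E k \<partial>bz)"
  proof (intro integral_mono integrable_mult_right i integrable_gap)
    fix k :: "real ^ 'n"
    show "?b * ((E - dispersion k) * sea E k) \<le> gap E k"
    proof (cases "dispersion k < E")
      case True
      then have "(E - dispersion k) * ?b \<le> (E - dispersion k) * (\<Sum>\<phi>\<in>above E. wt k \<phi>)"
        using sum_above_wt_ge[OF E0 E(2) True] by (intro mult_left_mono) auto
      with True show ?thesis by (simp add: gap_def mult.commute)
    qed (use gap_nonneg in simp)
  qed
  finally show ?thesis .
qed

end

section \<open>Lower bounds for the boundary constant\<close>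

text \<open>A site with the largest coordinate in some direction has an outgoing bond in that
  direction.\<close>

lemma boundary_bonds_pos:
  fixes \<Lambda> :: "(int ^ 'n::finite) set"
  assumes "finite \<Lambda>" "\<Lambda> \<noteq> {}"
  shows "0 < boundary_bonds \<Lambda>"
proof -
  obtain i :: 'n where True by simp
  define m where "m = Max ((\<lambda>x. x $ i) ` \<Lambda>)"
  have "m \<in> (\<lambda>x. x $ i) ` \<Lambda>" unfolding m_def using assms by (intro Max_in) auto
  then obtain x where x: "x \<in> \<Lambda>" "x $ i = m" by auto
  have "x + axis i 1 \<notin> \<Lambda>"
  proof
    assume "x + axis i 1 \<in> \<Lambda>"
    then have "(x + axis i 1) $ i \<in> (\<lambda>x. x $ i) ` \<Lambda>" by (rule imageI)
    then have "(x + axis i 1) $ i \<le> m" unfolding m_def using assms(1) by (intro Max_ge finite_imageI)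
    then show False using x by (simp add: axis_def)
  qed
  then have "axis i 1 \<in> outgoing \<Lambda> x" by (auto simp: outgoing_def units_eq)
  then have "0 < card (outgoing \<Lambda> x)" using finite_outgoing by (auto simp: card_gt_0_iff)
  with x assms show ?thesis by (auto simp: boundary_bonds_eq intro!: sum_pos2[of \<Lambda> x])
qed

text \<open>Reduces lower bounds for the infimum to bounds on the integrated \<open>gap\<close> that
  are uniform over domains, each of which has some eigenbasis.\<close>

lemma boundary_const_ge:
  fixes a :: real
  assumes \<rho>: "0 < \<rho>" "\<rho> < 1"
    and gap: "\<And>(\<Lambda> :: (int ^ 'n::finite) set) \<Phi> ev. eigenbasis \<Lambda> \<Phi> ev \<Longrightarrow>
      a * real (boundary_bonds \<Lambda>) \<le> (\<integral>k. eigenbasis.gap \<Lambda> \<Phi> ev (fermi_level TYPE('n) \<rho>) k \<partial>bz)"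
  shows "ereal a \<le> boundary_const TYPE('n) \<rho>"
  unfolding boundary_const_def
proof (rule INF_greatest, clarify)
  fix \<Lambda> :: "(int ^ 'n) set" and N
  assume L: "finite \<Lambda>" "\<Lambda> \<noteq> {}" and N: "real N = \<rho> * real (card \<Lambda>)"
  obtain \<Phi> ev where b: "eigenbasis \<Lambda> \<Phi> ev" by (rule eigenbasis_exists[OF L(1)])
  have "a * real (boundary_bonds \<Lambda>) \<le> lowest_sum \<Lambda> N - energy_density TYPE('n) \<rho> * real (card \<Lambda>)"
    using gap[OF b] eigenbasis.excess_ge[OF b \<rho> N refl] by linarith
  then show "ereal a \<le> ereal ((lowest_sum \<Lambda> N - energy_density TYPE('n) \<rho> * real (card \<Lambda>)) / real (boundary_bonds \<Lambda>))"
    using boundary_bonds_pos[OF L] by (simp add: field_simps)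
qed

text \<open>The cosine integral \<open>c\<close> is positive, and by continuity of
  \<open>ids\<close> some \<open>\<delta>\<close> makes the shell thin enough for
  \<open>gap_lower_bound\<close>. Neither depends on the domain.\<close>

theorem boundary_const_pos:
  assumes \<rho>: "0 < \<rho>" "\<rho> < 1"
  shows "0 < boundary_const TYPE('n::finite) \<rho>"
proof -
  define E where "E = fermi_level TYPE('n) \<rho>"
  note E = fermi_level(1,2)[OF \<rho>, where 'n = 'n, folded E_def]
  define c where "c = (\<integral>k. cos (k $ undefined) * sea E k \<partial>(bz :: (real ^ 'n) measure))"
  have c: "0 < c" unfolding c_def by (rule integral_cos_sea_pos[OF E])
  have c': "c = (\<integral>k. cos (k $ i) * sea E k \<partial>(bz :: (real ^ 'n) measure))" for i
    unfolding c_def by (rule integral_cos_sea_swap)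
  have "((\<lambda>\<delta>. ids TYPE('n) (E + \<delta>) - ids TYPE('n) (E - \<delta>)) \<longlongrightarrow> ids TYPE('n) (E + 0) - ids TYPE('n) (E - 0)) (at_right 0)"
    by (intro tendsto_diff isCont_tendsto_compose[OF isCont_ids] tendsto_intros tendsto_ident_at)
  then have "\<forall>\<^sub>F \<delta> in at_right 0. ids TYPE('n) (E + \<delta>) - ids TYPE('n) (E - \<delta>) < c\<^sup>2 / 2"
    using c by (intro order_tendstoD(2)) auto
  then have "\<forall>\<^sub>F \<delta> in at_right 0. 0 < \<delta> \<and> ids TYPE('n) (E + \<delta>) - ids TYPE('n) (E - \<delta>) < c\<^sup>2 / 2"
    using eventually_at_right_less by (rule eventually_conj[rotated])
  from eventually_happens'[OF trivial_limit_at_right_real this]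
  obtain \<delta> where \<delta>: "0 < \<delta>" "ids TYPE('n) (E + \<delta>) - ids TYPE('n) (E - \<delta>) \<le> c\<^sup>2 / 2"
    using less_imp_le by blast
  have "ereal (\<delta> * c\<^sup>2 / (32 * (real CARD('n))\<^sup>2)) \<le> boundary_const TYPE('n) \<rho>"
    by (rule boundary_const_ge[OF \<rho>])
      (rule eigenbasis.gap_lower_bound[OF _ _ c' \<delta>, folded E_def, unfolded E_def], use c in auto)
  moreover have "0 < ereal (\<delta> * c\<^sup>2 / (32 * (real CARD('n))\<^sup>2))" using c \<delta> by simp
  ultimately show ?thesis by (rule less_le_trans[rotated])
qed

theorem boundary_const_low_density:
  assumes \<rho>: "0 < \<rho>" "\<rho> < ids TYPE('n::finite) (1 / 9)"
  shows "ereal (2 / (3 * real CARD('n)) ^ 3 * xi TYPE('n) \<rho>) < boundary_const TYPE('n) \<rho>"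
proof -
  define d where "d = real CARD('n)"
  have d: "1 \<le> d" by (simp add: d_def Suc_le_eq)
  have "ids TYPE('n) (1 / 9) \<le> ids TYPE('n) (4 * d)" using d by (intro ids_mono) auto
  then have \<rho>1: "\<rho> < 1" using \<rho> by (simp add: ids_top d_def)
  have E: "fermi_level TYPE('n) \<rho> \<le> 1 / 9" using \<rho> \<rho>1 by (intro fermi_level_le) auto
  have "ereal (1 / (10 * d\<^sup>2) * xi TYPE('n) \<rho>) \<le> boundary_const TYPE('n) \<rho>"
    using eigenbasis.gap_low_density[OF _ \<rho>(1) \<rho>1 refl E]
    by (intro boundary_const_ge[OF \<rho>(1) \<rho>1]) (simp add: d_def field_simps)
  moreover have "2 / (3 * d) ^ 3 < 1 / (10 * d\<^sup>2)"
  proof -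
    \<comment> \<open>Clearing denominators reduces the claim to \<open>20 < 27 d\<close>.\<close>
    have "d\<^sup>2 * 20 < d\<^sup>2 * (27 * d)" using d by (intro mult_strict_left_mono) auto
    then show ?thesis using d by (simp add: field_simps power2_eq_square power3_eq_cube)
  qed
  then have "2 / (3 * d) ^ 3 * xi TYPE('n) \<rho> < 1 / (10 * d\<^sup>2) * xi TYPE('n) \<rho>"
    using xi_pos[OF \<rho>(1) \<rho>1, where 'n = 'n] by (rule mult_strict_right_mono)
  ultimately show ?thesis unfolding d_def by (metis ereal_less_eq(3) less_le_trans less_ereal.simps(1))
qed

section \<open>The upper bound\<close>

lemma sqn_pwl_subset:
  assumes "finite \<Lambda>" "A \<subseteq> \<Lambda>"
  shows "sqn \<Lambda> (pwl A k) = real (card A)"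
proof -
  have "sqn \<Lambda> (pwl A k) = sqn A (pwl A k)"
    unfolding sqn_def using assms by (intro sum.mono_neutral_right) (auto simp: pwl_def)
  then show ?thesis by (simp add: sqn_pwl)
qed

lemma hop_subset:
  assumes "finite \<Lambda>" "A \<subseteq> \<Lambda>" "\<psi> \<in> l2 A"
  shows "hop \<Lambda> \<psi> = hop A \<psi>"
proof -
  have z: "\<psi> x = 0" if "x \<notin> A" for x using assms(3) that by (simp add: l2_def)
  have "hop \<Lambda> \<psi> = (\<Sum>x\<in>A. \<Sum>e\<in>ingoing \<Lambda> x. cnj (\<psi> x) * \<psi> (x + e))"
    unfolding hop_def using assms z by (intro sum.mono_neutral_right) auto
  also have "\<dots> = hop A \<psi>"
    unfolding hop_def
  proof (rule sum.cong[OF refl])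
    fix x
    show "(\<Sum>e\<in>ingoing \<Lambda> x. cnj (\<psi> x) * \<psi> (x + e)) = (\<Sum>e\<in>ingoing A x. cnj (\<psi> x) * \<psi> (x + e))"
      using assms(2) z by (intro sum.mono_neutral_right finite_ingoing) (auto simp: ingoing_def)
  qed
  finally show ?thesis .
qed

context eigenbasis
begin

text \<open>A function supported in \<open>A\<close> only sees the bonds inside \<open>A\<close>, so
  the forms of the two Laplacians agree on it; on \<open>A\<close> the plane wave has energy
  \<open>dispersion k\<close> up to its overlap with the boundary vector.\<close>

lemma quadratic_form_pwl_le:
  assumes A: "A \<subseteq> \<Lambda>"
  shows "(\<Sum>\<phi>\<in>\<Phi>. ev \<phi> * (cmod (ip \<Lambda> \<phi> (pwl A k)))\<^sup>2) \<le> dispersion k * real (card A) + real (boundary_bonds A)"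
proof -
  have fA: "finite A" using A finite_domain finite_subset by blast
  have l: "pwl A k \<in> l2 \<Lambda>" using A by (auto simp: l2_def pwl_def)
  have "of_real (\<Sum>\<phi>\<in>\<Phi>. ev \<phi> * (cmod (ip \<Lambda> \<phi> (pwl A k)))\<^sup>2) = ip A (pwl A k) (laplacian A (pwl A k))"
    unfolding quadratic_form[OF l, symmetric] ip_laplacian_hop
    by (simp add: sqn_pwl_subset[OF finite_domain A] sqn_pwl hop_subset[OF finite_domain A pwl_l2])
  also have "\<dots> = of_real (dispersion k * real (card A)) + ip A (pwl A k) (bdry A k)"
  proof -
    have "ip A (pwl A k) (laplacian A (pwl A k))
        = of_real (dispersion k) * ip A (pwl A k) (pwl A k) + ip A (pwl A k) (bdry A k)"
      unfolding laplacian_pwl by (simp add: ip_def sum.distrib sum_distrib_left algebra_simps)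
    then show ?thesis by (simp add: ip_self sqn_pwl)
  qed
  finally have "(\<Sum>\<phi>\<in>\<Phi>. ev \<phi> * (cmod (ip \<Lambda> \<phi> (pwl A k)))\<^sup>2)
      = dispersion k * real (card A) + Re (ip A (pwl A k) (bdry A k))"
    by (simp add: complex_eq_iff)
  moreover have "cmod (ip A (pwl A k) (bdry A k)) \<le> (\<Sum>x\<in>A. degout A x)"
    unfolding ip_def
    by (intro sum_norm_le) (simp add: norm_mult pwl_def norm_pw norm_bdry_le)
  ultimately show ?thesis
    using complex_Re_le_cmod[of "ip A (pwl A k) (bdry A k)"] by (simp add: boundary_bonds_eq[OF fA])
qed

text \<open>The trial state fills the plane waves of the Fermi sea, cut off to \<open>A\<close>. Its
  occupation numbers \<open>w\<close> in the eigenbasis have total \<open>\<rho>\<close> times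
  \<open>card A\<close> and are at most 1 because the full zone yields the squared norm of
  \<open>\<phi>\<close> on \<open>A\<close>.\<close>

theorem lowest_sum_le_subdomain:
  assumes A: "A \<subseteq> \<Lambda>" and \<rho>: "0 < \<rho>" "\<rho> < 1" and N: "real N = \<rho> * real (card A)"
  shows "lowest_sum \<Lambda> N \<le> energy_density TYPE('n) \<rho> * real (card A) + real (boundary_bonds A)"
proof -
  define E where "E = fermi_level TYPE('n) \<rho>"
  have idsE: "ids TYPE('n) E = \<rho>" using fermi_level(3)[OF \<rho>, where 'n = 'n] by (simp add: E_def)
  define p where "p \<phi> k = (cmod (ip \<Lambda> \<phi> (pwl A k)))\<^sup>2" for \<phi> k
  define w where "w \<phi> = (\<integral>k. p \<phi> k * sea E k \<partial>bz)" for \<phi>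
  have fA: "finite A" using A finite_domain finite_subset by blast
  have l: "pwl A k \<in> l2 \<Lambda>" for k using A by (auto simp: l2_def pwl_def)
  have ip: "ip \<Lambda> \<phi> (pwl A k) = (\<Sum>x\<in>A. cnj (\<phi> x) * pw k x)" for \<phi> k
    unfolding ip_pwl[symmetric] ip_def using A finite_domain
    by (intro sum.mono_neutral_right) (auto simp: pwl_def)
  have [measurable]: "p \<phi> \<in> borel_measurable borel" for \<phi> unfolding p_def ip by measurable
  have sum_p: "(\<Sum>\<phi>\<in>\<Phi>. p \<phi> k) = real (card A)" for k
    unfolding p_def parseval[OF l, symmetric] by (rule sqn_pwl_subset[OF finite_domain A])
  have p_nn: "0 \<le> p \<phi> k" for \<phi> k by (simp add: p_def)
  have p_le: "p \<phi> k \<le> real (card A)" if "\<phi> \<in> \<Phi>" for \<phi> k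
    using member_le_sum[of \<phi> \<Phi> "\<lambda>\<phi>. p \<phi> k"] that finite_basis by (simp add: p_nn sum_p)
  have ip_int: "integrable bz (p \<phi>)" and ips: "integrable bz (\<lambda>k. p \<phi> k * sea E k)" if "\<phi> \<in> \<Phi>" for \<phi>
    using p_le[OF that] p_nn by (auto intro: integrable_bz[of _ "real (card A)"] integrable_sea[of _ "real (card A)"])
  have w0: "0 \<le> w \<phi>" for \<phi>
    unfolding w_def by (rule integral_nonneg_AE) (auto simp: p_nn)
  have w1: "w \<phi> \<le> 1" if ph: "\<phi> \<in> \<Phi>" for \<phi>
  proof -
    have "w \<phi> \<le> (\<integral>k. p \<phi> k \<partial>bz)"
      unfolding w_def by (intro integral_mono ip_int ips ph) (auto simp: p_nn split: split_indicator)
    also have "\<dots> = (\<Sum>x\<in>A. (cmod (\<phi> x))\<^sup>2)"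
      unfolding p_def ip integral_norm_trig[OF fA] by simp
    also have "\<dots> \<le> sqn \<Lambda> \<phi>" unfolding sqn_def using A finite_domain by (intro sum_mono2) auto
    finally show ?thesis using sqn_basis[OF ph] by simp
  qed
  have "(\<Sum>\<phi>\<in>\<Phi>. w \<phi>) = (\<integral>k. (\<Sum>\<phi>\<in>\<Phi>. p \<phi> k * sea E k) \<partial>bz)"
    unfolding w_def by (rule Bochner_Integration.integral_sum[symmetric]) (rule ips)
  also have "\<dots> = (\<integral>k. real (card A) * sea E k \<partial>(bz :: (real ^ 'n) measure))"
    unfolding sum_distrib_right[symmetric] sum_p ..
  also have "\<dots> = real N" unfolding integral_mult_right_zero integral_sea idsE N by simp
  finally have wN: "(\<Sum>\<phi>\<in>\<Phi>. w \<phi>) = real N" .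
  have ide: "integrable bz (\<lambda>k :: real ^ 'n. dispersion k * sea E k)"
    using integrable_dispersion_sea[of 0 1 E, where 'a = 'n] by simp
  have ids: "integrable bz (sea E :: real ^ 'n \<Rightarrow> real)" by (rule integrable_bz[of _ 1]) auto
  have "(\<Sum>\<phi>\<in>\<Phi>. w \<phi> * ev \<phi>) = (\<Sum>\<phi>\<in>\<Phi>. \<integral>k. ev \<phi> * (p \<phi> k * sea E k) \<partial>bz)"
    by (simp add: w_def mult.commute)
  also have "\<dots> = (\<integral>k. (\<Sum>\<phi>\<in>\<Phi>. ev \<phi> * (p \<phi> k * sea E k)) \<partial>bz)"
    by (rule Bochner_Integration.integral_sum[symmetric]) (intro integrable_mult_right ips)
  also have "\<dots> \<le> (\<integral>k. real (card A) * (dispersion k * sea E k) + real (boundary_bonds A) * sea E k \<partial>(bz :: (real ^ 'n) measure))"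
  proof (rule integral_mono)
    show "integrable bz (\<lambda>k. \<Sum>\<phi>\<in>\<Phi>. ev \<phi> * (p \<phi> k * sea E k))"
      by (intro Bochner_Integration.integrable_sum integrable_mult_right ips)
    show "integrable bz (\<lambda>k :: real ^ 'n. real (card A) * (dispersion k * sea E k) + real (boundary_bonds A) * sea E k)"
      by (intro Bochner_Integration.integrable_add integrable_mult_right ide ids)
    fix k :: "real ^ 'n"
    show "(\<Sum>\<phi>\<in>\<Phi>. ev \<phi> * (p \<phi> k * sea E k)) \<le> real (card A) * (dispersion k * sea E k) + real (boundary_bonds A) * sea E k"
      using quadratic_form_pwl_le[OF A, of k] by (simp add: p_def mult.commute split: split_indicator)
  qed
  also have "\<dots> = real (card A) * energy_density TYPE('n) \<rho> + real (boundary_bonds A) * \<rho>"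
    by (subst Bochner_Integration.integral_add)
      (simp_all only: integrable_mult_right ide ids integral_mult_right_zero integral_sea idsE
        energy_density_eq E_def[symmetric])
  also have "\<dots> \<le> energy_density TYPE('n) \<rho> * real (card A) + real (boundary_bonds A)"
    using mult_left_mono[of \<rho> 1 "real (boundary_bonds A)"] \<rho> by (simp add: mult.commute)
  finally show ?thesis using lowest_sum_le[of w N, OF w0 w1 wN] by linarith
qed

end

text \<open>The sea of level \<open>?E'\<close> occupies exactly the momenta where
  \<open>dispersion k - ?E'\<close> is negative, so it minimises the integral of that function among
  all seas.\<close>

lemma energy_density_convex:
  assumes \<rho>: "0 < \<rho>" "\<rho> < 1" and \<rho>': "0 < \<rho>'" "\<rho>' < 1"
  shows "energy_density TYPE('n::finite) \<rho>'
    \<le> energy_density TYPE('n) \<rho> + (\<rho>' - \<rho>) * fermi_level TYPE('n) \<rho>'"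
proof -
  let ?E = "fermi_level TYPE('n) \<rho>" and ?E' = "fermi_level TYPE('n) \<rho>'"
  have i: "integrable bz (\<lambda>k :: real ^ 'n. dispersion k * sea E k)" for E
    using integrable_dispersion_sea[of 0 1 E, where 'a = 'n] by simp
  have i': "integrable bz (\<lambda>k :: real ^ 'n. c * sea E k)" for c E :: real
    using integrable_dispersion_sea[of c 0 E, where 'a = 'n] by simp
  have e: "(\<integral>k. dispersion k * sea E k - ?E' * sea E k \<partial>(bz :: (real ^ 'n) measure))
      = (\<integral>k. dispersion k * sea E k \<partial>(bz :: (real ^ 'n) measure)) - ?E' * ids TYPE('n) E" for E
    unfolding Bochner_Integration.integral_diff[OF i i'] integral_mult_right_zero integral_sea ..
  have "(\<integral>k. dispersion k * sea ?E' k - ?E' * sea ?E' k \<partial>(bz :: (real ^ 'n) measure))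
      \<le> (\<integral>k. dispersion k * sea ?E k - ?E' * sea ?E k \<partial>(bz :: (real ^ 'n) measure))"
    by (intro integral_mono Bochner_Integration.integrable_diff i i') (auto split: split_indicator)
  then show ?thesis
    unfolding e fermi_level(3)[OF \<rho>, where 'n = 'n] fermi_level(3)[OF \<rho>', where 'n = 'n]
      energy_density_eq[symmetric] by (simp add: algebra_simps)
qed

section \<open>Trial domains made of a cube and isolated sites\<close>

definition cube :: "nat \<Rightarrow> (int ^ 'n::finite) set" where
  "cube L = {x. \<forall>i. 0 \<le> x $ i \<and> x $ i < int L}"

lemma finite_cube: "finite (cube L :: (int ^ 'n::finite) set)"
proof (rule finite_subset)
  show "cube L \<subseteq> vec_lambda ` (PiE (UNIV :: 'n set) (\<lambda>_. {0..<int L}))"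
  proof
    fix x :: "int ^ 'n" assume "x \<in> cube L"
    then have "vec_nth x \<in> PiE UNIV (\<lambda>_. {0..<int L})" by (auto simp: cube_def)
    then show "x \<in> vec_lambda ` (PiE UNIV (\<lambda>_. {0..<int L}))"
      by (metis image_eqI vec_nth_inverse)
  qed
qed (simp add: finite_PiE)

lemma card_cube_slice:
  fixes i :: "'n::finite"
  assumes c: "c \<in> {0..<int L}"
  shows "card {x \<in> cube L. x $ i = c} = card {x \<in> (cube L :: (int ^ 'n) set). x $ i = 0}"
proof (rule bij_betw_same_card)
  define s where "s a x = (\<chi> j. if j = i then a else x $ j)" for a and x :: "int ^ 'n"
  show "bij_betw (s 0) {x \<in> cube L. x $ i = c} {x \<in> cube L. x $ i = 0}"
    using c by (intro bij_betw_byWitness[of _ "s c"]) (auto simp: s_def cube_def vec_eq_iff)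
qed

lemma card_cube: "card (cube L :: (int ^ 'n::finite) set) = L * card {x \<in> (cube L :: (int ^ 'n) set). x $ i = 0}"
proof -
  have "card (cube L :: (int ^ 'n) set) = card (\<Union>c\<in>{0..<int L}. {x \<in> (cube L :: (int ^ 'n) set). x $ i = c})"
    by (rule arg_cong[of _ _ card]) (auto simp: cube_def)
  also have "\<dots> = (\<Sum>c\<in>{0..<int L}. card {x \<in> (cube L :: (int ^ 'n) set). x $ i = c})"
    by (rule card_UN_disjoint) (auto simp: finite_cube)
  also have "\<dots> = (\<Sum>c\<in>{0..<int L}. card {x \<in> (cube L :: (int ^ 'n) set). x $ i = 0})"
    by (intro sum.cong refl card_cube_slice)
  finally show ?thesis by simp
qed

text \<open>In each direction bonds leave through two opposite faces, each containing one site out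
  of \<open>L\<close>.\<close>

lemma boundary_bonds_cube:
  assumes "0 < L"
  shows "L * boundary_bonds (cube L :: (int ^ 'n::finite) set) = 2 * CARD('n) * card (cube L :: (int ^ 'n) set)"
proof -
  let ?Q = "cube L :: (int ^ 'n) set"
  have range: "0 \<le> x $ i" "x $ i < int L" if "x \<in> ?Q" for x i
    using that by (simp_all add: cube_def)
  have shift: "x + axis i c \<in> ?Q \<longleftrightarrow> 0 \<le> x $ i + c \<and> x $ i + c < int L" if x: "x \<in> ?Q" for x i c
  proof -
    have iff: "x + axis i c \<in> ?Q \<longleftrightarrow> (\<forall>j. 0 \<le> x $ j + (if j = i then c else 0) \<and> x $ j + (if j = i then c else 0) < int L)"
      by (simp add: cube_def axis_def)
    show ?thesis
    proof
      assume "x + axis i c \<in> ?Q"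
      from this[unfolded iff, THEN spec[of _ i]] show "0 \<le> x $ i + c \<and> x $ i + c < int L" by simp
    next
      assume c: "0 \<le> x $ i + c \<and> x $ i + c < int L"
      show "x + axis i c \<in> ?Q"
        unfolding iff
      proof
        fix j
        show "0 \<le> x $ j + (if j = i then c else 0) \<and> x $ j + (if j = i then c else 0) < int L"
          using c range[OF x, of j] by (cases "j = i") simp_all
      qed
    qed
  qed
  have up: "x + axis i 1 \<notin> ?Q \<longleftrightarrow> x $ i = int L - 1"
    and dn: "x + axis i (- 1) \<notin> ?Q \<longleftrightarrow> x $ i = 0" if "x \<in> ?Q" for x i
    using range[OF that, of i] unfolding shift[OF that] by auto
  \<comment> \<open>The two conditions are added rather than joined, since for \<open>L = 1\<close>
    both hold and both bonds leave.\<close>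
  have "card (outgoing ?Q x) = (\<Sum>i\<in>UNIV. of_bool (x $ i = int L - 1) + of_bool (x $ i = 0))" if x: "x \<in> ?Q" for x
  proof -
    have "card (outgoing ?Q x) = (\<Sum>e\<in>units. of_bool (x + e \<notin> ?Q))"
      by (simp add: outgoing_def finite_units sum_of_bool_eq Int_def)
    then show ?thesis unfolding sum_units by (simp add: up[OF x] dn[OF x])
  qed
  then have "boundary_bonds ?Q = (\<Sum>x\<in>?Q. \<Sum>i\<in>UNIV. of_bool (x $ i = int L - 1) + of_bool (x $ i = 0))"
    by (simp add: boundary_bonds_eq[OF finite_cube])
  also have "\<dots> = (\<Sum>i\<in>UNIV. card {x \<in> ?Q. x $ i = int L - 1} + card {x \<in> ?Q. x $ i = 0})"
    by (subst sum.swap) (simp add: finite_cube sum.distrib sum_of_bool_eq Int_def)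
  also have "\<dots> = (\<Sum>i\<in>(UNIV :: 'n set). 2 * card {x \<in> ?Q. x $ i = 0})"
  proof (rule sum.cong[OF refl])
    fix i :: 'n
    have "card {x \<in> ?Q. x $ i = int L - 1} = card {x \<in> ?Q. x $ i = 0}"
      using assms by (intro card_cube_slice) auto
    then show "card {x \<in> ?Q. x $ i = int L - 1} + card {x \<in> ?Q. x $ i = 0} = 2 * card {x \<in> ?Q. x $ i = 0}"
      by simp
  qed
  finally have "L * boundary_bonds ?Q = (\<Sum>i\<in>(UNIV :: 'n set). 2 * (L * card {x \<in> ?Q. x $ i = 0}))"
    by (simp add: sum_distrib_left mult.left_commute)
  also have "\<dots> = (\<Sum>i\<in>(UNIV :: 'n set). 2 * card ?Q)"
    by (intro sum.cong refl arg_cong[of _ _ "(*) 2"] card_cube[symmetric])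
  finally show ?thesis by simp
qed

text \<open>Sites at even negative positions on one axis, starting at -2: no two are neighbours, and
  none is adjacent to a cube, whose coordinates are nonnegative.\<close>

definition dust :: "nat \<Rightarrow> (int ^ 'n::finite) set" where
  "dust M = (\<lambda>j. axis undefined (- 2 - 2 * int j)) ` {..<M}"

lemma card_dust: "card (dust M :: (int ^ 'n::finite) set) = M"
  unfolding dust_def by (subst card_image) (auto simp: inj_on_def axis_eq_axis)

lemma finite_dust: "finite (dust M)"
  by (simp add: dust_def)

lemma cube_dust_disjoint: "cube L \<inter> dust M = {}"
proof -
  have "0 \<le> x $ undefined" if "x \<in> cube L" for x using that by (simp add: cube_def)
  moreover have "x $ undefined < 0" if "x \<in> dust M" for x using that by (auto simp: dust_def)
  ultimately show ?thesis by force
qed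

lemma outgoing_dust:
  assumes "x \<in> dust M"
  shows "outgoing (cube L \<union> dust M) x = units"
proof -
  from assms obtain j where j: "x = axis undefined (- 2 - 2 * int j)" by (auto simp: dust_def)
  have "x + e \<notin> cube L" and "x + e \<notin> dust M" if e: "e \<in> units" for e
  proof -
    have e1: "l1_norm e = 1" using e by (simp add: units_def)
    have "e $ undefined \<le> 1" using e by (auto simp: units_eq axis_def)
    then have "(x + e) $ undefined < 0" by (simp add: j)
    moreover have "0 \<le> (x + e) $ undefined" if "x + e \<in> cube L"
      using that unfolding cube_def by blast
    ultimately show "x + e \<notin> cube L" by force
    show "x + e \<notin> dust M"
    proof
      assume "x + e \<in> dust M"
      then obtain j' where "x + e = axis undefined (- 2 - 2 * int j')" by (auto simp: dust_def)
      then have "e = axis undefined (2 * int j - 2 * int j')"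
        by (auto simp: j vec_eq_iff axis_def split: if_splits)
      with e1 have "\<bar>2 * int j - 2 * int j'\<bar> = 1" by (simp add: l1_norm_axis)
      then show False by presburger
    qed
  qed
  then show ?thesis by (auto simp: outgoing_def)
qed

lemma boundary_bonds_cube_dust:
  "2 * CARD('n) * M \<le> boundary_bonds (cube L \<union> dust M :: (int ^ 'n::finite) set)"
proof -
  let ?L = "cube L \<union> dust M :: (int ^ 'n) set"
  have "2 * CARD('n) * M = (\<Sum>x\<in>(dust M :: (int ^ 'n) set). card (outgoing ?L x))"
    by (simp add: outgoing_dust card_units card_dust)
  also have "\<dots> \<le> (\<Sum>x\<in>?L. card (outgoing ?L x))" by (intro sum_mono2) (auto simp: finite_cube finite_dust)
  finally show ?thesis by (simp add: boundary_bonds_eq finite_cube finite_dust)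
qed

text \<open>The cube has \<open>t\<close> times as many sites as the dust. Putting all particles
  into the cube raises its density by the factor \<open>1 + 1 / t\<close>, and the cube surface
  costs at most \<open>1 / t\<close> per bond.\<close>

lemma boundary_const_le_cube_dust:
  assumes rat: "\<rho> \<in> \<rat>" and \<rho>: "0 < \<rho>" and t: "0 < t" "\<rho> * (1 + 1 / real t) < 1"
  shows "boundary_const TYPE('n::finite) \<rho> \<le> ereal (1 / (2 * real CARD('n))
    * (\<rho> * fermi_level TYPE('n) (\<rho> * (1 + 1 / real t)) - energy_density TYPE('n) \<rho>) + 1 / real t)"
proof -
  define d where "d = real CARD('n)"
  have d: "1 \<le> d" by (simp add: d_def Suc_le_eq)
  obtain p q :: nat where q: "q \<noteq> 0" "\<bar>\<rho>\<bar> = real p / real q" using rat by (rule Rats_abs_nat_div_natE)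
  then have pq: "\<rho> = real p / real q" using \<rho> by simp
  \<comment> \<open>The factor \<open>q\<close> makes the particle number an integer, and two
    factors \<open>t\<close> are needed: one for the volume ratio of cube to dust, one to make the
    cube surface small against the dust.\<close>
  define L where "L = q * t * t"
  have L: "0 < L" using q t by (simp add: L_def)
  define Q where "Q = (cube L :: (int ^ 'n) set)"
  define f where "f = card {x \<in> Q. x $ undefined = 0}"
  define V where "V = card Q"
  have V: "V = L * f" by (simp add: V_def Q_def f_def card_cube[of L undefined])
  have "0 \<in> Q" using L by (simp add: Q_def cube_def)
  then have V0: "0 < V" using finite_cube[of L, where 'n = 'n] by (auto simp: V_def Q_def card_gt_0_iff)
  then have f0: "0 < f" by (simp add: V)
  define M where "M = q * t * f"
  have M0: "0 < M" using q t f0 by (simp add: M_def)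
  have VM: "real V = real t * real M" by (simp add: V M_def L_def)
  define \<Lambda> where "\<Lambda> = Q \<union> dust M"
  have fin: "finite \<Lambda>" by (simp add: \<Lambda>_def Q_def finite_cube finite_dust)
  have card\<Lambda>: "card \<Lambda> = V + M"
    unfolding \<Lambda>_def V_def Q_def by (subst card_Un_disjoint) (simp_all add: finite_cube finite_dust cube_dust_disjoint card_dust)
  define N where "N = p * (t * t * f + t * f)"
  have N: "real N = \<rho> * real (card \<Lambda>)"
    using q by (simp add: N_def card\<Lambda> V M_def L_def pq field_simps)
  define \<rho>' where "\<rho>' = \<rho> * (1 + 1 / real t)"
  have \<rho>': "\<rho>' < 1" "\<rho> < \<rho>'" using \<rho> t by (simp_all add: \<rho>'_def field_simps)
  then have "0 < \<rho>'" using \<rho> by simp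
  note \<rho>' = this \<rho>'
  have \<rho>1: "\<rho> < 1" using \<rho>' by simp
  have N': "real N = \<rho>' * real (card Q)"
    using t by (simp add: N card\<Lambda> V_def[symmetric] VM \<rho>'_def field_simps)
  define E' where "E' = fermi_level TYPE('n) \<rho>'"
  let ?e = "energy_density TYPE('n)"
  obtain \<Phi> ev where b: "eigenbasis \<Lambda> \<Phi> ev" by (rule eigenbasis_exists[OF fin])
  have "lowest_sum \<Lambda> N \<le> ?e \<rho>' * real V + real (boundary_bonds Q)"
    unfolding V_def by (rule eigenbasis.lowest_sum_le_subdomain[OF b _ \<rho>'(1,2) N']) (simp add: \<Lambda>_def)
  moreover have "?e \<rho>' * real V \<le> (?e \<rho> + (\<rho>' - \<rho>) * E') * real V"
    unfolding E'_def by (intro mult_right_mono energy_density_convex \<rho> \<rho>1 \<rho>') simp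
  \<comment> \<open>The surplus density in the cube amounts to \<open>\<rho> M\<close> particles,
    those that the dust would have held.\<close>
  moreover have "(?e \<rho> + (\<rho>' - \<rho>) * E') * real V = ?e \<rho> * real V + \<rho> * real M * E'"
    using t by (simp add: VM \<rho>'_def field_simps)
  moreover have "real (boundary_bonds Q) \<le> 2 * d * real M / real t"
  proof -
    have "real L * real (boundary_bonds Q) = 2 * d * real V"
      using arg_cong[OF boundary_bonds_cube[OF L, where 'n = 'n], of real] by (simp add: Q_def V_def d_def)
    also have "\<dots> = 2 * d * real L * real f" by (simp add: V)
    finally have "real (boundary_bonds Q) = 2 * d * real f" using L by simp
    also have "\<dots> \<le> 2 * d * (real q * real f)" using q d f0 by (intro mult_left_mono) auto
    also have "\<dots> = 2 * d * real M / real t" using t by (simp add: M_def)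
    finally show ?thesis .
  qed
  ultimately have le: "lowest_sum \<Lambda> N - ?e \<rho> * real (card \<Lambda>)
      \<le> real M * (\<rho> * E' - ?e \<rho>) + 2 * d * real M / real t"
    by (simp add: card\<Lambda> algebra_simps)
  have "fermi_level TYPE('n) \<rho> \<le> E'"
    using fermi_level(3)[OF \<rho>'(1,2), where 'n = 'n] \<rho>' by (intro fermi_level_le \<rho> \<rho>1) (simp add: E'_def)
  then have "xi TYPE('n) \<rho> \<le> \<rho> * E' - ?e \<rho>" using \<rho> by (simp add: xi_def)
  \<comment> \<open>Nonnegativity of the numerator permits the denominator to be lowered to the
    bonds of the dust alone.\<close>
  then have X0: "0 \<le> \<rho> * E' - ?e \<rho>" using xi_pos[OF \<rho> \<rho>1, where 'n = 'n] by linarith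
  let ?B = "real (boundary_bonds \<Lambda>)"
  have B: "2 * d * real M \<le> ?B"
    using boundary_bonds_cube_dust[of M L, where 'n = 'n] unfolding \<Lambda>_def Q_def d_def
    by (metis of_nat_le_iff of_nat_mult of_nat_numeral)
  have B0: "0 < 2 * d * real M" using d M0 by simp
  have "(lowest_sum \<Lambda> N - ?e \<rho> * real (card \<Lambda>)) / ?B
      \<le> (real M * (\<rho> * E' - ?e \<rho>) + 2 * d * real M / real t) / ?B"
    using le by (rule divide_right_mono) simp
  also have "\<dots> \<le> (real M * (\<rho> * E' - ?e \<rho>) + 2 * d * real M / real t) / (2 * d * real M)"
    using B B0 X0 d by (intro divide_left_mono) auto
  also have "\<dots> = 1 / (2 * d) * (\<rho> * E' - ?e \<rho>) + 1 / real t"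
    using d M0 by (simp add: field_simps)
  finally have fin_le: "(lowest_sum \<Lambda> N - ?e \<rho> * real (card \<Lambda>)) / ?B \<le> \<dots>" .
  have "boundary_const TYPE('n) \<rho> \<le> ereal ((lowest_sum \<Lambda> N - ?e \<rho> * real (card \<Lambda>)) / ?B)"
    unfolding boundary_const_def
    by (rule INF_lower2[of "(\<Lambda>, N)"]) (use fin N \<open>0 \<in> Q\<close> in \<open>auto simp: \<Lambda>_def\<close>)
  also have "\<dots> \<le> ereal (1 / (2 * d) * (\<rho> * E' - ?e \<rho>) + 1 / real t)" using fin_le by simp
  finally show ?thesis by (simp add: d_def E'_def \<rho>'_def)
qed

text \<open>Letting \<open>t\<close> grow in \<open>boundary_const_le_cube_dust\<close> makes the
  raised density tend to \<open>\<rho>\<close>, so its Fermi level is eventually at most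
  \<open>E + \<eta>\<close>.\<close>

theorem boundary_const_upper:
  assumes rat: "\<rho> \<in> \<rat>" and \<rho>: "0 < \<rho>" "\<rho> < 1"
  shows "boundary_const TYPE('n::finite) \<rho> \<le> ereal (1 / (2 * real CARD('n)) * xi TYPE('n) \<rho>)"
proof (rule ereal_le_epsilon2)
  fix \<epsilon> :: real assume \<epsilon>: "0 < \<epsilon>"
  define d where "d = real CARD('n)"
  have d: "1 \<le> d" by (simp add: d_def Suc_le_eq)
  define E where "E = fermi_level TYPE('n) \<rho>"
  note E = fermi_level[OF \<rho>, where 'n = 'n, folded E_def d_def]
  \<comment> \<open>The cap \<open>4 d - E\<close> keeps \<open>E + \<eta>\<close> in the range
    where \<open>ids\<close> is strictly increasing, which gives \<open>lt\<close>.\<close>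
  define \<eta> where "\<eta> = min (\<epsilon> / 2) (4 * d - E)"
  have \<eta>: "0 < \<eta>" "\<eta> \<le> \<epsilon> / 2" "E + \<eta> \<le> 4 * d" using \<epsilon> E(1,2) by (auto simp: \<eta>_def min_def)
  have lt: "\<rho> < ids TYPE('n) (E + \<eta>)"
    using ids_strict_mono[of E "E + \<eta>", where 'n = 'n] E \<eta> by (simp add: d_def)
  have "(\<lambda>t. \<rho> * (1 + 1 / real t)) \<longlonglongrightarrow> \<rho> * (1 + 0)"
    by (intro tendsto_intros lim_1_over_n)
  then have "\<forall>\<^sub>F t in sequentially. \<rho> * (1 + 1 / real t) < min 1 (ids TYPE('n) (E + \<eta>))"
    using lt \<rho> by (intro order_tendstoD(2)) auto
  moreover have "\<forall>\<^sub>F t in sequentially. 1 / real t < \<epsilon> / 2"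
    using lim_1_over_n \<epsilon> by (intro order_tendstoD(2)) auto
  moreover have "\<forall>\<^sub>F t :: nat in sequentially. 0 < t" by (rule eventually_gt_at_top)
  ultimately have "\<forall>\<^sub>F t in sequentially. \<rho> * (1 + 1 / real t) < min 1 (ids TYPE('n) (E + \<eta>))
      \<and> 1 / real t < \<epsilon> / 2 \<and> 0 < t"
    by eventually_elim auto
  then obtain t :: nat where t: "\<rho> * (1 + 1 / real t) < 1" "\<rho> * (1 + 1 / real t) \<le> ids TYPE('n) (E + \<eta>)"
      "1 / real t < \<epsilon> / 2" "0 < t"
    by (auto dest!: eventually_happens)
  have "0 < \<rho> * (1 + 1 / real t)" using \<rho> by (intro mult_pos_pos add_pos_nonneg) auto
  then have "fermi_level TYPE('n) (\<rho> * (1 + 1 / real t)) \<le> E + \<eta>" using t by (intro fermi_level_le)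
  then have "\<rho> * fermi_level TYPE('n) (\<rho> * (1 + 1 / real t)) \<le> \<rho> * (E + \<eta>)"
    using \<rho> by (intro mult_left_mono) auto
  moreover have "\<rho> * \<eta> \<le> \<eta>" using \<rho> \<eta> by (intro mult_left_le_one_le) auto
  ultimately have "\<rho> * fermi_level TYPE('n) (\<rho> * (1 + 1 / real t)) \<le> \<rho> * E + \<eta>"
    unfolding distrib_left[of \<rho> E \<eta>] by linarith
  then have "\<rho> * fermi_level TYPE('n) (\<rho> * (1 + 1 / real t)) - energy_density TYPE('n) \<rho> \<le> xi TYPE('n) \<rho> + \<eta>"
    by (simp add: xi_def E_def)
  then have "1 / (2 * d) * (\<rho> * fermi_level TYPE('n) (\<rho> * (1 + 1 / real t)) - energy_density TYPE('n) \<rho>)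
      \<le> 1 / (2 * d) * (xi TYPE('n) \<rho> + \<eta>)"
    using d by (intro mult_left_mono) auto
  also have "\<dots> \<le> 1 / (2 * d) * xi TYPE('n) \<rho> + \<epsilon> / 2"
  proof -
    have "1 / (2 * d) * \<eta> \<le> 1 * \<eta>" using d \<eta> by (intro mult_right_mono) auto
    then show ?thesis using \<eta> by (simp add: distrib_left)
  qed
  finally have "1 / (2 * d) * (\<rho> * fermi_level TYPE('n) (\<rho> * (1 + 1 / real t)) - energy_density TYPE('n) \<rho>)
      + 1 / real t \<le> 1 / (2 * d) * xi TYPE('n) \<rho> + \<epsilon>" using t by linarith
  then show "boundary_const TYPE('n) \<rho> \<le> ereal (1 / (2 * real CARD('n)) * xi TYPE('n) \<rho>) + ereal \<epsilon>"
    using boundary_const_le_cube_dust[OF rat \<rho>(1) t(4,1), where 'n = 'n]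
    by (simp add: d_def) (metis ereal_less_eq(3) order_trans)
qed

theorem theorem2:
  fixes d :: real
  defines "d \<equiv> real CARD('n::finite)"
  shows "(\<forall>\<rho>\<in>\<rat>. 0 < \<rho> \<and> \<rho> \<le> 1 / 2 \<longrightarrow>
            0 < boundary_const TYPE('n) \<rho> \<and>
            boundary_const TYPE('n) \<rho> \<le> ereal (1 / (2 * d) * xi TYPE('n) \<rho>))
       \<and> (\<exists>C \<rho>\<^sub>0 :: real. 0 < \<rho>\<^sub>0 \<and>
            (\<forall>\<rho>\<in>\<rat>. 0 < \<rho> \<and> \<rho> < \<rho>\<^sub>0 \<longrightarrow>
              boundary_const TYPE('n) \<rho> >
                ereal (2 / (3 * d) ^ 3 * xi TYPE('n) \<rho> * (1 - C * \<rho> powr (2 / d)))))"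
proof (intro conjI ballI impI)
  fix \<rho> :: real assume "\<rho> \<in> \<rat>" "0 < \<rho> \<and> \<rho> \<le> 1 / 2"
  then show "0 < boundary_const TYPE('n) \<rho>"
    and "boundary_const TYPE('n) \<rho> \<le> ereal (1 / (2 * d) * xi TYPE('n) \<rho>)"
    using boundary_const_pos[of \<rho>, where 'n = 'n] boundary_const_upper[of \<rho>, where 'n = 'n]
    by (auto simp: d_def)
next
  \<comment> \<open>The witnesses are \<open>C = 0\<close> and the density whose Fermi level is
    \<open>1 / 9\<close>, or 1 if \<open>1 / 9\<close> exceeded the band; \<open>ids_pos\<close>
    makes it positive.\<close>
  show "\<exists>C \<rho>\<^sub>0 :: real. 0 < \<rho>\<^sub>0 \<and> (\<forall>\<rho>\<in>\<rat>. 0 < \<rho> \<and> \<rho> < \<rho>\<^sub>0 \<longrightarrow>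
      boundary_const TYPE('n) \<rho> > ereal (2 / (3 * d) ^ 3 * xi TYPE('n) \<rho> * (1 - C * \<rho> powr (2 / d))))"
    using boundary_const_low_density[where 'n = 'n] ids_pos[of "1 / 9", where 'n = 'n]
    by (intro exI[of _ 0] exI[of _ "ids TYPE('n) (1 / 9)"]) (simp add: d_def)
qed

end
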